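(* The potential $q(x)$ in the boundary value problem $$-y''+q(x)y=\lambda^2\rho(x)y,\quad 0\le x<+\infty,\qquad (\beta_0+i\beta_1\lambda+\beta_2\lambda^2)y'(0)+(\alpha_0+i\alpha_1\lambda+\alpha_2\lambda^2)y(0)=0$$ is uniquely determined by the scattering data. That is, with $\rho$ and $\alpha_i,\beta_i$ $(i=0,1,2)$ as in the context, if two such problems with the same $\rho$, $\alpha_i$, $\beta_i$ and with real-valued potentials $q$ and $\tilde q$ satisfying $\int_0^{+\infty}(1+x)|q(x)|\,dx<+\infty$ and $\int_0^{+\infty}(1+x)|\tilde q(x)|\,dx<+\infty$ have the same scattering data $\{S(\lambda)\ (-\infty<\lambda<+\infty);\ \lambda_k;\ m_k\ (k=1,\dots,n)\}$, then $q(x)=\tilde q(x)$ for almost every $x\in[0,+\infty)$.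
   Context: Here $\lambda$ is a spectral parameter; $\rho(x)=\alpha^2$ for $0\le x<a$ and $\rho(x)=1$ for $x>a$, with $a>0$ and $0<\alpha\ne1$; and $\alpha_i,\beta_i$ are real numbers with $\delta_1:=\alpha_0\beta_1-\alpha_1\beta_0\le0$, $\delta_2:=\alpha_0\beta_2-\alpha_2\beta_0\le0$, $\delta_3:=\alpha_1\beta_2-\alpha_2\beta_1\ge0$. Solutions are continuous together with their first derivative at $x=a$. Primes denote $x$-derivatives and bars denote complex conjugation. Set $\mu^{\pm}(x)=\pm x\sqrt{\rho(x)}+a(1\mp\sqrt{\rho(x)})$ and $$e_0(x,\lambda)=\tfrac12\Big(1+\tfrac1{\sqrt{\rho(x)}}\Big)e^{i\lambda\mu^+(x)}+\tfrac12\Big(1-\tfrac1{\sqrt{\rho(x)}}\Big)e^{i\lambda\mu^-(x)}.$$ It is known that for every $\lambda$ with $\operatorname{Im}\lambda\ge0$ the differential equation has a unique solution (the Jost solution) of the form $e(x,\lambda)=e_0(x,\lambda)+\int_{\mu^+(x)}^{+\infty}K(x,t)e^{i\lambda t}\,dt$, where $K(x,\cdot)\in L_1(\mu^+(x),+\infty)$ does not depend on $\lambda$. For $\operatorname{Im}\lambda\ge 0$ put $$E(\lambda)=(\beta_0+i\beta_1\lambda+\beta_2\lambda^2)e'(0,\lambda)+(\alpha_0+i\alpha_1\lambda+\alpha_2\lambda^2)e(0,\lambda),$$ and for real $\lambda\neq0$ define the scattering function $$S(\lambda)=\frac{(\beta_0+i\beta_1\lambda+\beta_2\lambda^2)\overline{e'(0,\lambda)}+(\alpha_0+i\alpha_1\lambda+\alpha_2\lambda^2)\overline{e(0,\lambda)}}{E(\lambda)}.$$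 The zeros of $E$ in $\operatorname{Im}\lambda>0$ are finite in number, simple and purely imaginary; they are denoted $i\lambda_1,\dots,i\lambda_n$ with $\lambda_k>0$. The normalizing numbers $m_k$ are given by $$m_k^{-2}=\int_0^{+\infty}|e(x,i\lambda_k)|^2\rho(x)\,dx-\frac{(\delta_1+2\delta_2\lambda_k-\delta_3\lambda_k^2)\,|e(0,i\lambda_k)|^2}{2\lambda_k(\beta_0-\beta_1\lambda_k-\beta_2\lambda_k^2)^2}.$$ The scattering data of the problem are $\{S(\lambda)\ (-\infty<\lambda<+\infty);\ \lambda_k;\ m_k\ (k=1,\dots,n)\}$. *)

theory Defs
  imports "HOL-Analysis.Analysis"
begin

text \<open>
  The equation is \<open>- y'' + q y = \<lambda>\<^sup>2 \<rho> y\<close> on \<open>[0, \<infinity>)\<close>. The value of \<open>\<rho>\<close> at the jump point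
  \<open>a\<close> is immaterial: there both branches of \<open>mu_plus\<close>, \<open>mu_minus\<close> and \<open>jost_e0\<close> agree.
\<close>

definition rho :: "real \<Rightarrow> real \<Rightarrow> real \<Rightarrow> real" where
  "rho a \<alpha> x = (if x < a then \<alpha>\<^sup>2 else 1)"

definition mu_plus :: "real \<Rightarrow> real \<Rightarrow> real \<Rightarrow> real" where
  "mu_plus a \<alpha> x = x * sqrt (rho a \<alpha> x) + a * (1 - sqrt (rho a \<alpha> x))"

definition mu_minus :: "real \<Rightarrow> real \<Rightarrow> real \<Rightarrow> real" where
  "mu_minus a \<alpha> x = - x * sqrt (rho a \<alpha> x) + a * (1 + sqrt (rho a \<alpha> x))"

definition jost_e0 :: "real \<Rightarrow> real \<Rightarrow> real \<Rightarrow> complex \<Rightarrow> complex" where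
  "jost_e0 a \<alpha> x l =
     of_real (1 / 2 * (1 + 1 / sqrt (rho a \<alpha> x))) * exp (\<i> * l * of_real (mu_plus a \<alpha> x)) +
     of_real (1 / 2 * (1 - 1 / sqrt (rho a \<alpha> x))) * exp (\<i> * l * of_real (mu_minus a \<alpha> x))"

text \<open>
  Since \<open>q\<close> is only integrable, solutions are meant in the Caratheodory sense: \<open>y\<close> is
  differentiable everywhere (so \<open>y\<close> and \<open>y'\<close> are continuous also at \<open>a\<close>), \<open>y'\<close> is locally
  absolutely continuous, that is, the indefinite Lebesgue integral of a locally integrable
  \<open>y''\<close>, and the equation holds almost everywhere.
\<close>

definition solves_sl :: "real \<Rightarrow> real \<Rightarrow> (real \<Rightarrow> real) \<Rightarrow> complex \<Rightarrow> (real \<Rightarrow> complex) \<Rightarrow> bool" where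
  "solves_sl a \<alpha> q l y \<longleftrightarrow>
     (\<exists>y' y''.
        (\<forall>x\<ge>0. (y has_vector_derivative y' x) (at x within {0..})) \<and>
        (\<forall>x\<ge>0. set_integrable lebesgue {0..x} y'' \<and>
                y' x = y' 0 + (LINT t:{0..x}|lebesgue. y'' t)) \<and>
        (AE x in lebesgue. x \<ge> 0 \<longrightarrow>
           - y'' x + of_real (q x) * y x = l\<^sup>2 * of_real (rho a \<alpha> x) * y x))"

text \<open>
  \<open>e x l\<close> is constrained only for \<open>x \<ge> 0\<close> and \<open>Im l \<ge> 0\<close>. The kernel \<open>K\<close> is chosen before \<open>l\<close>.
  The integral representation alone does not determine \<open>e\<close>: for \<open>q = 0\<close> and \<open>x > a\<close>,
  the functions \<open>e\<^sup>i\<^sup>l\<^sup>x (1 + (\<integral>\<^sub>0\<^sup>\<infinity> k(s) e\<^sup>i\<^sup>l\<^sup>s ds))\<close> with any integrable \<open>k\<close> have the same form, with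
  \<open>K(x, t) = k(t - x)\<close>. Uniqueness comes from the normalization at infinity that
  the term ``Jost solution'' entails, which is therefore part of the definition.
\<close>

definition jost_solution ::
  "real \<Rightarrow> real \<Rightarrow> (real \<Rightarrow> real) \<Rightarrow> (real \<Rightarrow> complex \<Rightarrow> complex) \<Rightarrow> bool" where
  "jost_solution a \<alpha> q e \<longleftrightarrow>
     (\<exists>K :: real \<Rightarrow> real \<Rightarrow> complex.
        (\<forall>x\<ge>0. set_integrable lebesgue {mu_plus a \<alpha> x..} (K x)) \<and>
        (\<forall>l. Im l \<ge> 0 \<longrightarrow>
           solves_sl a \<alpha> q l (\<lambda>x. e x l) \<and>
           ((\<lambda>x. e x l * exp (- (\<i> * l * of_real x))) \<longlongrightarrow> 1) at_top \<and>
           (\<forall>x\<ge>0. e x l = jost_e0 a \<alpha> x l +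
              (LINT t:{mu_plus a \<alpha> x..}|lebesgue. K x t * exp (\<i> * l * of_real t)))))"

definition deriv0 :: "(real \<Rightarrow> complex \<Rightarrow> complex) \<Rightarrow> complex \<Rightarrow> complex" where
  "deriv0 e l = vector_derivative (\<lambda>x. e x l) (at 0 within {0..})"

text \<open>
  The coefficients \<open>\<alpha>\<^sub>0, \<alpha>\<^sub>1, \<alpha>\<^sub>2\<close> and \<open>\<beta>\<^sub>0, \<beta>\<^sub>1, \<beta>\<^sub>2\<close> of the boundary condition are passed as functions
  \<open>\<alpha>s\<close>, \<open>\<beta>s\<close> on \<open>nat\<close>, of which only the values at \<open>0, 1, 2\<close> are used.
\<close>

definition bc_poly :: "(nat \<Rightarrow> real) \<Rightarrow> complex \<Rightarrow> complex" where
  "bc_poly c l = of_real (c 0) + \<i> * of_real (c 1) * l + of_real (c 2) * l\<^sup>2"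

definition E_fun ::
  "(nat \<Rightarrow> real) \<Rightarrow> (nat \<Rightarrow> real) \<Rightarrow> (real \<Rightarrow> complex \<Rightarrow> complex) \<Rightarrow> complex \<Rightarrow> complex" where
  "E_fun \<alpha>s \<beta>s e l = bc_poly \<beta>s l * deriv0 e l + bc_poly \<alpha>s l * e 0 l"

definition S_fun ::
  "(nat \<Rightarrow> real) \<Rightarrow> (nat \<Rightarrow> real) \<Rightarrow> (real \<Rightarrow> complex \<Rightarrow> complex) \<Rightarrow> real \<Rightarrow> complex" where
  "S_fun \<alpha>s \<beta>s e r =
     (bc_poly \<beta>s (of_real r) * cnj (deriv0 e (of_real r)) +
      bc_poly \<alpha>s (of_real r) * cnj (e 0 (of_real r))) / E_fun \<alpha>s \<beta>s e (of_real r)"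

definition delta1 :: "(nat \<Rightarrow> real) \<Rightarrow> (nat \<Rightarrow> real) \<Rightarrow> real" where
  "delta1 \<alpha>s \<beta>s = \<alpha>s 0 * \<beta>s 1 - \<alpha>s 1 * \<beta>s 0"

definition delta2 :: "(nat \<Rightarrow> real) \<Rightarrow> (nat \<Rightarrow> real) \<Rightarrow> real" where
  "delta2 \<alpha>s \<beta>s = \<alpha>s 0 * \<beta>s 2 - \<alpha>s 2 * \<beta>s 0"

definition delta3 :: "(nat \<Rightarrow> real) \<Rightarrow> (nat \<Rightarrow> real) \<Rightarrow> real" where
  "delta3 \<alpha>s \<beta>s = \<alpha>s 1 * \<beta>s 2 - \<alpha>s 2 * \<beta>s 1"

definition norming_num :: "(nat \<Rightarrow> real) \<Rightarrow> (nat \<Rightarrow> real) \<Rightarrow> real \<Rightarrow> real" where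
  "norming_num \<alpha>s \<beta>s r = delta1 \<alpha>s \<beta>s + 2 * delta2 \<alpha>s \<beta>s * r - delta3 \<alpha>s \<beta>s * r\<^sup>2"

definition norming_den :: "(nat \<Rightarrow> real) \<Rightarrow> real \<Rightarrow> real" where
  "norming_den \<beta>s r = \<beta>s 0 - \<beta>s 1 * r - \<beta>s 2 * r\<^sup>2"

text \<open>The right-hand side of the formula for \<open>m\<^sub>k\<^sup>-\<^sup>2\<close>, with \<open>r = \<lambda>\<^sub>k\<close>.\<close>

definition norming_value ::
  "real \<Rightarrow> real \<Rightarrow> (nat \<Rightarrow> real) \<Rightarrow> (nat \<Rightarrow> real) \<Rightarrow> (real \<Rightarrow> complex \<Rightarrow> complex) \<Rightarrow> real \<Rightarrow> real" where
  "norming_value a \<alpha> \<alpha>s \<beta>s e r =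
     (LINT x:{0..}|lebesgue. (norm (e x (\<i> * of_real r)))\<^sup>2 * rho a \<alpha> x) -
     norming_num \<alpha>s \<beta>s r * (norm (e 0 (\<i> * of_real r)))\<^sup>2 / (2 * r * (norming_den \<beta>s r)\<^sup>2)"

text \<open>
  \<open>{S; \<lambda>\<^sub>k; m\<^sub>k (k = 1, \<dots>, n)}\<close> is the scattering data of the problem with potential \<open>q\<close>.
  The value \<open>S 0\<close> is not part of the data. That the zeros of \<open>E\<close> in the upper half plane are finitely
  many, purely imaginary and simple is what makes the data of this form. The condition on
  \<open>norming_den\<close> says that \<open>m\<^sub>k\<close> is well defined: a zero denominator is admitted only if
  \<open>\<delta>\<^sub>1 + 2 \<delta>\<^sub>2 \<lambda>\<^sub>k - \<delta>\<^sub>3 \<lambda>\<^sub>k\<^sup>2 = 0\<close> (as for the condition \<open>y(0) = 0\<close>), the fraction then being read as \<open>0\<close>.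
\<close>

definition scattering_data ::
  "real \<Rightarrow> real \<Rightarrow> (nat \<Rightarrow> real) \<Rightarrow> (nat \<Rightarrow> real) \<Rightarrow> (real \<Rightarrow> real) \<Rightarrow>
   (real \<Rightarrow> complex) \<Rightarrow> nat \<Rightarrow> (nat \<Rightarrow> real) \<Rightarrow> (nat \<Rightarrow> real) \<Rightarrow> bool" where
  "scattering_data a \<alpha> \<alpha>s \<beta>s q S n lam m \<longleftrightarrow>
     (\<exists>e. jost_solution a \<alpha> q e \<and>
        (\<forall>r. r \<noteq> 0 \<longrightarrow> S r = S_fun \<alpha>s \<beta>s e r) \<and>
        inj_on lam {1..n} \<and> (\<forall>k\<in>{1..n}. lam k > 0) \<and>
        {l. Im l > 0 \<and> E_fun \<alpha>s \<beta>s e l = 0} = (\<lambda>k. \<i> * of_real (lam k)) ` {1..n} \<and>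
        (\<forall>k\<in>{1..n}. deriv (E_fun \<alpha>s \<beta>s e) (\<i> * of_real (lam k)) \<noteq> 0) \<and>
        (\<forall>k\<in>{1..n}.
           (norming_den \<beta>s (lam k) = 0 \<longrightarrow> norming_num \<alpha>s \<beta>s (lam k) = 0) \<and>
           1 / (m k)\<^sup>2 = norming_value a \<alpha> \<alpha>s \<beta>s e (lam k)))"

end

theory Submission
  imports Defs "HOL-Complex_Analysis.Complex_Analysis"
begin

text \<open>
  Let \<open>phi\<close> be the solution with \<open>phi(0) = B\<close>, \<open>phi'(0) = - A\<close>, where \<open>A\<close>, \<open>B\<close> are the polynomials of the boundary
  condition, so that \<open>E\<close> is the Wronskian of \<open>phi\<close> and the Jost solution \<open>e\<close>. For real \<open>\<lambda> \<noteq> 0\<close> one has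
  \<open>2 \<i> \<lambda> phi / E = cnj e - S e\<close>. For two problems with the same \<open>S\<close>, the function
  \<open>F(\<lambda>) = \<lambda> (phi e\<^sub>2 / E - phi\<^sub>2 e / E\<^sub>2)\<close>, taken at a fixed \<open>x\<close>, therefore equals \<open>Im (cnj e e\<^sub>2)\<close> on the real line:
  \<open>S\<close> drops out, \<open>F\<close> is real and odd there, and it extends to the lower half plane by reflection. Equality of the norming
  numbers makes the residues at the \<open>\<i> \<lambda>\<^sub>k\<close> cancel.

  The signs of the \<open>\<delta>\<^sub>i\<close> make the fluxes \<open>Im (e' cnj e)\<close> and \<open>Im (phi' cnj phi)\<close> have opposite signs, which gives
  \<open>\<bar>phi / E\<bar> \<le> \<bar>e\<bar> / \<bar>Im (e' cnj e)\<bar>\<close> without any asymptotics of \<open>phi\<close> or \<open>E\<close>. Hence \<open>\<bar>F(\<lambda>)\<bar> \<le> C \<bar>\<lambda>\<bar> / \<bar>Re \<lambda>\<bar>\<close> for small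
  and for large \<open>\<lambda>\<close>, so that \<open>F\<close> is constant by a Liouville argument, and zero because it is odd. Differentiating
  \<open>phi e\<^sub>2 / E = phi\<^sub>2 e / E\<^sub>2\<close> in \<open>x\<close> gives \<open>e\<^sup>2 = e\<^sub>2\<^sup>2\<close>, hence the same potential.
\<close>

subsection \<open>Indefinite integrals and Caratheodory solutions\<close>

text \<open>The exponentials cancel because both problems share rho: phi / E grows at most like exp
  (Im l mu_plus), and the Jost solution of the other problem decays like the inverse. What is lost
  is the factor |Re l| of the flux, which vanishes on the imaginary axis, where the zeros of E lie.
  Near l = 0 nothing is known about the size of E. There the flux, 2 Re l Im l times the integral of
  rho |e|^2 over a half line, still has a lower bound proportional to |Re l|, since the integral
  contributes 1 / Im l. This needs |e| to be comparable to the free exponential beyond one point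
  that does not depend on l, and the finite first moment of q provides it. The kernel representation
  gives regularity of e in l but not of e'; the latter is found by expanding e in fundamental
  solutions that are entire in l. If all three delta vanish, the boundary polynomials may have
  common zeros in the closed half plane, where E vanishes for every potential and S is 0 / 0. This
  case is reduced to a boundary condition with constant coefficients.\<close>

lemma absolutely_integrable_mult_continuous:
  fixes f g :: "real \<Rightarrow> complex"
  assumes "f absolutely_integrable_on {c..d}" "continuous_on {c..d} g"
  shows "(\<lambda>t. f t * g t) absolutely_integrable_on {c..d}"
proof -
  have "(\<lambda>t. g t * f t) absolutely_integrable_on {c..d}"
  proof (rule absolutely_integrable_bounded_measurable_product[where h = "(*)" and f = g and g = f])
    show "bilinear ((*) :: complex \<Rightarrow> complex \<Rightarrow> complex)"
      by (simp add: bilinear_times)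
    show "g \<in> borel_measurable (lebesgue_on {c..d})"
      by (rule continuous_imp_measurable_on_sets_lebesgue[OF assms(2)]) auto
    show "bounded (g ` {c..d})"
      using assms(2) compact_Icc compact_continuous_image compact_imp_bounded by blast
  qed (use assms in auto)
  then show ?thesis by (simp add: mult.commute)
qed

text \<open>A local estimate adds up along a chain of short steps. It replaces a mean value theorem
  where \<open>D\<close> need not be differentiable.\<close>

lemma norm_increment_le:
  fixes D :: "real \<Rightarrow> 'a::real_normed_vector" and P :: "real \<Rightarrow> real"
  assumes "0 < \<delta>" "c \<le> d"
    and step: "\<And>u v. c \<le> u \<Longrightarrow> u \<le> v \<Longrightarrow> v \<le> d \<Longrightarrow> v - u < \<delta> \<Longrightarrow> norm (D v - D u) \<le> P v - P u"
  shows "norm (D d - D c) \<le> P d - P c"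
proof -
  have *: "norm (D v - D c) \<le> P v - P c" if "c \<le> v" "v \<le> d" "v - c \<le> real n * (\<delta>/2)" for n v
    using that
  proof (induction n arbitrary: v)
    case 0
    then have "v = c" by auto
    then show ?case by simp
  next
    case (Suc n)
    \<comment> \<open>Half a step back, so that \<open>v - u\<close> stays strictly below the
      admissible length, cut off at \<open>c\<close>.\<close>
    define u where "u = max c (v - \<delta>/2)"
    have u: "c \<le> u" "u \<le> v" "u \<le> d" "u - c \<le> real n * (\<delta>/2)" "v - u < \<delta>"
      using Suc.prems \<open>0 < \<delta>\<close> by (auto simp: u_def max_def algebra_simps)
    have "norm (D v - D c) \<le> norm (D v - D u) + norm (D u - D c)"
      by (metis add.commute add_diff_eq diff_add_cancel norm_triangle_ineq)
    then show ?case using Suc.IH[of u] step[of u v] u Suc.prems by linarith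
  qed
  obtain n :: nat where "(d - c) / (\<delta>/2) \<le> real n" using real_arch_simple by blast
  then have "d - c \<le> real n * (\<delta>/2)" using \<open>0 < \<delta>\<close> by (simp add: field_simps)
  with * assms(2) show ?thesis by blast
qed

text \<open>Leibniz rule for absolutely continuous functions, from uniform continuity alone: over a
  short interval the defect \<open>D\<close> changes by at most \<open>e\<close> times the integral
  of |f| + |g|, and \<open>norm_increment_le\<close> adds these contributions up.\<close>

lemma integral_product_rule:
  fixes F G f g :: "real \<Rightarrow> complex"
  assumes cd: "c \<le> d"
    and f: "f absolutely_integrable_on {c..d}" and g: "g absolutely_integrable_on {c..d}"
    and F: "\<And>x. x \<in> {c..d} \<Longrightarrow> F x = F c + integral {c..x} f"
    and G: "\<And>x. x \<in> {c..d} \<Longrightarrow> G x = G c + integral {c..x} g"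
  shows "((\<lambda>t. f t * G t + F t * g t) has_integral (F d * G d - F c * G c)) {c..d}"
proof -
  have fi: "f integrable_on {c..d}" "g integrable_on {c..d}"
    using f g absolutely_integrable_on_def by blast+
  have "continuous_on {c..d} (\<lambda>x. F c + integral {c..x} f)"
    by (intro continuous_intros indefinite_integral_continuous_1 fi)
  then have contF: "continuous_on {c..d} F" using F by (metis (no_types, lifting) continuous_on_cong)
  have "continuous_on {c..d} (\<lambda>x. G c + integral {c..x} g)"
    by (intro continuous_intros indefinite_integral_continuous_1 fi)
  then have contG: "continuous_on {c..d} G" using G by (metis (no_types, lifting) continuous_on_cong)
  define h where "h = (\<lambda>t. f t * G t + g t * F t)"
  have h: "h absolutely_integrable_on {c..d}"
    unfolding h_def by (intro set_integral_add(1) absolutely_integrable_mult_continuous f g contF contG)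
  have Fd: "F v - F u = integral {u..v} f" "G v - G u = integral {u..v} g"
    if "c \<le> u" "u \<le> v" "v \<le> d" for u v
  proof -
    have "integral {c..u} f + integral {u..v} f = integral {c..v} f"
      by (rule Henstock_Kurzweil_Integration.integral_combine) (use that fi in \<open>auto intro: integrable_subinterval_real\<close>)
    then show "F v - F u = integral {u..v} f" using F[of u] F[of v] that by (auto simp: algebra_simps)
    have "integral {c..u} g + integral {u..v} g = integral {c..v} g"
      by (rule Henstock_Kurzweil_Integration.integral_combine) (use that fi in \<open>auto intro: integrable_subinterval_real\<close>)
    then show "G v - G u = integral {u..v} g" using G[of u] G[of v] that by (auto simp: algebra_simps)
  qed
  define p where "p = (\<lambda>t. norm (f t) + norm (g t))"
  have p: "p integrable_on {c..d}"
    unfolding p_def using f g by (intro integrable_add) (auto simp: absolutely_integrable_on_def)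
  have p0: "0 \<le> p t" for t by (simp add: p_def)
  define D where "D = (\<lambda>x. F x * G x - integral {c..x} h)"
  have hi: "h integrable_on {c..d}" using h absolutely_integrable_on_def by blast
  have key: "norm (D d - D c) \<le> e * integral {c..d} p" if e: "e > 0" for e
  proof -
    have "uniformly_continuous_on {c..d} F" "uniformly_continuous_on {c..d} G"
      using compact_uniformly_continuous contF contG by blast+
    then obtain d1 d2 where d1: "d1 > 0" "\<And>x y. x \<in> {c..d} \<Longrightarrow> y \<in> {c..d} \<Longrightarrow> dist y x < d1 \<Longrightarrow> dist (F y) (F x) < e"
      and d2: "d2 > 0" "\<And>x y. x \<in> {c..d} \<Longrightarrow> y \<in> {c..d} \<Longrightarrow> dist y x < d2 \<Longrightarrow> dist (G y) (G x) < e"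
      unfolding uniformly_continuous_on_def using e by metis
    have "norm (D d - D c) \<le> e * integral {c..d} p - e * integral {c..c} p"
    proof (rule norm_increment_le[where \<delta> = "min d1 d2" and P = "\<lambda>x. e * integral {c..x} p"])
      show "0 < min d1 d2" using d1 d2 by simp
      fix u v assume uv: "c \<le> u" "u \<le> v" "v \<le> d" "v - u < min d1 d2"
      have sub: "{u..v} \<subseteq> {c..d}" using uv by auto
      have fu: "f absolutely_integrable_on {u..v}" "g absolutely_integrable_on {u..v}"
        "h absolutely_integrable_on {u..v}"
        using f g h sub absolutely_integrable_on_subinterval by blast+
      have I: "f integrable_on {u..v}" "g integrable_on {u..v}" "h integrable_on {u..v}" "p integrable_on {u..v}"
        using fu p sub by (auto simp: absolutely_integrable_on_def intro: integrable_on_subinterval)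
      have "integral {c..u} h + integral {u..v} h = integral {c..v} h"
        by (rule Henstock_Kurzweil_Integration.integral_combine) (use uv hi in \<open>auto intro: integrable_subinterval_real\<close>)
      then have "D v - D u = F v * G v - F u * G u - integral {u..v} h" by (simp add: D_def algebra_simps)
      \<comment> \<open>With this splitting the change of the defect is the integral of
        \<open>f t * (G v - G t) + g t * (F u - F t)\<close>, where uniform continuity makes both
        differences small.\<close>
      also have "F v * G v - F u * G u = (F v - F u) * G v + F u * (G v - G u)" by (simp add: algebra_simps)
      also have "\<dots> = integral {u..v} (\<lambda>t. f t * G v) + integral {u..v} (\<lambda>t. F u * g t)"
        using Fd[of u v] uv by simp
      also have "\<dots> = integral {u..v} (\<lambda>t. f t * G v + F u * g t)"
        by (rule Henstock_Kurzweil_Integration.integral_add[symmetric]) (use I in \<open>auto intro: integrable_on_mult_left integrable_on_mult_right\<close>)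
      also have "\<dots> - integral {u..v} h = integral {u..v} (\<lambda>t. f t * G v + F u * g t - h t)"
        by (rule Henstock_Kurzweil_Integration.integral_diff[symmetric]) (use I in \<open>auto intro!: integrable_add integrable_on_mult_left integrable_on_mult_right\<close>)
      finally have eq: "D v - D u = integral {u..v} (\<lambda>t. f t * G v + F u * g t - h t)" .
      have "norm (D v - D u) \<le> integral {u..v} (\<lambda>t. e * p t)"
        unfolding eq
      proof (rule Henstock_Kurzweil_Integration.integral_norm_bound_integral)
        show "(\<lambda>t. f t * G v + F u * g t - h t) integrable_on {u..v}"
          using I by (auto intro!: integrable_add integrable_diff integrable_on_mult_left integrable_on_mult_right)
        show "(\<lambda>t. e * p t) integrable_on {u..v}" using I by (auto intro: integrable_on_mult_right)
        fix t assume t: "t \<in> {u..v}"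
        have "norm (G v - G t) \<le> e" "norm (F u - F t) \<le> e"
          using d1(2)[of t u] d2(2)[of t v] t uv by (force simp: dist_norm)+
        then have "norm (f t * (G v - G t) + g t * (F u - F t)) \<le> norm (f t) * e + norm (g t) * e"
          by (intro order.trans[OF norm_triangle_ineq] add_mono) (auto simp: norm_mult intro!: mult_left_mono)
        then show "norm (f t * G v + F u * g t - h t) \<le> e * p t"
          by (simp add: h_def p_def algebra_simps)
      qed
      also have "\<dots> = e * integral {u..v} p" by simp
      also have "\<dots> = e * integral {c..v} p - e * integral {c..u} p"
      proof -
        have "integral {c..u} p + integral {u..v} p = integral {c..v} p"
          by (rule Henstock_Kurzweil_Integration.integral_combine) (use uv p in \<open>auto intro: integrable_subinterval_real\<close>)
        then show ?thesis by (simp add: algebra_simps flip: distrib_left)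
      qed
      finally show "norm (D v - D u) \<le> e * integral {c..v} p - e * integral {c..u} p" .
    qed (rule cd)
    then show ?thesis by simp
  qed
  have "norm (D d - D c) \<le> 0"
  proof (rule field_le_epsilon)
    fix e :: real assume e: "e > 0"
    have pp: "0 \<le> integral {c..d} p" using p0 p by (intro integral_nonneg) auto
    have "norm (D d - D c) \<le> e / (1 + integral {c..d} p) * integral {c..d} p"
      using key[of "e / (1 + integral {c..d} p)"] e pp by simp
    also have "\<dots> \<le> e" using e pp by (simp add: field_simps)
    finally show "norm (D d - D c) \<le> 0 + e" by simp
  qed
  then have "integral {c..d} h = F d * G d - F c * G c" by (simp add: D_def algebra_simps)
  then have "(h has_integral (F d * G d - F c * G c)) {c..d}" using hi by (metis integrable_integral)
  then show ?thesis by (simp add: h_def mult.commute)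
qed

text \<open>\<open>y'' = w y\<close> on \<open>[0, \<infinity>)\<close> in the sense of Caratheodory.\<close>

definition sl_sol :: "(real \<Rightarrow> complex) \<Rightarrow> (real \<Rightarrow> complex) \<Rightarrow> (real \<Rightarrow> complex) \<Rightarrow> bool" where
  "sl_sol w y y' \<longleftrightarrow>
     (\<forall>c d. 0 \<le> c \<longrightarrow> w absolutely_integrable_on {c..d}) \<and>
     (\<forall>x\<ge>0. (y has_vector_derivative y' x) (at x within {0..})) \<and>
     (\<forall>c d. 0 \<le> c \<longrightarrow> c \<le> d \<longrightarrow> ((\<lambda>t. w t * y t) has_integral (y' d - y' c)) {c..d})"

lemma sl_solD:
  assumes "sl_sol w y y'"
  shows "0 \<le> c \<Longrightarrow> w absolutely_integrable_on {c..d}"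
    and "0 \<le> x \<Longrightarrow> (y has_vector_derivative y' x) (at x within {0..})"
    and "0 \<le> c \<Longrightarrow> c \<le> d \<Longrightarrow> ((\<lambda>t. w t * y t) has_integral (y' d - y' c)) {c..d}"
  using assms unfolding sl_sol_def by blast+

lemma sl_sol_continuous:
  assumes "sl_sol w y y'"
  shows "continuous_on {0..} y"
  using sl_solD(2)[OF assms] by (auto simp: continuous_on_eq_continuous_within intro: has_vector_derivative_continuous)

lemma sl_sol_abs_int:
  assumes "sl_sol w y y'" "0 \<le> c"
  shows "(\<lambda>t. w t * y t) absolutely_integrable_on {c..d}"
proof (rule absolutely_integrable_mult_continuous)
  show "w absolutely_integrable_on {c..d}" using assms sl_solD(1) by blast
  show "continuous_on {c..d} y"
    using sl_sol_continuous[OF assms(1)] assms(2) by (elim continuous_on_subset) auto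
qed

lemma sl_sol_continuous_deriv:
  assumes "sl_sol w y y'"
  shows "continuous_on {0..} y'"
proof -
  have "continuous_on {0..d} y'" for d
  proof -
    have "continuous_on {0..d} (\<lambda>x. y' 0 + integral {0..x} (\<lambda>t. w t * y t))"
      by (intro continuous_intros indefinite_integral_continuous_1)
         (use sl_sol_abs_int[OF assms] in \<open>auto simp: absolutely_integrable_on_def\<close>)
    moreover have "y' x = y' 0 + integral {0..x} (\<lambda>t. w t * y t)" if "x \<in> {0..d}" for x
      using sl_solD(3)[OF assms, of 0 x] that by (auto simp: integral_unique)
    ultimately show ?thesis by (metis (no_types, lifting) continuous_on_cong)
  qed
  note * = this
  show ?thesis
    unfolding continuous_on_eq_continuous_within
  proof
    fix x :: real assume x: "x \<in> {0..}"
    have "continuous (at x within {0..x+1}) y'" using *[of "x+1"] x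
      by (auto simp: continuous_on_eq_continuous_within)
    moreover have "at x within {0..} = at x within {0..x+1}"
      using x by (intro at_within_nhd[of x "{..<x+1}"]) auto
    ultimately show "continuous (at x within {0..}) y'" by (simp only: continuous_within)
  qed
qed

lemma sl_sol_integral_deriv:
  assumes "sl_sol w y y'" "0 \<le> c" "c \<le> d"
  shows "(y' has_integral (y d - y c)) {c..d}"
proof (rule fundamental_theorem_of_calculus[OF assms(3)])
  fix x assume "x \<in> {c..d}"
  then show "(y has_vector_derivative y' x) (at x within {c..d})"
    using sl_solD(2)[OF assms(1), of x] assms(2) has_vector_derivative_within_subset by fastforce
qed

section \<open>Wronskians and Lagrange's identity\<close>

definition wronskian :: "(real \<Rightarrow> complex) \<Rightarrow> (real \<Rightarrow> complex) \<Rightarrow> (real \<Rightarrow> complex) \<Rightarrow> (real \<Rightarrow> complex) \<Rightarrow> real \<Rightarrow> complex" where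
  "wronskian y y' z z' x = y x * z' x - y' x * z x"

text \<open>Lagrange's identity. The later integral identities are its instances: against an
  exponential (\<open>exp_transport\<close>), against the conjugate (\<open>flux_interval\<close>),
  and between two spectral parameters (\<open>green_identity\<close>).\<close>

lemma sl_sol_wronskian:
  assumes y: "sl_sol v y y'" and z: "sl_sol w z z'" and cd: "0 \<le> c" "c \<le> d"
  shows "((\<lambda>t. (w t - v t) * y t * z t) has_integral
           (wronskian y y' z z' d - wronskian y y' z z' c)) {c..d}"
proof -
  have *: "((\<lambda>t. y' t * z' t + y t * (w t * z t)) has_integral (y d * z' d - y c * z' c)) {c..d}"
    if y: "sl_sol v y y'" and z: "sl_sol w z z'" for v w y y' z z'
  proof (rule integral_product_rule[OF cd(2)])
    show "y' absolutely_integrable_on {c..d}"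
      using sl_sol_continuous_deriv[OF y] cd
      by (intro absolutely_integrable_continuous_real) (auto intro: continuous_on_subset)
    show "(\<lambda>t. w t * z t) absolutely_integrable_on {c..d}" using z cd sl_sol_abs_int by blast
    show "y x = y c + integral {c..x} y'" if "x \<in> {c..d}" for x
      using sl_sol_integral_deriv[OF y cd(1), of x] that by (auto simp: integral_unique)
    show "z' x = z' c + integral {c..x} (\<lambda>t. w t * z t)" if "x \<in> {c..d}" for x
      using sl_solD(3)[OF z cd(1), of x] that by (auto simp: integral_unique)
  qed
  from has_integral_diff[OF *[OF y z] *[OF z y]]
  show ?thesis by (rule has_integral_eq_rhs[OF has_integral_eq, rotated])
      (auto simp: wronskian_def algebra_simps)
qed

lemma sl_sol_wronskian_const:
  assumes y: "sl_sol w y y'" and z: "sl_sol w z z'" and cd: "0 \<le> c"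
  shows "wronskian y y' z z' c = wronskian y y' z z' 0"
  using sl_sol_wronskian[OF y z order_refl cd] by (auto dest!: has_integral_unique[OF has_integral_0])

lemma sl_sol_cnj:
  assumes "sl_sol w y y'"
  shows "sl_sol (\<lambda>t. cnj (w t)) (\<lambda>t. cnj (y t)) (\<lambda>t. cnj (y' t))"
  unfolding sl_sol_def
proof (intro conjI allI impI)
  fix c d :: real assume "0 \<le> c"
  have "(cnj \<circ> w) absolutely_integrable_on {c..d}"
    by (rule absolutely_integrable_linear[OF sl_solD(1)[OF assms \<open>0 \<le> c\<close>]]) (rule bounded_linear_cnj)
  then show "(\<lambda>t. cnj (w t)) absolutely_integrable_on {c..d}" by (simp add: o_def)
next
  fix x :: real assume "0 \<le> x"
  show "((\<lambda>t. cnj (y t)) has_vector_derivative cnj (y' x)) (at x within {0..})"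
    by (rule has_vector_derivative_cnj[OF sl_solD(2)[OF assms \<open>0 \<le> x\<close>]])
next
  fix c d :: real assume "0 \<le> c" "c \<le> d"
  show "((\<lambda>t. cnj (w t) * cnj (y t)) has_integral cnj (y' d) - cnj (y' c)) {c..d}"
    using has_integral_linear[OF sl_solD(3)[OF assms \<open>0 \<le> c\<close> \<open>c \<le> d\<close>] bounded_linear_cnj] by (simp add: o_def)
qed

lemma sl_sol_cmult_add:
  assumes "sl_sol w y y'" "sl_sol w z z'"
  shows "sl_sol w (\<lambda>t. k * y t + m * z t) (\<lambda>t. k * y' t + m * z' t)"
  unfolding sl_sol_def
proof (intro conjI allI impI)
  fix c d :: real assume "0 \<le> c"
  show "w absolutely_integrable_on {c..d}" using assms \<open>0 \<le> c\<close> sl_solD(1) by blast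
next
  fix x :: real assume "0 \<le> x"
  show "((\<lambda>t. k * y t + m * z t) has_vector_derivative k * y' x + m * z' x) (at x within {0..})"
    using assms[THEN sl_solD(2), OF \<open>0 \<le> x\<close>] by (auto intro!: derivative_eq_intros)
next
  fix c d :: real assume "0 \<le> c" "c \<le> d"
  have "((\<lambda>t. k * (w t * y t) + m * (w t * z t)) has_integral k * (y' d - y' c) + m * (z' d - z' c)) {c..d}"
    using assms[THEN sl_solD(3), OF \<open>0 \<le> c\<close> \<open>c \<le> d\<close>] by (intro has_integral_add has_integral_mult_right)
  then show "((\<lambda>t. w t * (k * y t + m * z t)) has_integral k * y' d + m * z' d - (k * y' c + m * z' c)) {c..d}"
    by (simp add: algebra_simps)
qed

text \<open>Free solutions, to be paired with arbitrary ones in Lagrange's identity.\<close>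

lemma sl_sol_exp: "sl_sol (\<lambda>t. - k\<^sup>2) (\<lambda>t. exp (\<i> * k * of_real t)) (\<lambda>t. \<i> * k * exp (\<i> * k * of_real t))"
proof -
  have d1: "((\<lambda>t. c * exp (\<i> * k * of_real t)) has_vector_derivative c * (\<i> * k * exp (\<i> * k * of_real x))) (at x within A)"
    for x A and c :: complex
    by (rule has_vector_derivative_real_field[where f = "\<lambda>z. c * exp (\<i> * k * z)", THEN has_vector_derivative_at_within])
       (auto intro!: derivative_eq_intros simp: algebra_simps)
  show ?thesis
    unfolding sl_sol_def
  proof (intro conjI allI impI)
    fix c d :: real
    show "(\<lambda>t. - k\<^sup>2) absolutely_integrable_on {c..d}"
      by (intro absolutely_integrable_continuous_real continuous_intros)
    assume "c \<le> d"
    have "((\<lambda>t. \<i> * k * (\<i> * k * exp (\<i> * k * of_real t))) has_integral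
        \<i> * k * exp (\<i> * k * of_real d) - \<i> * k * exp (\<i> * k * of_real c)) {c..d}"
      by (rule fundamental_theorem_of_calculus[OF \<open>c \<le> d\<close>]) (rule d1)
    moreover have "\<i> * k * (\<i> * k * X) = - k\<^sup>2 * X" for X
    proof -
      have "\<i> * k * (\<i> * k * X) = (\<i> * \<i>) * k\<^sup>2 * X" by (simp only: power2_eq_square ac_simps)
      then show ?thesis by simp
    qed
    ultimately show "((\<lambda>t. - k\<^sup>2 * exp (\<i> * k * of_real t)) has_integral
        \<i> * k * exp (\<i> * k * of_real d) - \<i> * k * exp (\<i> * k * of_real c)) {c..d}"
      by simp
  next
    fix x :: real
    show "((\<lambda>t. exp (\<i> * k * of_real t)) has_vector_derivative \<i> * k * exp (\<i> * k * of_real x)) (at x within {0..})"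
      using d1[of 1 x] by simp
  qed
qed

subsection \<open>The initial value problem\<close>

definition loc_abs_int :: "(real \<Rightarrow> complex) \<Rightarrow> bool" where
  "loc_abs_int w \<longleftrightarrow> (\<forall>c d. 0 \<le> c \<longrightarrow> w absolutely_integrable_on {c..d})"

lemma loc_abs_intD: "loc_abs_int w \<Longrightarrow> 0 \<le> c \<Longrightarrow> w absolutely_integrable_on {c..d}"
  by (auto simp: loc_abs_int_def)

lemma loc_abs_int_mult:
  assumes "loc_abs_int w" "continuous_on {0..} u" "0 \<le> c"
  shows "(\<lambda>t. w t * u t) absolutely_integrable_on {c..d}" "(\<lambda>t. w t * u t) integrable_on {c..d}"
proof -
  show "(\<lambda>t. w t * u t) absolutely_integrable_on {c..d}"
    by (intro absolutely_integrable_mult_continuous loc_abs_intD assms continuous_on_subset[OF assms(2)])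
       (use assms in auto)
  then show "(\<lambda>t. w t * u t) integrable_on {c..d}" by (simp add: absolutely_integrable_on_def)
qed

lemma continuous_on_atLeast_from_Icc:
  fixes f :: "real \<Rightarrow> 'a::topological_space"
  assumes "\<And>d. continuous_on {0..d} f"
  shows "continuous_on {0..} f"
  unfolding continuous_on_eq_continuous_within
proof
  fix x :: real assume x: "x \<in> {0..}"
  have "continuous (at x within {0..x+1}) f" using assms[of "x+1"] x
    by (auto simp: continuous_on_eq_continuous_within)
  moreover have "at x within {0..} = at x within {0..x+1}"
    using x by (intro at_within_nhd[of x "{..<x+1}"]) auto
  ultimately show "continuous (at x within {0..}) f" by (simp only: continuous_within)
qed

lemma continuous_on_indefinite_integral:
  fixes f :: "real \<Rightarrow> complex"
  assumes "\<And>d. f integrable_on {0..d}"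
  shows "continuous_on {0..} (\<lambda>x. integral {0..x} f)"
  by (intro continuous_on_atLeast_from_Icc indefinite_integral_continuous_1 assms)

text \<open>The primitive of an integrable function is only absolutely continuous, so its powers are
  differentiated by induction with \<open>integral_product_rule\<close>. The term
  \<open>0 ^ n\<close> is the value of the power at the left end, which is 1 for
  \<open>n = 0\<close>; there the truncated exponent \<open>n - 1\<close> comes with the factor
  0.\<close>

lemma has_integral_power_primitive:
  fixes p :: "real \<Rightarrow> complex"
  assumes p: "p absolutely_integrable_on {0..d}" and x: "x \<in> {0..d}"
  shows "((\<lambda>t. of_nat n * p t * integral {0..t} p ^ (n - 1)) has_integral (integral {0..x} p ^ n - 0 ^ n)) {0..x}"
  using x
proof (induction n arbitrary: x)
  case 0
  then show ?case by simp
next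
  case (Suc n)
  define P where "P = (\<lambda>x. integral {0..x} p)"
  have pi: "p integrable_on {0..d}" using p by (simp add: absolutely_integrable_on_def)
  have contP: "continuous_on {0..d} P" unfolding P_def by (rule indefinite_integral_continuous_1[OF pi])
  have px: "p absolutely_integrable_on {0..x}"
    by (rule absolutely_integrable_on_subinterval[OF p]) (use Suc.prems in auto)
  have cx: "continuous_on {0..x} P" using contP by (rule continuous_on_subset) (use Suc.prems in auto)
  have "((\<lambda>t. p t * P t ^ n + P t * (of_nat n * p t * P t ^ (n - 1))) has_integral (P x * P x ^ n - P 0 * P 0 ^ n)) {0..x}"
  proof (rule integral_product_rule[where F = P and G = "\<lambda>t. P t ^ n"])
    show "(\<lambda>t. of_nat n * p t * P t ^ (n - 1)) absolutely_integrable_on {0..x}"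
    proof (cases "n = 0")
      case False
      have "(\<lambda>t. p t * (of_nat n * P t ^ (n - 1))) absolutely_integrable_on {0..x}"
        by (intro absolutely_integrable_mult_continuous continuous_intros px cx)
      then show ?thesis by (simp add: mult_ac)
    qed auto
    show "P y ^ n = P 0 ^ n + integral {0..y} (\<lambda>t. of_nat n * p t * P t ^ (n - 1))" if "y \<in> {0..x}" for y
      using Suc.IH[of y] that Suc.prems by (auto simp: P_def dest!: integral_unique)
  qed (use Suc.prems px in \<open>auto simp: P_def\<close>)
  moreover have "p t * P t ^ n + P t * (of_nat n * p t * P t ^ (n - 1)) = of_nat (Suc n) * p t * P t ^ n" for t
    by (cases n) (auto simp: algebra_simps)
  ultimately show ?case by (simp add: P_def)
qed

lemma has_integral_power_primitive_real:
  fixes p :: "real \<Rightarrow> real"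
  assumes p: "p absolutely_integrable_on {0..d}" and x: "x \<in> {0..d}"
  shows "((\<lambda>t. p t * integral {0..t} p ^ n) has_integral (integral {0..x} p ^ Suc n / Suc n)) {0..x}"
proof -
  define P where "P = (\<lambda>x. integral {0..x} p)"
  \<comment> \<open>The product rule is stated for complex functions; the real case is embedded and
    recovered with \<open>Re\<close>.\<close>
  have pc: "(\<lambda>t. complex_of_real (p t)) absolutely_integrable_on {0..d}"
    using absolutely_integrable_linear[OF p, of complex_of_real] bounded_linear_of_real by (simp add: o_def)
  have eq: "integral {0..t} (\<lambda>t. complex_of_real (p t)) = of_real (P t)" if "t \<in> {0..d}" for t
  proof -
    have "p integrable_on {0..t}"
      using p that by (auto simp: absolutely_integrable_on_def intro: integrable_on_subinterval)
    from integral_linear[OF this, of complex_of_real] show ?thesis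
      using bounded_linear_of_real by (simp add: o_def P_def)
  qed
  have "((\<lambda>t. of_nat (Suc n) * of_real (p t) * complex_of_real (P t) ^ n) has_integral complex_of_real (P x) ^ Suc n) {0..x}"
    using has_integral_power_primitive[OF pc x, of "Suc n"] eq x
    by (auto intro: has_integral_eq_rhs[OF has_integral_eq, rotated])
  moreover have "(\<lambda>t. of_nat (Suc n) * of_real (p t) * complex_of_real (P t) ^ n)
      = (\<lambda>t. complex_of_real (real (Suc n) * (p t * P t ^ n)))" by (simp add: mult_ac)
  ultimately have "((\<lambda>t. complex_of_real (real (Suc n) * (p t * P t ^ n))) has_integral complex_of_real (P x ^ Suc n)) {0..x}"
    by (simp only: of_real_power)
  from has_integral_linear[OF this bounded_linear_Re]
  have "((\<lambda>t. of_nat (Suc n) * (p t * P t ^ n)) has_integral (P x) ^ Suc n) {0..x}"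
    by (simp add: o_def del: of_nat_Suc)
  from has_integral_mult_right[OF this, of "1 / Suc n"]
  show ?thesis by (simp add: P_def field_simps del: of_nat_Suc)
qed

section \<open>Picard iteration\<close>

definition picard_op :: "(real \<Rightarrow> complex) \<Rightarrow> (real \<Rightarrow> complex) \<Rightarrow> real \<Rightarrow> complex" where
  "picard_op w u x = integral {0..x} (\<lambda>s. integral {0..s} (\<lambda>t. w t * u t))"

lemma continuous_on_inner:
  assumes "loc_abs_int w" "continuous_on {0..} u"
  shows "continuous_on {0..} (\<lambda>s. integral {0..s} (\<lambda>t. w t * u t))"
  by (intro continuous_on_indefinite_integral loc_abs_int_mult assms) auto

lemma continuous_on_picard_op:
  assumes "loc_abs_int w" "continuous_on {0..} u"
  shows "continuous_on {0..} (picard_op w u)"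
  unfolding picard_op_def
  by (intro continuous_on_indefinite_integral integrable_continuous_interval
        continuous_on_subset[OF continuous_on_inner[OF assms]]) auto

text \<open>The weight is integrable but possibly unbounded, so the majorant uses powers of the
  primitive of \<open>p\<close> instead of powers of \<open>s\<close>. The inner integral raises the
  power and supplies the factor 1 / (n + 1); the outer one costs a factor \<open>X\<close>.\<close>

lemma picard_op_bound:
  fixes p :: "real \<Rightarrow> real"
  assumes w: "loc_abs_int w" and u: "continuous_on {0..} u"
    and p: "p absolutely_integrable_on {0..X}" and wp: "\<And>t. norm (w t) \<le> p t"
    and M: "0 \<le> M" and ub: "\<And>t. t \<in> {0..X} \<Longrightarrow> norm (u t) \<le> M * (X * integral {0..t} p) ^ n / fact n"
    and s: "s \<in> {0..X}"
  shows "norm (integral {0..s} (\<lambda>t. w t * u t)) \<le> M * X ^ n * integral {0..s} p ^ Suc n / fact (Suc n)" (is ?A)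
    and "norm (picard_op w u s) \<le> M * (X * integral {0..s} p) ^ Suc n / fact (Suc n)" (is ?B)
proof -
  define P where "P = (\<lambda>x. integral {0..x} p)"
  have p0: "0 \<le> p t" for t using wp[of t] by (meson norm_ge_zero order_trans)
  have pint: "p integrable_on {0..x}" if "x \<in> {0..X}" for x
    using p that by (auto simp: absolutely_integrable_on_def intro: integrable_on_subinterval)
  have Pmono: "P x \<le> P y" if "0 \<le> x" "x \<le> y" "y \<le> X" for x y
    unfolding P_def by (rule integral_subset_le) (use that p0 pint in auto)
  have P0: "0 \<le> P x" if "x \<in> {0..X}" for x
    unfolding P_def by (rule Henstock_Kurzweil_Integration.integral_nonneg) (use that p0 pint in auto)
  have X: "0 \<le> X" using s by auto
  have A: "norm (integral {0..s} (\<lambda>t. w t * u t)) \<le> M * X ^ n * P s ^ Suc n / fact (Suc n)" if s: "s \<in> {0..X}" for s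
  proof -
    have I: "((\<lambda>t. M * X ^ n / fact n * (p t * P t ^ n)) has_integral M * X ^ n / fact n * (P s ^ Suc n / Suc n)) {0..s}"
      using has_integral_mult_right[OF has_integral_power_primitive_real[OF p s, of n]] by (simp only: P_def)
    have "norm (integral {0..s} (\<lambda>t. w t * u t)) \<le> integral {0..s} (\<lambda>t. M * X ^ n / fact n * (p t * P t ^ n))"
    proof (rule Henstock_Kurzweil_Integration.integral_norm_bound_integral)
      show "(\<lambda>t. w t * u t) integrable_on {0..s}" by (rule loc_abs_int_mult[OF w u]) simp
      show "(\<lambda>t. M * X ^ n / fact n * (p t * P t ^ n)) integrable_on {0..s}" using I by blast
      fix t assume "t \<in> {0..s}"
      then have t: "t \<in> {0..X}" using s by auto
      have "norm (w t * u t) \<le> p t * (M * (X * P t) ^ n / fact n)"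
        unfolding norm_mult by (rule mult_mono) (use wp ub[OF t] p0 in \<open>auto simp: P_def\<close>)
      then show "norm (w t * u t) \<le> M * X ^ n / fact n * (p t * P t ^ n)"
        by (simp add: power_mult_distrib mult_ac)
    qed
    also have "\<dots> = M * X ^ n / fact n * (P s ^ Suc n / Suc n)" using I by (rule integral_unique)
    also have "\<dots> = M * X ^ n * P s ^ Suc n / fact (Suc n)" by (simp add: field_simps)
    finally show ?thesis .
  qed
  show ?A using A[OF s] by (simp add: P_def)
  have "norm (picard_op w u s) \<le> M * X ^ n * P s ^ Suc n / fact (Suc n) * (s - 0)"
    unfolding picard_op_def
  proof (rule integral_bound)
    show "0 \<le> s" using s by simp
    show "continuous_on {0..s} (\<lambda>s. integral {0..s} (\<lambda>t. w t * u t))"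
      by (rule continuous_on_subset[OF continuous_on_inner[OF w u]]) auto
    fix r assume r: "r \<in> {0..s}"
    have "P r ^ Suc n \<le> P s ^ Suc n" using r s Pmono P0 by (intro power_mono) auto
    then have "M * X ^ n * P r ^ Suc n / fact (Suc n) \<le> M * X ^ n * P s ^ Suc n / fact (Suc n)"
      using M X by (intro divide_right_mono mult_left_mono) auto
    with A[of r] r s show "norm (integral {0..r} (\<lambda>t. w t * u t)) \<le> M * X ^ n * P s ^ Suc n / fact (Suc n)" by auto
  qed
  also have "\<dots> \<le> M * X ^ n * P s ^ Suc n / fact (Suc n) * X"
    using M X P0[OF s] s by (intro mult_left_mono) auto
  also have "\<dots> = M * (X * P s) ^ Suc n / fact (Suc n)" by (simp add: power_mult_distrib mult_ac)
  finally show ?B by (simp only: P_def)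
qed

fun picard_iter :: "(real \<Rightarrow> complex) \<Rightarrow> complex \<Rightarrow> complex \<Rightarrow> nat \<Rightarrow> real \<Rightarrow> complex" where
  "picard_iter w u0 u1 0 = (\<lambda>x. u0 + u1 * of_real x)"
| "picard_iter w u0 u1 (Suc n) = picard_op w (picard_iter w u0 u1 n)"

lemma continuous_on_picard_iter:
  assumes "loc_abs_int w" shows "continuous_on {0..} (picard_iter w u0 u1 n)"
  by (induction n) (auto intro!: continuous_intros continuous_on_picard_op assms)

lemma picard_iter_bound:
  fixes p :: "real \<Rightarrow> real"
  assumes w: "loc_abs_int w" and p: "p absolutely_integrable_on {0..X}" and wp: "\<And>t. norm (w t) \<le> p t"
    and s: "s \<in> {0..X}"
  shows "norm (picard_iter w u0 u1 n s) \<le> (norm u0 + norm u1 * X) * (X * integral {0..s} p) ^ n / fact n"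
    and "norm (integral {0..s} (\<lambda>t. w t * picard_iter w u0 u1 n t))
           \<le> (norm u0 + norm u1 * X) * X ^ n * integral {0..s} p ^ Suc n / fact (Suc n)"
proof -
  have M: "0 \<le> norm u0 + norm u1 * X" using s by auto
  have *: "norm (picard_iter w u0 u1 n s) \<le> (norm u0 + norm u1 * X) * (X * integral {0..s} p) ^ n / fact n"
    if "s \<in> {0..X}" for s
    using that
  proof (induction n arbitrary: s)
    case 0
    have "norm (u0 + u1 * of_real s) \<le> norm u0 + norm u1 * X"
      using 0 by (intro order.trans[OF norm_triangle_ineq] add_left_mono) (auto simp: norm_mult intro!: mult_left_mono)
    then show ?case by simp
  next
    case (Suc n)
    show ?case
      using picard_op_bound(2)[OF w continuous_on_picard_iter[OF w] p wp M Suc.IH Suc.prems] by simp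
  qed
  show "norm (picard_iter w u0 u1 n s) \<le> (norm u0 + norm u1 * X) * (X * integral {0..s} p) ^ n / fact n"
    using *[OF s] .
  show "norm (integral {0..s} (\<lambda>t. w t * picard_iter w u0 u1 n t))
           \<le> (norm u0 + norm u1 * X) * X ^ n * integral {0..s} p ^ Suc n / fact (Suc n)"
    by (rule picard_op_bound(1)[OF w continuous_on_picard_iter[OF w] p wp M * s])
qed

lemma summable_pow_fact: "summable (\<lambda>n. M * r ^ n / fact n :: real)"
  using summable_mult[OF summable_exp[of r], of M] by (simp add: field_simps)

text \<open>Such a solution is a fixed point of \<open>picard_op\<close>, so a bound B for it
  improves to B (x P)^n / n! for every n.\<close>

lemma sl_sol_zero_unique:
  assumes y: "sl_sol w y y'" and z: "y 0 = 0" "y' 0 = 0" and x: "0 \<le> x"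
  shows "y x = 0" "y' x = 0"
proof -
  have w: "loc_abs_int w" using sl_solD(1)[OF y] by (simp add: loc_abs_int_def)
  have cont: "continuous_on {0..} y" by (rule sl_sol_continuous[OF y])
  have y': "y' s = integral {0..s} (\<lambda>t. w t * y t)" if "0 \<le> s" for s
    using sl_solD(3)[OF y _ that] z by (simp add: integral_unique)
  have op: "y s = picard_op w y s" if "0 \<le> s" for s
  proof -
    have "integral {0..s} y' = y s" using sl_sol_integral_deriv[OF y _ that] z by (simp add: integral_unique)
    moreover have "integral {0..s} y' = picard_op w y s"
      unfolding picard_op_def by (rule integral_cong) (use y' in auto)
    ultimately show ?thesis by simp
  qed
  have zero: "y x = 0" if x: "0 \<le> x" for x
  proof -
    have "compact (y ` {0..x})"
      by (rule compact_continuous_image[OF continuous_on_subset[OF cont]]) auto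
    then obtain B where B: "\<And>t. t \<in> {0..x} \<Longrightarrow> norm (y t) \<le> B"
      using compact_imp_bounded bounded_iff by (metis imageI)
    have B0: "0 \<le> B" using B[of 0] x z by simp
    define P where "P = (\<lambda>s. integral {0..s} (\<lambda>t. norm (w t)))"
    have p: "(\<lambda>t. norm (w t)) absolutely_integrable_on {0..x}"
      by (rule absolutely_integrable_norm[unfolded o_def, OF loc_abs_intD[OF w order_refl]])
    have bd: "norm (y s) \<le> B * (x * P s) ^ n / fact n" if "s \<in> {0..x}" for n s
      using that
    proof (induction n arbitrary: s)
      case 0 then show ?case using B by simp
    next
      case (Suc n)
      show ?case
        using picard_op_bound(2)[OF w cont p order_refl B0, of n s] Suc op[of s] by (auto simp: P_def)
    qed
    have "norm (y x) \<le> 0"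
      by (rule LIMSEQ_le_const[OF summable_LIMSEQ_zero[OF summable_pow_fact]]) (use bd[of x] x in auto)
    then show ?thesis by simp
  qed
  show "y x = 0" using zero x .
  have "integral {0..x} (\<lambda>t. w t * y t) = integral {0..x} (\<lambda>t. 0)"
    by (rule integral_cong) (use zero in auto)
  then show "y' x = 0" using y'[OF x] by simp
qed

lemma sl_sol_unique:
  assumes "sl_sol w y y'" "sl_sol w z z'" "y 0 = z 0" "y' 0 = z' 0" "0 \<le> x"
  shows "y x = z x" "y' x = z' x"
  using sl_sol_zero_unique[OF sl_sol_cmult_add[OF assms(1,2), of 1 "-1"], of x] assms by auto

lemma integral_mult_uniform_limit:
  assumes w: "loc_abs_int w" and u: "\<And>n. continuous_on {0..} (u n)" and v: "continuous_on {0..} v"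
    and lim: "uniform_limit {0..x} u v sequentially"
  shows "uniform_limit {0..x} (\<lambda>n s. integral {0..s} (\<lambda>t. w t * u n t)) (\<lambda>s. integral {0..s} (\<lambda>t. w t * v t)) sequentially"
proof (rule uniform_limitI)
  fix e :: real assume e: "0 < e"
  define N where "N = integral {0..x} (\<lambda>t. norm (w t))"
  have wi: "(\<lambda>t. norm (w t)) integrable_on {0..s}" for s
    using loc_abs_intD[OF w, of 0 s] by (simp add: absolutely_integrable_on_def)
  have N: "0 \<le> N" unfolding N_def by (rule Henstock_Kurzweil_Integration.integral_nonneg[OF wi]) auto
  \<comment> \<open>The summand 1 keeps the denominator positive when the weight vanishes.\<close>
  have "\<forall>\<^sub>F n in sequentially. \<forall>t\<in>{0..x}. dist (u n t) (v t) < e / (1 + N)"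
    using lim e N unfolding uniform_limit_iff by auto
  then show "\<forall>\<^sub>F n in sequentially. \<forall>s\<in>{0..x}. dist (integral {0..s} (\<lambda>t. w t * u n t)) (integral {0..s} (\<lambda>t. w t * v t)) < e"
  proof (eventually_elim, intro ballI)
    fix n s assume un: "\<forall>t\<in>{0..x}. dist (u n t) (v t) < e / (1 + N)" and s: "s \<in> {0..x}"
    have I: "(\<lambda>t. w t * u n t) integrable_on {0..s}" "(\<lambda>t. w t * v t) integrable_on {0..s}"
      using loc_abs_int_mult(2)[OF w] u v by blast+
    have "norm (integral {0..s} (\<lambda>t. w t * u n t - w t * v t)) \<le> integral {0..s} (\<lambda>t. e / (1 + N) * norm (w t))"
    proof (rule Henstock_Kurzweil_Integration.integral_norm_bound_integral)
      fix t assume "t \<in> {0..s}"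
      then have "norm (w t) * norm (u n t - v t) \<le> norm (w t) * (e / (1 + N))"
        using un s by (intro mult_left_mono) (auto simp: dist_norm intro: less_imp_le)
      then show "norm (w t * u n t - w t * v t) \<le> e / (1 + N) * norm (w t)"
        by (simp add: norm_mult flip: right_diff_distrib) (simp add: mult.commute)
    qed (intro integrable_diff I integrable_on_mult_right wi)+
    also have "\<dots> = e / (1 + N) * integral {0..s} (\<lambda>t. norm (w t))" by simp
    also have "\<dots> \<le> e / (1 + N) * N"
      unfolding N_def by (intro mult_left_mono integral_subset_le) (use wi s e N N_def in auto)
    also have "\<dots> < e" using e N by (simp add: field_simps)
    finally show "dist (integral {0..s} (\<lambda>t. w t * u n t)) (integral {0..s} (\<lambda>t. w t * v t)) < e"
      using I by (simp add: dist_norm Henstock_Kurzweil_Integration.integral_diff)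
  qed
qed

definition ivp_sol :: "(real \<Rightarrow> complex) \<Rightarrow> complex \<Rightarrow> complex \<Rightarrow> real \<Rightarrow> complex" where
  "ivp_sol w u0 u1 x = (\<Sum>n. picard_iter w u0 u1 n x)"

definition ivp_deriv :: "(real \<Rightarrow> complex) \<Rightarrow> complex \<Rightarrow> complex \<Rightarrow> real \<Rightarrow> complex" where
  "ivp_deriv w u0 u1 x = u1 + integral {0..x} (\<lambda>t. w t * ivp_sol w u0 u1 t)"

text \<open>One majorant \<open>p\<close> serves all parameters in \<open>A\<close>, so the M-test
  is uniform in the parameter as well as in x. Holomorphy in the parameter rests on this.\<close>

lemma picard_uniform_limit:
  assumes w: "\<And>\<mu>. \<mu> \<in> A \<Longrightarrow> loc_abs_int (w \<mu>)" and p: "p absolutely_integrable_on {0..X}"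
    and wp: "\<And>\<mu> t. \<mu> \<in> A \<Longrightarrow> norm (w \<mu> t) \<le> p t"
  shows "uniform_limit (A \<times> {0..X}) (\<lambda>n (\<mu>, x). \<Sum>i<n. picard_iter (w \<mu>) u0 u1 i x) (\<lambda>(\<mu>, x). ivp_sol (w \<mu>) u0 u1 x) sequentially"
    and "\<mu> \<in> A \<Longrightarrow> x \<in> {0..X} \<Longrightarrow> norm (ivp_sol (w \<mu>) u0 u1 x) \<le> (norm u0 + norm u1 * X) * exp (X * integral {0..X} p)"
proof -
  define P where "P = integral {0..X} p"
  have pi: "p integrable_on {0..x}" if "x \<in> {0..X}" for x
    using p that by (auto simp: absolutely_integrable_on_def intro: integrable_on_subinterval)
  have bd: "norm (picard_iter (w \<mu>) u0 u1 n x) \<le> (norm u0 + norm u1 * X) * (X * P) ^ n / fact n"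
    if "\<mu> \<in> A" "x \<in> {0..X}" for \<mu> x n
  proof -
    have p0: "0 \<le> p t" for t using wp[OF that(1), of t] by (meson norm_ge_zero order_trans)
    have "integral {0..x} p \<le> P" "0 \<le> integral {0..x} p"
      unfolding P_def
      by (auto intro!: integral_subset_le Henstock_Kurzweil_Integration.integral_nonneg simp: p0 pi that)
         (use that p0 pi in auto)
    then have "(X * integral {0..x} p) ^ n \<le> (X * P) ^ n" using that
      by (intro power_mono mult_left_mono) auto
    then show ?thesis using picard_iter_bound(1)[OF w[OF that(1)] p wp[OF that(1)] that(2), of u0 u1 n] that
      by (elim order.trans) (intro divide_right_mono mult_left_mono, auto)
  qed
  have "uniform_limit (A \<times> {0..X}) (\<lambda>n z. \<Sum>i<n. (\<lambda>(\<mu>, x). picard_iter (w \<mu>) u0 u1 i x) z)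
           (\<lambda>z. \<Sum>i. (\<lambda>(\<mu>, x). picard_iter (w \<mu>) u0 u1 i x) z) sequentially"
    by (rule Weierstrass_m_test[OF _ summable_pow_fact[of "norm u0 + norm u1 * X" "X * P"]])
       (use bd in auto)
  then show "uniform_limit (A \<times> {0..X}) (\<lambda>n (\<mu>, x). \<Sum>i<n. picard_iter (w \<mu>) u0 u1 i x) (\<lambda>(\<mu>, x). ivp_sol (w \<mu>) u0 u1 x) sequentially"
    by (simp add: ivp_sol_def case_prod_unfold)
  assume h: "\<mu> \<in> A" "x \<in> {0..X}"
  have "norm (ivp_sol (w \<mu>) u0 u1 x) \<le> (\<Sum>n. (norm u0 + norm u1 * X) * (X * P) ^ n / fact n)"
    unfolding ivp_sol_def
    by (rule norm_suminf_le[OF _ summable_pow_fact]) (rule bd[OF h])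
  also have "\<dots> = (norm u0 + norm u1 * X) * exp (X * P)"
    using suminf_mult[OF summable_exp[of "X * P"], of "norm u0 + norm u1 * X"]
    by (simp add: exp_def field_simps)
  finally show "norm (ivp_sol (w \<mu>) u0 u1 x) \<le> (norm u0 + norm u1 * X) * exp (X * integral {0..X} p)"
    by (simp add: P_def)
qed

lemma ivp_sol_props:
  assumes w: "loc_abs_int w"
  shows "sl_sol w (ivp_sol w u0 u1) (ivp_deriv w u0 u1)"
    and "ivp_sol w u0 u1 0 = u0" and "ivp_deriv w u0 u1 0 = u1"
proof -
  let ?y = "ivp_sol w u0 u1" and ?y' = "ivp_deriv w u0 u1" and ?U = "picard_iter w u0 u1"
  have ul: "uniform_limit {0..X} (\<lambda>n x. \<Sum>i<n. ?U i x) ?y sequentially" for X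
  proof -
    have "(\<lambda>t. norm (w t)) absolutely_integrable_on {0..X}"
      by (rule absolutely_integrable_norm[unfolded o_def, OF loc_abs_intD[OF w order_refl]])
    \<comment> \<open>A parameter set with one point stands for a single weight.\<close>
    from picard_uniform_limit(1)[of "{()}" "\<lambda>_. w", OF w this order_refl, of u0 u1]
    show ?thesis unfolding uniform_limit_iff by auto
  qed
  have cU: "continuous_on {0..} (\<lambda>x. \<Sum>i<n. ?U i x)" for n
    by (intro continuous_on_sum continuous_on_picard_iter[OF w])
  have cy: "continuous_on {0..} ?y"
  proof (rule continuous_on_atLeast_from_Icc)
    show "continuous_on {0..d} ?y" for d
      by (rule uniform_limit_theorem[OF _ ul]) (auto intro!: always_eventually continuous_on_subset[OF cU])
  qed
  have cy': "continuous_on {0..} ?y'"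
    unfolding ivp_deriv_def by (intro continuous_intros continuous_on_inner[OF w cy])
  \<comment> \<open>The partial sums satisfy this equation up to a shift of the index. It passes to
    the limit because both integrations preserve uniform convergence, the outer one being the case
    of weight 1 in \<open>integral_mult_uniform_limit\<close>.\<close>
  have opeq: "?y x = u0 + u1 * of_real x + picard_op w ?y x" if x: "0 \<le> x" for x
  proof -
    have "(\<lambda>n. \<Sum>i<Suc n. ?U i x) \<longlonglongrightarrow> ?y x"
      by (rule LIMSEQ_Suc, rule tendsto_uniform_limitI[OF ul[of x]]) (use x in auto)
    moreover have "(\<lambda>n. \<Sum>i<Suc n. ?U i x) = (\<lambda>n. u0 + u1 * of_real x + picard_op w (\<lambda>x. \<Sum>i<n. ?U i x) x)"
    proof
      fix n
      have inner: "integral {0..s} (\<lambda>t. w t * (\<Sum>i<n. ?U i t)) = (\<Sum>i<n. integral {0..s} (\<lambda>t. w t * ?U i t))" for s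
        unfolding sum_distrib_left
        by (rule Henstock_Kurzweil_Integration.integral_sum) (auto intro!: loc_abs_int_mult[OF w] continuous_on_picard_iter[OF w])
      have "picard_op w (\<lambda>x. \<Sum>i<n. ?U i x) x = (\<Sum>i<n. ?U (Suc i) x)"
        unfolding picard_op_def inner picard_iter.simps
        by (rule Henstock_Kurzweil_Integration.integral_sum)
           (auto intro!: integrable_continuous_interval continuous_on_subset[OF continuous_on_inner[OF w continuous_on_picard_iter[OF w]]])
      then show "(\<Sum>i<Suc n. ?U i x) = u0 + u1 * of_real x + picard_op w (\<lambda>x. \<Sum>i<n. ?U i x) x"
        by (subst sum.lessThan_Suc_shift) simp
    qed
    moreover have "(\<lambda>n. picard_op w (\<lambda>x. \<Sum>i<n. ?U i x) x) \<longlonglongrightarrow> picard_op w ?y x"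
    proof -
      have one: "loc_abs_int (\<lambda>_. 1)"
        by (auto simp: loc_abs_int_def intro: absolutely_integrable_continuous_real)
      have "uniform_limit {0..x} (\<lambda>n s. integral {0..s} (\<lambda>r. 1 * integral {0..r} (\<lambda>t. w t * (\<Sum>i<n. ?U i t))))
          (\<lambda>s. integral {0..s} (\<lambda>r. 1 * integral {0..r} (\<lambda>t. w t * ?y t))) sequentially"
        by (intro integral_mult_uniform_limit[OF one] integral_mult_uniform_limit[OF w cU cy ul] continuous_on_inner[OF w] cU cy)
      from tendsto_uniform_limitI[OF this, of x] x show ?thesis by (simp add: picard_op_def)
    qed
    then have "(\<lambda>n. u0 + u1 * of_real x + picard_op w (\<lambda>x. \<Sum>i<n. ?U i x) x) \<longlonglongrightarrow> u0 + u1 * of_real x + picard_op w ?y x"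
      by (intro tendsto_intros)
    ultimately show ?thesis using LIMSEQ_unique by metis
  qed
  show "?y 0 = u0" using opeq[of 0] by (simp add: picard_op_def)
  show "?y' 0 = u1" by (simp add: ivp_deriv_def)
  show "sl_sol w ?y ?y'"
    unfolding sl_sol_def
  proof (intro conjI allI impI)
    fix c d :: real assume c: "0 \<le> c"
    show "w absolutely_integrable_on {c..d}" by (rule loc_abs_intD[OF w c])
    assume d: "c \<le> d"
    have "integral {0..c} (\<lambda>t. w t * ?y t) + integral {c..d} (\<lambda>t. w t * ?y t) = integral {0..d} (\<lambda>t. w t * ?y t)"
      by (rule Henstock_Kurzweil_Integration.integral_combine[OF c d]) (rule loc_abs_int_mult[OF w cy order_refl])
    then have "integral {c..d} (\<lambda>t. w t * ?y t) = ?y' d - ?y' c" by (simp add: ivp_deriv_def algebra_simps)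
    then show "((\<lambda>t. w t * ?y t) has_integral ?y' d - ?y' c) {c..d}"
      using loc_abs_int_mult(2)[OF w cy c] by (metis integrable_integral)
  next
    fix x :: real assume x: "0 \<le> x"
    have nhd: "at x within {0..} = at x within {0..x+1}"
      using x by (intro at_within_nhd[of x "{..<x+1}"]) auto
    have cV: "continuous_on {0..x+1} (\<lambda>s. integral {0..s} (\<lambda>t. w t * ?y t))"
      by (rule continuous_on_subset[OF continuous_on_inner[OF w cy]]) auto
    have "((\<lambda>x. u0 + u1 * of_real x + picard_op w ?y x) has_vector_derivative 0 + u1 * 1 + integral {0..x} (\<lambda>t. w t * ?y t)) (at x within {0..x+1})"
      unfolding picard_op_def
      by (intro has_vector_derivative_add has_vector_derivative_const has_vector_derivative_mult_right
             integral_has_vector_derivative[OF cV])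
         (use x in \<open>auto intro!: derivative_eq_intros\<close>)
    then have "((\<lambda>x. u0 + u1 * of_real x + picard_op w ?y x) has_vector_derivative ?y' x) (at x within {0..})"
      by (simp add: nhd ivp_deriv_def)
    then show "(?y has_vector_derivative ?y' x) (at x within {0..})"
      by (rule has_vector_derivative_transform[rotated 2]) (use x opeq in auto)
  qed
qed

section \<open>Dependence on the spectral parameter\<close>

lemma picard_op_add:
  assumes "loc_abs_int w" "continuous_on {0..} u" "continuous_on {0..} v"
  shows "picard_op w (\<lambda>x. u x + v x) x = picard_op w u x + picard_op w v x"
proof -
  have "integral {0..s} (\<lambda>t. w t * (u t + v t)) = integral {0..s} (\<lambda>t. w t * u t) + integral {0..s} (\<lambda>t. w t * v t)" for s
    unfolding distrib_left
    by (intro Henstock_Kurzweil_Integration.integral_add loc_abs_int_mult assms order_refl)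
  then show ?thesis
    unfolding picard_op_def
    by (simp, intro Henstock_Kurzweil_Integration.integral_add integrable_continuous_interval
          continuous_on_subset[OF continuous_on_inner] assms) auto
qed

lemma picard_op_mult: "picard_op w (\<lambda>x. m * u x) x = m * picard_op w u x"
  unfolding picard_op_def by (simp add: mult.left_commute)

lemma picard_op_add_weight:
  assumes "loc_abs_int w1" "loc_abs_int w2" "continuous_on {0..} u"
  shows "picard_op (\<lambda>t. w1 t + m * w2 t) u x = picard_op w1 u x + m * picard_op w2 u x"
proof -
  have "integral {0..s} (\<lambda>t. (w1 t + m * w2 t) * u t)
      = integral {0..s} (\<lambda>t. w1 t * u t) + integral {0..s} (\<lambda>t. m * (w2 t * u t))" for s
    unfolding distrib_right mult.assoc
    by (intro Henstock_Kurzweil_Integration.integral_add integrable_on_mult_right loc_abs_int_mult assms order_refl)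
  then have "picard_op (\<lambda>t. w1 t + m * w2 t) u x
      = integral {0..x} (\<lambda>s. integral {0..s} (\<lambda>t. w1 t * u t) + m * integral {0..s} (\<lambda>t. w2 t * u t))"
    unfolding picard_op_def by simp
  also have "\<dots> = integral {0..x} (\<lambda>s. integral {0..s} (\<lambda>t. w1 t * u t))
       + integral {0..x} (\<lambda>s. m * integral {0..s} (\<lambda>t. w2 t * u t))"
    by (intro Henstock_Kurzweil_Integration.integral_add integrable_on_mult_right integrable_continuous_interval
          continuous_on_subset[OF continuous_on_inner] assms) auto
  finally show ?thesis by (simp add: picard_op_def)
qed

text \<open>Polynomials in the parameter whose coefficients are continuous functions of x. In this
  inductive form, closure under \<open>picard_op\<close> follows from linearity, with no
  differentiation under the integral.\<close>

inductive polynomial_family :: "(complex \<Rightarrow> real \<Rightarrow> complex) \<Rightarrow> bool" where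
  const: "continuous_on {0..} f \<Longrightarrow> polynomial_family (\<lambda>\<mu>. f)"
| add: "polynomial_family U \<Longrightarrow> polynomial_family V \<Longrightarrow> polynomial_family (\<lambda>\<mu> x. U \<mu> x + V \<mu> x)"
| mult: "polynomial_family U \<Longrightarrow> polynomial_family (\<lambda>\<mu> x. \<mu> * U \<mu> x)"

lemma polynomial_family_continuous: "polynomial_family U \<Longrightarrow> continuous_on {0..} (U \<mu>)"
  by (induction rule: polynomial_family.induct) (auto intro!: continuous_intros)

lemma polynomial_family_holomorphic: "polynomial_family U \<Longrightarrow> (\<lambda>\<mu>. U \<mu> x) holomorphic_on A"
  by (induction rule: polynomial_family.induct) (auto intro!: holomorphic_intros)

lemma polynomial_family_picard_op:
  assumes "loc_abs_int w" "polynomial_family U"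
  shows "polynomial_family (\<lambda>\<mu>. picard_op w (U \<mu>))"
  using assms(2)
proof (induction rule: polynomial_family.induct)
  case (const f)
  then show ?case by (intro polynomial_family.const continuous_on_picard_op assms)
next
  case (add U V)
  have "(\<lambda>\<mu>. picard_op w (\<lambda>x. U \<mu> x + V \<mu> x)) = (\<lambda>\<mu> x. picard_op w (U \<mu>) x + picard_op w (V \<mu>) x)"
    by (intro ext picard_op_add assms polynomial_family_continuous add)
  then show ?case using add by (simp add: polynomial_family.add)
next
  case (mult U)
  have "(\<lambda>\<mu>. picard_op w (\<lambda>x. \<mu> * U \<mu> x)) = (\<lambda>\<mu> x. \<mu> * picard_op w (U \<mu>) x)"
    by (intro ext picard_op_mult)
  then show ?case using mult by (simp add: polynomial_family.mult)
qed

lemma polynomial_family_picard_iter: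
  assumes "loc_abs_int w1" "loc_abs_int w2"
  shows "polynomial_family (\<lambda>\<mu>. picard_iter (\<lambda>t. w1 t + \<mu> * w2 t) u0 u1 n)"
proof (induction n)
  case 0
  show ?case by (auto intro!: polynomial_family.const continuous_intros)
next
  case (Suc n)
  let ?U = "\<lambda>\<mu>. picard_iter (\<lambda>t. w1 t + \<mu> * w2 t) u0 u1 n"
  have "(\<lambda>\<mu>. picard_iter (\<lambda>t. w1 t + \<mu> * w2 t) u0 u1 (Suc n))
      = (\<lambda>\<mu> x. picard_op w1 (?U \<mu>) x + \<mu> * picard_op w2 (?U \<mu>) x)"
    by (intro ext, simp, intro picard_op_add_weight assms polynomial_family_continuous Suc)
  then show ?case
    by (simp only:) (intro polynomial_family.add polynomial_family.mult polynomial_family_picard_op Suc assms)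
qed

lemma loc_abs_int_add_mult:
  assumes "loc_abs_int w1" "loc_abs_int w2" shows "loc_abs_int (\<lambda>t. w1 t + \<mu> * w2 t)"
  using assms unfolding loc_abs_int_def by (intro allI impI set_integral_add(1)) auto

text \<open>Each iterate is a polynomial in the parameter, and on the disc of radius
  \<open>R\<close> all weights have the majorant |w1| + R |w2|. The series is therefore a locally
  uniform limit of polynomials.\<close>

lemma ivp_sol_family:
  assumes w: "loc_abs_int w1" "loc_abs_int w2"
  shows ivp_sol_holomorphic: "0 \<le> x \<Longrightarrow> (\<lambda>\<mu>. ivp_sol (\<lambda>t. w1 t + \<mu> * w2 t) u0 u1 x) holomorphic_on UNIV"
    and ivp_sol_bounded: "\<exists>B. \<forall>\<mu> x. norm \<mu> \<le> R \<longrightarrow> x \<in> {0..X} \<longrightarrow> norm (ivp_sol (\<lambda>t. w1 t + \<mu> * w2 t) u0 u1 x) \<le> B"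
proof -
  let ?w = "\<lambda>\<mu> t. w1 t + \<mu> * w2 t"
  define p where "p = (\<lambda>R t. norm (w1 t) + R * norm (w2 t))"
  have p: "p R absolutely_integrable_on {0..X}" for R X
    unfolding p_def
    by (intro set_integral_add(1) set_integrable_mult_right
          absolutely_integrable_norm[unfolded o_def, OF loc_abs_intD[OF w(1) order_refl]]
          absolutely_integrable_norm[unfolded o_def, OF loc_abs_intD[OF w(2) order_refl]])
  have wp: "norm (?w \<mu> t) \<le> p R t" if "\<mu> \<in> cball 0 R" for \<mu> R t
    unfolding p_def using that
    by (intro order.trans[OF norm_triangle_ineq] add_left_mono) (auto simp: norm_mult intro!: mult_right_mono)
  show "\<exists>B. \<forall>\<mu> x. norm \<mu> \<le> R \<longrightarrow> x \<in> {0..X} \<longrightarrow> norm (ivp_sol (?w \<mu>) u0 u1 x) \<le> B"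
    using picard_uniform_limit(2)[where A = "cball 0 R" and w = ?w, OF loc_abs_int_add_mult[OF w] p[where R = R and X = X] wp[where R = R]]
    by (intro exI[of _ "(norm u0 + norm u1 * X) * exp (X * integral {0..X} (p R))"]) auto
  assume x: "0 \<le> x"
  show "(\<lambda>\<mu>. ivp_sol (?w \<mu>) u0 u1 x) holomorphic_on UNIV"
  proof (rule holomorphic_uniform_sequence[where f = "\<lambda>n \<mu>. \<Sum>i<n. picard_iter (?w \<mu>) u0 u1 i x"])
    show "(\<lambda>\<mu>. \<Sum>i<n. picard_iter (?w \<mu>) u0 u1 i x) holomorphic_on UNIV" for n
      by (intro holomorphic_intros polynomial_family_holomorphic[OF polynomial_family_picard_iter[OF w]])
    fix \<mu> :: complex
    have "uniform_limit (cball 0 (norm \<mu> + 1)) (\<lambda>n \<mu>. \<Sum>i<n. picard_iter (?w \<mu>) u0 u1 i x)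
             (\<lambda>\<mu>. ivp_sol (?w \<mu>) u0 u1 x) sequentially"
      using picard_uniform_limit(1)[where A = "cball 0 (norm \<mu> + 1)" and w = ?w and X = x and ?u0.0 = u0 and ?u1.0 = u1, OF loc_abs_int_add_mult[OF w]
          p[where R = "norm \<mu> + 1"] wp[where R = "norm \<mu> + 1"]] x
      unfolding uniform_limit_iff by (auto elim!: eventually_mono)
    moreover have "cball \<mu> 1 \<subseteq> cball 0 (norm \<mu> + 1)" by (simp add: cball_subset_cball_iff)
    ultimately show "\<exists>d>0. cball \<mu> d \<subseteq> UNIV \<and> uniform_limit (cball \<mu> d) (\<lambda>n \<mu>. \<Sum>i<n. picard_iter (?w \<mu>) u0 u1 i x)
             (\<lambda>\<mu>. ivp_sol (?w \<mu>) u0 u1 x) sequentially"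
      by (intro exI[of _ 1]) (auto intro: uniform_limit_on_subset)
  qed auto
qed

section \<open>The equation with a discontinuous weight\<close>

locale sl_problem =
  fixes a \<alpha> :: real and q :: "real \<Rightarrow> real"
  assumes a_pos: "a > 0" and alpha_pos: "\<alpha> > 0"
    and q_meas: "q \<in> borel_measurable (lebesgue_on {0..})"
    and q_int: "set_integrable lebesgue {0..} (\<lambda>x. (1 + x) * \<bar>q x\<bar>)"
begin

abbreviation \<rho> :: "real \<Rightarrow> real" where "\<rho> \<equiv> rho a \<alpha>"

text \<open>The equation reads y'' = wt l y. The weight is kept affine in
  \<open>- l\<^sup>2\<close>, the form to which \<open>ivp_sol_family\<close> applies.\<close>

definition wt :: "complex \<Rightarrow> real \<Rightarrow> complex" where
  "wt l t = of_real (q t) + (- l\<^sup>2) * of_real (\<rho> t)"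

definition qm :: real where "qm = integral {0..} (\<lambda>x. (1 + x) * \<bar>q x\<bar>)"

lemma rho_pos: "\<rho> x > 0" using alpha_pos by (simp add: rho_def)

lemma q1_integrable: "(\<lambda>x. (1 + x) * \<bar>q x\<bar>) integrable_on {0..}"
  using q_int by (simp add: absolutely_integrable_on_def)

lemma q_abs: "q absolutely_integrable_on {0..}"
proof (rule measurable_bounded_by_integrable_imp_absolutely_integrable[OF q_meas _ q1_integrable])
  show "norm (q x) \<le> (1 + x) * \<bar>q x\<bar>" if "x \<in> {0..}" for x using that by (simp add: algebra_simps)
qed auto

lemma q_abs_Icc: "0 \<le> c \<Longrightarrow> q absolutely_integrable_on {c..d}"
  by (rule absolutely_integrable_on_subinterval[OF q_abs]) auto

lemma loc_abs_int_q: "loc_abs_int (\<lambda>t. of_real (q t))"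
  unfolding loc_abs_int_def
proof (intro allI impI)
  fix c d :: real assume "0 \<le> c"
  from absolutely_integrable_linear[OF q_abs_Icc[OF this], of complex_of_real]
  show "(\<lambda>t. complex_of_real (q t)) absolutely_integrable_on {c..d}"
    using bounded_linear_of_real by (simp add: o_def)
qed

lemma rho_measurable: "\<rho> \<in> borel_measurable borel"
  unfolding rho_def by measurable

lemma rho_abs_Icc: "\<rho> absolutely_integrable_on {c..d}"
proof (rule measurable_bounded_by_integrable_imp_absolutely_integrable)
  show "\<rho> \<in> borel_measurable (lebesgue_on {c..d})"
    using rho_measurable by (intro measurable_restrict_space1 measurable_completion) simp
  show "(\<lambda>_. \<alpha>\<^sup>2 + 1) integrable_on {c..d}" by (rule integrable_const_ivl)
  show "norm (\<rho> x) \<le> \<alpha>\<^sup>2 + 1" for x by (simp add: rho_def)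
qed auto

lemma loc_abs_int_rho: "loc_abs_int (\<lambda>t. of_real (\<rho> t))"
  unfolding loc_abs_int_def
proof (intro allI impI)
  fix c d :: real
  from absolutely_integrable_linear[OF rho_abs_Icc, of complex_of_real c d]
  show "(\<lambda>t. complex_of_real (\<rho> t)) absolutely_integrable_on {c..d}"
    using bounded_linear_of_real by (simp add: o_def)
qed

lemma loc_abs_int_wt: "loc_abs_int (wt l)"
  unfolding wt_def[abs_def] by (rule loc_abs_int_add_mult[OF loc_abs_int_q loc_abs_int_rho])

lemma abs_q_int: "0 \<le> c \<Longrightarrow> (\<lambda>t. \<bar>q t\<bar>) integrable_on {c..d}"
  using q_abs_Icc[of c d] by (auto simp: absolutely_integrable_on_def)

lemma q1_int_Icc: "0 \<le> c \<Longrightarrow> (\<lambda>t. (1 + t) * \<bar>q t\<bar>) integrable_on {c..d}"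
  by (rule integrable_on_subinterval[OF q1_integrable]) auto

lemma qm_nonneg: "0 \<le> qm"
  unfolding qm_def by (rule Henstock_Kurzweil_Integration.integral_nonneg[OF q1_integrable]) auto

lemma q1_le_qm: assumes "0 \<le> c" shows "integral {c..d} (\<lambda>t. (1 + t) * \<bar>q t\<bar>) \<le> qm"
  unfolding qm_def using assms by (intro integral_subset_le q1_int_Icc q1_integrable) auto

lemma q_le_q1: assumes "0 \<le> c" shows "integral {c..d} (\<lambda>t. \<bar>q t\<bar>) \<le> integral {c..d} (\<lambda>t. (1 + t) * \<bar>q t\<bar>)"
proof (rule Henstock_Kurzweil_Integration.integral_le)
  fix t assume "t \<in> {c..d}"
  then have "1 * \<bar>q t\<bar> \<le> (1 + t) * \<bar>q t\<bar>" using assms by (intro mult_right_mono) auto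
  then show "\<bar>q t\<bar> \<le> (1 + t) * \<bar>q t\<bar>" by simp
qed (use abs_q_int q1_int_Icc assms in blast)+

lemma q_le_qm: "0 \<le> c \<Longrightarrow> integral {c..d} (\<lambda>t. \<bar>q t\<bar>) \<le> qm"
  using q_le_q1 q1_le_qm order.trans by blast

text \<open>A small tail takes the place of a small parameter in \<open>g_near_infinity\<close>,
  where \<open>l\<close> may be arbitrarily close to 0.\<close>

lemma q1_tail:
  assumes "e > 0"
  obtains X where "X \<ge> a" "\<And>x N. X \<le> x \<Longrightarrow> integral {x..N} (\<lambda>t. (1 + t) * \<bar>q t\<bar>) \<le> e"
proof -
  define f where "f = (\<lambda>t. (1 + t) * \<bar>q t\<bar>)"
  have "((\<lambda>b. LINT t:{0..b}|lebesgue. f t) \<longlongrightarrow> (LINT t:{0..}|lebesgue. f t)) at_top"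
    by (rule tendsto_set_lebesgue_integral_at_top) (use q_int in \<open>auto simp: f_def\<close>)
  moreover have "(LINT t:{0..b}|lebesgue. f t) = integral {0..b} f" for b
  proof (rule set_lebesgue_integral_eq_integral)
    show "set_integrable lebesgue {0..b} f"
      unfolding f_def by (rule set_integrable_subset[OF q_int]) auto
  qed
  moreover have "(LINT t:{0..}|lebesgue. f t) = qm"
    unfolding qm_def f_def by (rule set_lebesgue_integral_eq_integral[OF q_int])
  ultimately have "((\<lambda>b. integral {0..b} f) \<longlongrightarrow> qm) at_top" by simp
  then have "eventually (\<lambda>b. dist (integral {0..b} f) qm < e) at_top" using assms tendstoD by blast
  then obtain b where b: "\<And>x. x \<ge> b \<Longrightarrow> \<bar>integral {0..x} f - qm\<bar> < e"
    unfolding eventually_at_top_linorder dist_real_def by blast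
  show thesis
  proof (rule that[of "max a b"])
    fix x N assume x: "max a b \<le> x"
    show "integral {x..N} (\<lambda>t. (1 + t) * \<bar>q t\<bar>) \<le> e"
    proof (cases "x \<le> N")
      case True
      have "integral {0..x} f + integral {x..N} f = integral {0..N} f"
        by (rule Henstock_Kurzweil_Integration.integral_combine)
           (use x a_pos True q1_int_Icc in \<open>auto simp: f_def\<close>)
      moreover have "integral {0..N} f \<le> qm" unfolding f_def by (rule q1_le_qm) simp
      ultimately show ?thesis using b[of x] x by (auto simp: f_def)
    qed (use assms in auto)
  qed auto
qed

lemma vector_derivative_half_line:
  fixes y :: "real \<Rightarrow> complex"
  assumes "(y has_vector_derivative d) (at x within {0..})" "0 \<le> x"
  shows "vector_derivative y (at x within {0..}) = d"
proof (rule vector_derivative_within[OF _ assms(1)])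
  have "x islimpt {x..x+1}" by simp
  then have "x islimpt {0..}" by (rule islimpt_subset) (use assms in auto)
  then show "at x within {0..} \<noteq> bot" by (simp add: trivial_limit_within)
qed

text \<open>The exceptional null set does not affect integrals, so y'' may be replaced by
  \<open>wt l * y\<close> under the integral sign. Taking the derivative from
  \<open>vector_derivative\<close> makes it a function of \<open>y\<close>, with no choice
  involved.\<close>

lemma solves_sl_imp_sl_sol:
  assumes "solves_sl a \<alpha> q l y"
  shows "sl_sol (wt l) y (\<lambda>x. vector_derivative y (at x within {0..}))"
proof -
  obtain y' y'' where y: "\<And>x. 0 \<le> x \<Longrightarrow> (y has_vector_derivative y' x) (at x within {0..})"
    and i: "\<And>x. 0 \<le> x \<Longrightarrow> set_integrable lebesgue {0..x} y''"
    and e: "\<And>x. 0 \<le> x \<Longrightarrow> y' x = y' 0 + (LINT t:{0..x}|lebesgue. y'' t)"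
    and ae: "AE x in lebesgue. x \<ge> 0 \<longrightarrow> - y'' x + of_real (q x) * y x = l\<^sup>2 * of_real (\<rho> x) * y x"
    using assms unfolding solves_sl_def by blast
  have d: "vector_derivative y (at x within {0..}) = y' x" if "0 \<le> x" for x
    using vector_derivative_half_line[OF y[OF that] that] .
  obtain N where N: "N \<in> null_sets lebesgue"
    "\<And>x. x \<ge> 0 \<Longrightarrow> x \<notin> N \<Longrightarrow> y'' x = wt l x * y x"
  proof -
    obtain N where "N \<in> null_sets lebesgue"
      "{x\<in>space lebesgue. \<not> (x \<ge> 0 \<longrightarrow> - y'' x + of_real (q x) * y x = l\<^sup>2 * of_real (\<rho> x) * y x)} \<subseteq> N"
      using ae unfolding eventually_ae_filter by blast
    then show thesis by (intro that[of N]) (auto simp: wt_def algebra_simps)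
  qed
  have neg: "negligible N" using N(1) by (simp add: negligible_iff_null_sets)
  show ?thesis
    unfolding sl_sol_def
  proof (intro conjI allI impI)
    fix c d :: real assume c: "0 \<le> c"
    show "wt l absolutely_integrable_on {c..d}" by (rule loc_abs_intD[OF loc_abs_int_wt c])
    assume cd: "c \<le> d"
    have hi: "y'' integrable_on {0..x}" "y' x = y' 0 + integral {0..x} y''" if "0 \<le> x" for x
      using i[OF that] e[OF that] set_lebesgue_integral_eq_integral[OF i[OF that]] by auto
    have "integral {0..c} y'' + integral {c..d} y'' = integral {0..d} y''"
      by (rule Henstock_Kurzweil_Integration.integral_combine) (use c cd hi in auto)
    then have "integral {c..d} y'' = y' d - y' c" using hi(2)[of c] hi(2)[of d] c cd by (auto simp: algebra_simps)
    moreover have "y'' integrable_on {c..d}"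
      using hi(1)[of d] c cd by (auto intro: integrable_on_subinterval)
    ultimately have "(y'' has_integral (y' d - y' c)) {c..d}" by (metis integrable_integral)
    then have "((\<lambda>t. wt l t * y t) has_integral (y' d - y' c)) {c..d}"
      by (rule has_integral_spike[OF neg, rotated]) (use N(2) c in auto)
    then show "((\<lambda>t. wt l t * y t) has_integral
      (vector_derivative y (at d within {0..}) - vector_derivative y (at c within {0..}))) {c..d}"
      using d[of c] d[of "d"] c cd by simp
  qed (use y d in auto)
qed

end

subsection \<open>Fourier-Laplace integrals\<close>

text \<open>Mean value bound on the left half plane. In \<open>transport_bound_tail\<close> it
  produces the factor |l| that compensates a division by \<open>l\<close>.\<close>

lemma norm_exp_minus_one_le:
  fixes z :: complex assumes "Re z \<le> 0" shows "norm (exp z - 1) \<le> norm z"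
proof -
  have "norm (exp z - exp 0) \<le> 1 * norm (z - 0)"
  proof (rule field_differentiable_bound[where S = "{z. Re z \<le> 0}" and f' = exp])
    show "convex {z. Re z \<le> 0}" by (rule convex_halfspace_Re_le)
    show "(exp has_field_derivative exp z) (at z within {z. Re z \<le> 0})" for z :: complex
      by (rule DERIV_subset[OF DERIV_exp]) auto
  qed (use assms in auto)
  then show ?thesis by simp
qed

lemma norm_exp_diff_le:
  fixes u v :: complex assumes "Re u \<le> M" "Re v \<le> M" shows "norm (exp u - exp v) \<le> exp M * norm (u - v)"
proof (rule field_differentiable_bound[where S = "{z. Re z \<le> M}" and f' = exp])
  show "convex {z. Re z \<le> M}" by (rule convex_halfspace_Re_le)
  show "(exp has_field_derivative exp z) (at z within {z. Re z \<le> M})" for z :: complex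
    by (rule DERIV_subset[OF DERIV_exp]) auto
qed (use assms in auto)

lemma fourier_laplace_integrable:
  fixes f :: "real \<Rightarrow> complex"
  assumes f: "set_integrable lebesgue {c..} f" and g: "g \<in> borel_measurable borel" and b: "\<And>t. t \<ge> c \<Longrightarrow> norm (g t) \<le> B"
  shows "set_integrable lebesgue {c..} (\<lambda>t. f t * g t)"
  unfolding set_integrable_def
proof (rule Bochner_Integration.integrable_bound)
  show "integrable lebesgue (\<lambda>t. B * norm (indicator {c..} t *\<^sub>R f t))"
    by (intro integrable_mult_right integrable_norm f[unfolded set_integrable_def])
  have "(\<lambda>t. (indicator {c..} t *\<^sub>R f t) * g t) \<in> borel_measurable lebesgue"
    using f g by (intro borel_measurable_times) (auto simp: set_integrable_def intro: measurable_completion borel_measurable_integrable)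
  then show "(\<lambda>t. indicator {c..} t *\<^sub>R (f t * g t)) \<in> borel_measurable lebesgue" by simp
  have "norm (indicator {c..} t *\<^sub>R (f t * g t)) \<le> norm (B * norm (indicator {c..} t *\<^sub>R f t))" for t
  proof (cases "t \<ge> c")
    case True
    then have "norm (f t) * norm (g t) \<le> norm (f t) * B" by (intro mult_left_mono b) auto
    moreover have "0 \<le> B" using b[OF True] norm_ge_zero order_trans by blast
    ultimately show ?thesis using True by (simp add: norm_mult mult.commute)
  qed auto
  then show "AE t in lebesgue. norm (indicator {c..} t *\<^sub>R (f t * g t)) \<le> norm (B * norm (indicator {c..} t *\<^sub>R f t))" by simp
qed

lemma fourier_laplace_dominated:
  fixes f :: "real \<Rightarrow> complex"
  assumes f: "set_integrable lebesgue {c..} f"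
    and g: "\<And>n. g n \<in> borel_measurable borel" "h \<in> borel_measurable borel"
    and b: "\<And>n t. t \<ge> c \<Longrightarrow> norm (g n t) \<le> B"
    and lim: "\<And>t. t \<ge> c \<Longrightarrow> (\<lambda>n. g n t) \<longlonglongrightarrow> h t"
  shows "(\<lambda>n. LINT t:{c..}|lebesgue. f t * g n t) \<longlonglongrightarrow> (LINT t:{c..}|lebesgue. f t * h t)"
  unfolding set_lebesgue_integral_def
proof (rule integral_dominated_convergence)
  have bh: "norm (h t) \<le> B" if "t \<ge> c" for t
    by (rule LIMSEQ_le_const2[OF tendsto_norm[OF lim[OF that]]]) (use b that in auto)
  show "(\<lambda>t. indicator {c..} t *\<^sub>R (f t * h t)) \<in> borel_measurable lebesgue"
    using fourier_laplace_integrable[OF f g(2) bh] by (auto simp: set_integrable_def)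
  show "(\<lambda>t. indicator {c..} t *\<^sub>R (f t * g n t)) \<in> borel_measurable lebesgue" for n
    using fourier_laplace_integrable[OF f g(1) b] by (auto simp: set_integrable_def)
  show "integrable lebesgue (\<lambda>t. B * norm (indicator {c..} t *\<^sub>R f t))"
    by (intro integrable_mult_right integrable_norm f[unfolded set_integrable_def])
  show "AE t in lebesgue. (\<lambda>n. indicator {c..} t *\<^sub>R (f t * g n t)) \<longlonglongrightarrow> indicator {c..} t *\<^sub>R (f t * h t)"
    by (rule AE_I2) (auto simp: indicator_def intro!: tendsto_intros lim)
  have "norm (indicator {c..} t *\<^sub>R (f t * g n t)) \<le> B * norm (indicator {c..} t *\<^sub>R f t)" for t n
  proof (cases "t \<ge> c")
    case True
    then have "norm (f t) * norm (g n t) \<le> norm (f t) * B" by (intro mult_left_mono b) auto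
    then show ?thesis using True by (simp add: norm_mult mult.commute)
  qed auto
  then show "AE t in lebesgue. norm (indicator {c..} t *\<^sub>R (f t * g n t)) \<le> B * norm (indicator {c..} t *\<^sub>R f t)" for n by simp
qed

text \<open>Both parts are dominated convergence. The lower limit \<open>c\<close> may be negative,
  as \<open>mu_plus\<close> at 0 is for alpha > 1, so the exponential is bounded by exp (Im l |c|)
  rather than by 1.\<close>

lemma fourier_laplace:
  fixes f :: "real \<Rightarrow> complex"
  assumes f: "set_integrable lebesgue {c..} f"
  defines "F \<equiv> \<lambda>l. LINT t:{c..}|lebesgue. f t * exp (\<i> * l * of_real t)"
  shows fourier_laplace_continuous: "continuous_on {l. 0 \<le> Im l} F"
    and fourier_laplace_holomorphic: "F holomorphic_on {l. 0 < Im l}"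
proof -
  have m: "(\<lambda>t. exp (\<i> * l * complex_of_real t)) \<in> borel_measurable borel" for l
    by (intro borel_measurable_continuous_onI continuous_intros)
  have nexp: "norm (exp (\<i> * l * complex_of_real t)) \<le> exp (Im l * \<bar>c\<bar>)" if "Im l \<ge> 0" "t \<ge> c" for l t
  proof -
    have "- (Im l * t) \<le> Im l * \<bar>c\<bar>" using that mult_left_mono[of "-t" "\<bar>c\<bar>" "Im l"] by auto
    then show ?thesis by simp
  qed
  show "continuous_on {l. 0 \<le> Im l} F"
    unfolding continuous_on_sequentially
  proof (intro allI ballI impI, elim conjE)
    fix x l assume l: "l \<in> {l. 0 \<le> Im l}" and x: "\<forall>n. x n \<in> {l. 0 \<le> Im l}" "x \<longlonglongrightarrow> l"
    have "Bseq (\<lambda>n. Im (x n))" by (rule convergent_imp_Bseq) (use x(2) tendsto_Im convergentI in blast)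
    then obtain M where M: "\<And>n. \<bar>Im (x n)\<bar> \<le> M" unfolding Bseq_def by auto
    have "(\<lambda>n. LINT t:{c..}|lebesgue. f t * exp (\<i> * x n * of_real t)) \<longlonglongrightarrow> (LINT t:{c..}|lebesgue. f t * exp (\<i> * l * of_real t))"
    proof (rule fourier_laplace_dominated[OF f m m, where B = "exp (M * \<bar>c\<bar>)"])
      show "norm (exp (\<i> * x n * complex_of_real t)) \<le> exp (M * \<bar>c\<bar>)" if "c \<le> t" for n t
      proof -
        have "Im (x n) * \<bar>c\<bar> \<le> M * \<bar>c\<bar>" using M[of n] by (intro mult_right_mono) auto
        then show ?thesis using nexp[of "x n" t] x(1) that by (auto elim!: order.trans)
      qed
    qed (use x(2) in \<open>auto intro!: tendsto_intros\<close>)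
    then show "(F \<circ> x) \<longlonglongrightarrow> F l" by (simp add: F_def o_def)
  qed
  have "(F has_field_derivative (LINT t:{c..}|lebesgue. f t * (\<i> * of_real t * exp (\<i> * l * of_real t)))) (at l)"
    if l: "0 < Im l" for l
    unfolding has_field_derivative_iff tendsto_at_iff_sequentially
  proof (intro allI impI)
    fix x assume x: "\<forall>n. x n \<in> UNIV - {l}" "x \<longlonglongrightarrow> l"
    \<comment> \<open>Near \<open>l\<close> the imaginary parts lie between tau and 3 tau, and the
      decay exp (- tau t) absorbs the factor t of the difference quotient.\<close>
    define \<tau> where "\<tau> = Im l / 2"
    have \<tau>: "\<tau> > 0" using l by (simp add: \<tau>_def)
    have "\<forall>\<^sub>F n in sequentially. dist (x n) l < \<tau>" using x(2) \<tau> tendstoD by blast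
    then obtain n0 where n0: "\<And>n. n \<ge> n0 \<Longrightarrow> norm (x n - l) < \<tau>"
      unfolding eventually_sequentially dist_norm by blast
    define z where "z = (\<lambda>n. x (n + n0))"
    have z: "norm (z n - l) < \<tau>" "z n \<noteq> l" for n using n0[of "n + n0"] x(1) by (auto simp: z_def)
    have zl: "z \<longlonglongrightarrow> l" unfolding z_def using x(2) by (rule LIMSEQ_ignore_initial_segment)
    have zIm: "\<tau> \<le> Im (z n)" "Im (z n) \<le> 3 * \<tau>" for n
      using z(1)[of n] abs_Im_le_cmod[of "z n - l"] by (auto simp: \<tau>_def)
    define Q where "Q = (\<lambda>n t. (exp (\<i> * z n * of_real t) - exp (\<i> * l * of_real t)) / (z n - l))"
    \<comment> \<open>The first bound serves t >= 0, the second c <= t < 0.\<close>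
    define B where "B = max (1 / \<tau>) (\<bar>c\<bar> * exp (3 * \<tau> * \<bar>c\<bar>))"
    have Qb: "norm (Q n t) \<le> B" if t: "t \<ge> c" for n t
    proof -
      have nz: "norm (z n - l) > 0" using z(2)[of n] by simp
      have diff: "norm (exp (\<i> * z n * of_real t) - exp (\<i> * l * of_real t)) \<le> exp M * (norm (z n - l) * \<bar>t\<bar>)"
        if "- (Im (z n) * t) \<le> M" "- (Im l * t) \<le> M" for M
      proof -
        have "norm (exp (\<i> * z n * of_real t) - exp (\<i> * l * of_real t)) \<le> exp M * norm (\<i> * z n * of_real t - \<i> * l * of_real t)"
          by (rule norm_exp_diff_le) (use that in auto)
        also have "\<i> * z n * of_real t - \<i> * l * of_real t = \<i> * (z n - l) * of_real t" by (simp add: algebra_simps)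
        finally show ?thesis by (simp add: norm_mult)
      qed
      show ?thesis
      proof (cases "t \<ge> 0")
        case True
        have "norm (exp (\<i> * z n * of_real t) - exp (\<i> * l * of_real t)) \<le> exp (- (\<tau> * t)) * (norm (z n - l) * \<bar>t\<bar>)"
          by (rule diff) (use True zIm[of n] \<tau> l mult_right_mono[of \<tau> "Im (z n)" t] in \<open>auto simp: \<tau>_def\<close>)
        moreover have "exp (- (\<tau> * t)) * t \<le> 1 / \<tau>"
        proof -
          have "\<tau> * t \<le> exp (\<tau> * t)" using exp_ge_add_one_self[of "\<tau> * t"] by linarith
          then show ?thesis using \<tau> by (simp add: exp_minus field_simps)
        qed
        ultimately have "norm (exp (\<i> * z n * of_real t) - exp (\<i> * l * of_real t)) \<le> norm (z n - l) * (1 / \<tau>)"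
          using True nz by (smt (verit, best) mult.commute mult.left_commute mult_left_mono norm_ge_zero)
        then have "norm (Q n t) \<le> 1 / \<tau>" using nz by (simp add: Q_def norm_divide divide_le_eq mult.commute)
        then show ?thesis by (simp add: B_def)
      next
        case False
        have tc: "\<bar>t\<bar> \<le> \<bar>c\<bar>" using False t by auto
        have *: "- (s * t) \<le> 3 * \<tau> * \<bar>c\<bar>" if "0 \<le> s" "s \<le> 3 * \<tau>" for s
        proof -
          have "s * \<bar>t\<bar> \<le> 3 * \<tau> * \<bar>c\<bar>" by (rule mult_mono) (use that tc \<tau> in auto)
          then show ?thesis using False by simp
        qed
        have "norm (exp (\<i> * z n * of_real t) - exp (\<i> * l * of_real t)) \<le> exp (3 * \<tau> * \<bar>c\<bar>) * (norm (z n - l) * \<bar>t\<bar>)"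
          by (rule diff) (use * zIm[of n] \<tau> in \<open>auto simp: \<tau>_def\<close>)
        also have "\<dots> \<le> exp (3 * \<tau> * \<bar>c\<bar>) * (norm (z n - l) * \<bar>c\<bar>)"
          using tc by (intro mult_left_mono) auto
        finally have "norm (Q n t) \<le> \<bar>c\<bar> * exp (3 * \<tau> * \<bar>c\<bar>)"
          using nz by (simp add: Q_def norm_divide divide_le_eq mult_ac)
        then show ?thesis by (simp add: B_def)
      qed
    qed
    have mQ: "Q n \<in> borel_measurable borel" for n
      unfolding Q_def by (intro borel_measurable_divide borel_measurable_diff m) auto
    have "(\<lambda>n. LINT t:{c..}|lebesgue. f t * Q n t) \<longlonglongrightarrow> (LINT t:{c..}|lebesgue. f t * (\<i> * of_real t * exp (\<i> * l * of_real t)))"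
    proof (rule fourier_laplace_dominated[OF f mQ _ Qb])
      show "(\<lambda>t. \<i> * complex_of_real t * exp (\<i> * l * complex_of_real t)) \<in> borel_measurable borel"
        by (intro borel_measurable_continuous_onI continuous_intros)
      fix t :: real
      have "((\<lambda>l. exp (\<i> * l * complex_of_real t)) has_field_derivative \<i> * of_real t * exp (\<i> * l * of_real t)) (at l)"
        by (auto intro!: derivative_eq_intros simp: algebra_simps)
      then show "(\<lambda>n. Q n t) \<longlonglongrightarrow> \<i> * of_real t * exp (\<i> * l * of_real t)"
        unfolding has_field_derivative_iff tendsto_at_iff_sequentially using zl z(2)
        by (auto simp: Q_def o_def)
    qed
    moreover have "(LINT t:{c..}|lebesgue. f t * Q n t) = (F (z n) - F l) / (z n - l)" for n
    proof -
      have i: "set_integrable lebesgue {c..} (\<lambda>t. f t * exp (\<i> * w * of_real t))" if "Im w \<ge> 0" for w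
        by (rule fourier_laplace_integrable[OF f m nexp[OF that]])
      have "(LINT t:{c..}|lebesgue. f t * Q n t)
          = (LINT t:{c..}|lebesgue. (f t * exp (\<i> * z n * of_real t) - f t * exp (\<i> * l * of_real t)) / (z n - l))"
        by (simp add: Q_def right_diff_distrib)
      also have "\<dots> = (F (z n) - F l) / (z n - l)"
        unfolding F_def using i[of "z n"] i[of l] zIm[of n] \<tau> l
        by (subst set_integral_divide_zero, subst set_integral_diff) auto
      finally show ?thesis .
    qed
    ultimately have "(\<lambda>n. (F (z n) - F l) / (z n - l)) \<longlonglongrightarrow> (LINT t:{c..}|lebesgue. f t * (\<i> * of_real t * exp (\<i> * l * of_real t)))"
      by simp
    then show "((\<lambda>y. (F y - F l) / (y - l)) \<circ> x) \<longlonglongrightarrow> (LINT t:{c..}|lebesgue. f t * (\<i> * of_real t * exp (\<i> * l * of_real t)))"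
      unfolding z_def o_def by (rule LIMSEQ_offset)
  qed
  then show "F holomorphic_on {l. 0 < Im l}"
    by (auto simp: holomorphic_on_def field_differentiable_def intro: has_field_derivative_at_within)
qed

text \<open>The increment of \<open>f\<close> over a unit interval tends to 0, and it is the mean of
  f' there, which tends to \<open>m\<close>.\<close>

lemma deriv_limit_zero:
  fixes f f' :: "real \<Rightarrow> complex"
  assumes d: "\<And>c d. 0 \<le> c \<Longrightarrow> c \<le> d \<Longrightarrow> (f' has_integral (f d - f c)) {c..d}"
    and f: "(f \<longlongrightarrow> l) at_top" and f': "(f' \<longlongrightarrow> m) at_top"
  shows "m = 0"
proof -
  have "norm m \<le> 0"
  proof (rule field_le_epsilon)
    fix e :: real assume e: "e > 0"
    have "\<forall>\<^sub>F x in at_top. dist (f x) l < e / 3" "\<forall>\<^sub>F x in at_top. dist (f' x) m < e / 3"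
      using tendstoD f f' e by (metis divide_pos_pos zero_less_numeral)+
    then have "\<forall>\<^sub>F x in at_top. dist (f x) l < e / 3 \<and> dist (f' x) m < e / 3 \<and> x \<ge> 0"
      using eventually_ge_at_top[of "0::real"] by eventually_elim auto
    then obtain X where X: "\<And>x. x \<ge> X \<Longrightarrow> norm (f x - l) < e / 3 \<and> norm (f' x - m) < e / 3 \<and> x \<ge> 0"
      unfolding eventually_at_top_linorder dist_norm by blast
    have "((\<lambda>t. f' t - m) has_integral (f (X+1) - f X - (X + 1 - X) *\<^sub>R m)) {X..X+1}"
      using d[of X "X+1"] X[of X] has_integral_const_real[of m X "X+1"] by (intro has_integral_diff) auto
    then have "((\<lambda>t. f' t - m) has_integral (f (X+1) - f X - m)) {X..X+1}" by simp
    then have "norm (f (X+1) - f X - m) \<le> e / 3 * measure lborel {X..X+1}"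
      by (rule has_integral_bound_real[rotated 2, where S = "{}"]) (use X e in \<open>auto intro: less_imp_le\<close>)
    moreover have "norm m \<le> norm (f (X+1) - f X - m) + norm (f (X+1) - l) + norm (f X - l)"
      by (smt (verit) norm_minus_commute norm_triangle_ineq3 norm_triangle_sub diff_add_cancel diff_diff_eq2 add_diff_cancel)
    ultimately show "norm m \<le> 0 + e" using X[of X] X[of "X+1"] by simp
  qed
  then show ?thesis by simp
qed

subsection \<open>Jost solutions\<close>

lemma bounded_at_top_of_limit:
  fixes g :: "real \<Rightarrow> complex"
  assumes "continuous_on {c..} g" "(g \<longlongrightarrow> l) at_top"
  obtains B where "\<And>x. c \<le> x \<Longrightarrow> norm (g x) \<le> B"
proof -
  have "\<forall>\<^sub>F x in at_top. dist (g x) l < 1" using assms(2) tendstoD zero_less_one by blast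
  then obtain X where X: "\<And>x. x \<ge> X \<Longrightarrow> dist (g x) l < 1" unfolding eventually_at_top_linorder by blast
  have "compact (g ` {c..X})"
    by (rule compact_continuous_image[OF continuous_on_subset[OF assms(1)]]) auto
  then obtain B where B: "\<And>x. x \<in> {c..X} \<Longrightarrow> norm (g x) \<le> B"
    using compact_imp_bounded bounded_iff by (metis imageI)
  show thesis
  proof (rule that[of "max B (1 + norm l)"])
    fix x assume "c \<le> x"
    show "norm (g x) \<le> max B (1 + norm l)"
    proof (cases "x \<le> X")
      case True then show ?thesis using B[of x] \<open>c \<le> x\<close> by auto
    next
      case False
      then have "norm (g x - l) < 1" using X[of x] by (simp add: dist_norm)
      then show ?thesis using norm_triangle_sub[of "g x" l] by linarith
    qed
  qed
qed

context sl_problem begin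

text \<open>Lagrange's identity against an exponential. Where rho is constant, the choice of
  \<open>k\<close> cancels the spectral term and only \<open>q\<close> is left. The condition on rho
  omits the right endpoint to admit d = a, where rho has already jumped.\<close>

lemma exp_transport:
  assumes y: "sl_sol (wt l) y y'" and k: "k\<^sup>2 = of_real (\<kappa>\<^sup>2) * l\<^sup>2" and cd: "0 \<le> c" "c \<le> d"
    and \<rho>: "\<And>t. c \<le> t \<Longrightarrow> t < d \<Longrightarrow> \<rho> t = \<kappa>\<^sup>2"
  shows "((\<lambda>t. of_real (q t) * (exp (\<i> * k * of_real t) * y t)) has_integral
            (exp (\<i> * k * of_real d) * (y' d - \<i> * k * y d) - exp (\<i> * k * of_real c) * (y' c - \<i> * k * y c))) {c..d}"
proof -
  have "((\<lambda>t. (wt l t - (- k\<^sup>2)) * exp (\<i> * k * of_real t) * y t) has_integral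
            (exp (\<i> * k * of_real d) * (y' d - \<i> * k * y d) - exp (\<i> * k * of_real c) * (y' c - \<i> * k * y c))) {c..d}"
    using sl_sol_wronskian[OF sl_sol_exp y cd, of k] by (simp add: wronskian_def algebra_simps)
  then show ?thesis
    by (rule has_integral_spike_finite[of "{d}", rotated 2]) (use \<rho> k in \<open>auto simp: wt_def\<close>)
qed

lemma rho_right: "a \<le> t \<Longrightarrow> \<rho> t = 1\<^sup>2" and rho_left: "t < a \<Longrightarrow> \<rho> t = \<alpha>\<^sup>2"
  by (auto simp: rho_def)

text \<open>Beyond \<open>a\<close> the combination U = h + i l g has the integrable derivative q g,
  so it converges; hence g' = U - 2 i l g converges too. As \<open>g\<close> converges, g' tends to
  0, which determines the limit of \<open>U\<close> and then that of \<open>h\<close>.\<close>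

lemma jost_deriv_limit:
  assumes y: "sl_sol (wt l) y y'"
    and g: "((\<lambda>x. y x * exp (- (\<i> * l * of_real x))) \<longlongrightarrow> c0) at_top"
  shows "((\<lambda>x. y' x * exp (- (\<i> * l * of_real x))) \<longlongrightarrow> \<i> * l * c0) at_top"
proof -
  define g where "g = (\<lambda>x. y x * exp (- (\<i> * l * of_real x)))"
  define h where "h = (\<lambda>x. y' x * exp (- (\<i> * l * of_real x)))"
  define U where "U = (\<lambda>x. h x + \<i> * l * g x)"
  have gl: "(g \<longlongrightarrow> c0) at_top" using g by (simp add: g_def)
  have cg: "continuous_on {0..} g"
    unfolding g_def by (intro continuous_intros sl_sol_continuous[OF y])
  have cga: "continuous_on {a..} g" using cg by (rule continuous_on_subset) (use a_pos in auto)
  have UI: "((\<lambda>t. of_real (q t) * g t) has_integral (U x - U a)) {a..x}" if "a \<le> x" for x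
    using exp_transport[OF y, of "-l" 1 a x] rho_right that a_pos
    by (simp add: g_def h_def U_def algebra_simps)
  obtain B where B: "\<And>x. a \<le> x \<Longrightarrow> norm (g x) \<le> B" using bounded_at_top_of_limit[OF cga gl] by blast
  have qa: "(\<lambda>t. complex_of_real (q t)) absolutely_integrable_on {a..}"
  proof -
    have "q absolutely_integrable_on {a..}"
      by (rule set_integrable_subset[OF q_abs]) (use a_pos in auto)
    from absolutely_integrable_linear[OF this, of complex_of_real]
    show ?thesis using bounded_linear_of_real by (simp add: o_def)
  qed
  have "(\<lambda>t. g t * complex_of_real (q t)) absolutely_integrable_on {a..}"
  proof (rule absolutely_integrable_bounded_measurable_product[where h = "(*)" and f = g])
    show "bilinear ((*) :: complex \<Rightarrow> complex \<Rightarrow> complex)" by (simp add: bilinear_times)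
    show "g \<in> borel_measurable (lebesgue_on {a..})"
      by (rule continuous_imp_measurable_on_sets_lebesgue[OF cga]) auto
    show "bounded (g ` {a..})" using B by (auto simp: bounded_iff)
  qed (use qa in auto)
  then have qg: "set_integrable lebesgue {a..} (\<lambda>t. of_real (q t) * g t)" by (simp add: mult.commute)
  have "((\<lambda>x. LINT t:{a..x}|lebesgue. of_real (q t) * g t) \<longlongrightarrow> (LINT t:{a..}|lebesgue. of_real (q t) * g t)) at_top"
    by (rule tendsto_set_lebesgue_integral_at_top[OF _ qg]) auto
  moreover have "\<forall>\<^sub>F x in at_top. (LINT t:{a..x}|lebesgue. of_real (q t) * g t) = U x - U a"
    using eventually_ge_at_top[of a]
  proof eventually_elim
    case (elim x)
    have "set_integrable lebesgue {a..x} (\<lambda>t. of_real (q t) * g t)"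
      by (rule set_integrable_subset[OF qg]) auto
    from set_lebesgue_integral_eq_integral(2)[OF this] show ?case
      using integral_unique[OF UI[OF elim]] by simp
  qed
  ultimately have "((\<lambda>x. U x - U a) \<longlongrightarrow> (LINT t:{a..}|lebesgue. of_real (q t) * g t)) at_top"
    using tendsto_cong by force
  from tendsto_add[OF this tendsto_const[of "U a"]]
  obtain L where L: "(U \<longlongrightarrow> L) at_top" by auto
  have "((\<lambda>x. U x - 2 * \<i> * l * g x) \<longlongrightarrow> L - 2 * \<i> * l * c0) at_top"
    by (intro tendsto_intros L gl)
  moreover have "((\<lambda>x. U x - 2 * \<i> * l * g x) has_integral (g d - g c)) {c..d}" if cd: "0 \<le> c" "c \<le> d" for c d
  proof (rule fundamental_theorem_of_calculus[OF cd(2)])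
    fix x assume x: "x \<in> {c..d}"
    have 1: "(y has_vector_derivative y' x) (at x within {c..d})"
      using sl_solD(2)[OF y, of x] x cd by (auto intro: has_vector_derivative_within_subset)
    have 2: "((\<lambda>x. exp (- (\<i> * l * of_real x))) has_vector_derivative - (\<i> * l) * exp (- (\<i> * l * of_real x))) (at x within {c..d})"
      by (rule has_vector_derivative_real_field[where f = "\<lambda>z. exp (- (\<i> * l * z))", THEN has_vector_derivative_at_within])
         (auto intro!: derivative_eq_intros)
    show "(g has_vector_derivative U x - 2 * \<i> * l * g x) (at x within {c..d})"
      using has_vector_derivative_mult[OF 1 2] by (simp add: g_def U_def h_def algebra_simps)
  qed
  ultimately have "L - 2 * \<i> * l * c0 = 0"
    using deriv_limit_zero[OF _ gl] by blast
  moreover have "((\<lambda>x. U x - \<i> * l * g x) \<longlongrightarrow> L - \<i> * l * c0) at_top"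
    by (intro tendsto_intros L gl)
  ultimately have "(h \<longlongrightarrow> \<i> * l * c0) at_top" by (simp add: U_def algebra_simps)
  then show ?thesis by (simp add: h_def)
qed

text \<open>The normalization passes to derivatives, so the Wronskian of one solution with the
  difference, multiplied by the square of exp (- i l x), tends to 0. That exponential has modulus at
  least 1, so the constant Wronskian is 0 and the difference is a multiple of the solution; its
  limit makes the factor 0.\<close>

lemma jost_unique:
  assumes y: "sl_sol (wt l) y y'" and z: "sl_sol (wt l) z z'" and l: "0 \<le> Im l"
    and yl: "((\<lambda>x. y x * exp (- (\<i> * l * of_real x))) \<longlongrightarrow> 1) at_top"
    and zl: "((\<lambda>x. z x * exp (- (\<i> * l * of_real x))) \<longlongrightarrow> 1) at_top"
    and x: "0 \<le> x"
  shows "y x = z x" "y' x = z' x"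
proof -
  define E where "E = (\<lambda>x. exp (- (\<i> * l * complex_of_real x)))"
  define D where "D = (\<lambda>x. z x + (-1) * y x)"
  define D' where "D' = (\<lambda>x. z' x + (-1) * y' x)"
  have D: "sl_sol (wt l) D D'"
    using sl_sol_cmult_add[OF z y, of 1 "-1"] by (simp add: D_def D'_def)
  have Dl: "((\<lambda>x. D x * E x) \<longlongrightarrow> 0) at_top"
    using tendsto_diff[OF zl yl] by (simp add: D_def E_def algebra_simps)
  have D'l: "((\<lambda>x. D' x * E x) \<longlongrightarrow> 0) at_top"
    using jost_deriv_limit[OF D, of 0] Dl by (simp add: E_def)
  have y'l: "((\<lambda>x. y' x * E x) \<longlongrightarrow> \<i> * l) at_top"
    using jost_deriv_limit[OF y yl] by (simp add: E_def)
  have yl': "((\<lambda>x. y x * E x) \<longlongrightarrow> 1) at_top" using yl by (simp add: E_def)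
  have "((\<lambda>x. (y x * E x) * (D' x * E x) - (y' x * E x) * (D x * E x)) \<longlongrightarrow> 1 * 0 - \<i> * l * 0) at_top"
    by (intro tendsto_intros yl' y'l Dl D'l)
  moreover have "\<forall>\<^sub>F x in at_top. norm (wronskian y y' D D' 0) \<le> norm ((y x * E x) * (D' x * E x) - (y' x * E x) * (D x * E x))"
    using eventually_ge_at_top[of "0::real"]
  proof eventually_elim
    case (elim x)
    have "1 \<le> exp (Im l * x)" using elim l by simp
    then have "1 \<le> norm (E x)" by (simp add: E_def)
    then have "1 * 1 \<le> norm (E x) * norm (E x)" by (intro mult_mono) auto
    then have "norm (wronskian y y' D D' x) * 1 \<le> norm (wronskian y y' D D' x) * (norm (E x) * norm (E x))"
      by (intro mult_left_mono) auto
    also have "\<dots> = norm (wronskian y y' D D' x * (E x * E x))" by (simp only: norm_mult)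
    also have "wronskian y y' D D' x * (E x * E x) = (y x * E x) * (D' x * E x) - (y' x * E x) * (D x * E x)"
      by (simp add: wronskian_def algebra_simps)
    finally show ?case using sl_sol_wronskian_const[OF y D elim] by simp
  qed
  ultimately have "norm (wronskian y y' D D' 0) \<le> 0"
    by (elim tendsto_lowerbound[OF tendsto_norm_zero, rotated]) simp_all
  then have W: "y 0 * D' 0 = y' 0 * D 0" by (simp add: wronskian_def)
  have nz: "y 0 \<noteq> 0 \<or> y' 0 \<noteq> 0"
  proof (rule ccontr)
    assume "\<not> ?thesis"
    then have y0: "y x = 0" if "x \<ge> 0" for x using sl_sol_zero_unique(1)[OF y] that by auto
    have "\<forall>\<^sub>F x in at_top. y x * E x = 0"
      using eventually_ge_at_top[of "0::real"] by eventually_elim (simp add: y0)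
    then have "((\<lambda>x. y x * E x) \<longlongrightarrow> 0) at_top" by (rule tendsto_eventually)
    then show False using yl' tendsto_unique trivial_limit_at_top_linorder zero_neq_one by metis
  qed
  \<comment> \<open>The two initial values do not vanish together, but either one may.\<close>
  define c where "c = (if y 0 \<noteq> 0 then D 0 / y 0 else D' 0 / y' 0)"
  \<comment> \<open>The summand with factor 0 brings the multiple into the form of
    \<open>sl_sol_cmult_add\<close>.\<close>
  have c: "D 0 = c * y 0 + 0 * y 0" "D' 0 = c * y' 0 + 0 * y' 0"
    using W nz by (auto simp: c_def field_simps)
  have Dc: "D x = c * y x" "D' x = c * y' x" if "x \<ge> 0" for x
    using sl_sol_unique[OF D sl_sol_cmult_add[OF y y, of c 0] c that] by auto
  have "\<forall>\<^sub>F x in at_top. c * (y x * E x) = D x * E x"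
    using eventually_ge_at_top[of "0::real"] by eventually_elim (simp add: Dc)
  then have "((\<lambda>x. D x * E x) \<longlongrightarrow> c * 1) at_top"
    by (rule Lim_transform_eventually[OF tendsto_mult[OF tendsto_const yl']])
  then have "c = 0" using Dl tendsto_unique trivial_limit_at_top_linorder by (metis mult.right_neutral)
  then show "y x = z x" "y' x = z' x" using Dc[OF x] by (auto simp: D_def D'_def)
qed

definition cos_sol :: "complex \<Rightarrow> real \<Rightarrow> complex" where "cos_sol l = ivp_sol (wt l) 1 0"
definition sin_sol :: "complex \<Rightarrow> real \<Rightarrow> complex" where "sin_sol l = ivp_sol (wt l) 0 1"
definition cos_deriv :: "complex \<Rightarrow> real \<Rightarrow> complex" where "cos_deriv l = ivp_deriv (wt l) 1 0"
definition sin_deriv :: "complex \<Rightarrow> real \<Rightarrow> complex" where "sin_deriv l = ivp_deriv (wt l) 0 1"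

lemma cos_sin_sol:
  shows "sl_sol (wt l) (cos_sol l) (cos_deriv l)" "sl_sol (wt l) (sin_sol l) (sin_deriv l)"
    and "cos_sol l 0 = 1" "cos_deriv l 0 = 0" "sin_sol l 0 = 0" "sin_deriv l 0 = 1"
  unfolding cos_sol_def sin_sol_def cos_deriv_def sin_deriv_def
  using ivp_sol_props[OF loc_abs_int_wt] by auto

lemma sl_sol_repr:
  assumes "sl_sol (wt l) y y'" "0 \<le> x"
  shows "y x = y 0 * cos_sol l x + y' 0 * sin_sol l x"
  by (rule sl_sol_unique(1)[OF assms(1) sl_sol_cmult_add[OF cos_sin_sol(1,2)] _ _ assms(2)])
     (simp_all add: cos_sin_sol)

lemma cos_sin_sol_holomorphic:
  assumes "0 \<le> x"
  shows "(\<lambda>l. cos_sol l x) holomorphic_on A" "(\<lambda>l. sin_sol l x) holomorphic_on A"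
proof -
  have "(\<lambda>l. ivp_sol (wt l) u0 u1 x) holomorphic_on A" for u0 u1
  proof -
    have "(\<lambda>\<mu>. ivp_sol (\<lambda>t. of_real (q t) + \<mu> * of_real (\<rho> t)) u0 u1 x) \<circ> (\<lambda>l. - l\<^sup>2) holomorphic_on A"
      by (rule holomorphic_on_compose_gen[OF _ ivp_sol_holomorphic[OF loc_abs_int_q loc_abs_int_rho assms]])
         (auto intro!: holomorphic_intros)
    then show ?thesis by (simp add: o_def wt_def[abs_def])
  qed
  then show "(\<lambda>l. cos_sol l x) holomorphic_on A" "(\<lambda>l. sin_sol l x) holomorphic_on A"
    unfolding cos_sol_def sin_sol_def by auto
qed

lemma cos_sin_sol_bounded:
  obtains B where "\<And>l x. norm l \<le> R \<Longrightarrow> x \<in> {0..X} \<Longrightarrow> norm (cos_sol l x) \<le> B \<and> norm (sin_sol l x) \<le> B"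
proof -
  have *: "\<exists>B. \<forall>l x. norm l \<le> R \<longrightarrow> x \<in> {0..X} \<longrightarrow> norm (ivp_sol (wt l) u0 u1 x) \<le> B" for u0 u1
  proof -
    obtain B where B: "\<And>\<mu> x. norm \<mu> \<le> R\<^sup>2 \<Longrightarrow> x \<in> {0..X} \<Longrightarrow> norm (ivp_sol (\<lambda>t. of_real (q t) + \<mu> * of_real (\<rho> t)) u0 u1 x) \<le> B"
      using ivp_sol_bounded[OF loc_abs_int_q loc_abs_int_rho, of "R\<^sup>2" X u0 u1] by auto
    show ?thesis
    proof (intro exI[of _ B] allI impI)
      fix l :: complex and x assume "norm l \<le> R" "x \<in> {0..X}"
      then show "norm (ivp_sol (wt l) u0 u1 x) \<le> B"
        using B[of "- l\<^sup>2" x] by (simp add: wt_def[abs_def] norm_power power_mono)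
    qed
  qed
  obtain B1 where B1: "\<And>l x. norm l \<le> R \<Longrightarrow> x \<in> {0..X} \<Longrightarrow> norm (cos_sol l x) \<le> B1"
    using *[of 1 0] unfolding cos_sol_def by auto
  obtain B2 where B2: "\<And>l x. norm l \<le> R \<Longrightarrow> x \<in> {0..X} \<Longrightarrow> norm (sin_sol l x) \<le> B2"
    using *[of 0 1] unfolding sin_sol_def by auto
  show thesis by (rule that[of "max B1 B2"]) (use B1 B2 in \<open>auto simp: le_max_iff_disj\<close>)
qed

text \<open>The derivative 1 at 0 excludes vanishing on the whole half line. Dividing by such a
  value expresses e' at 0 through values of \<open>e\<close>.\<close>

lemma sin_sol_nonzero: obtains x where "0 < x" "sin_sol l x \<noteq> 0"
proof -
  have d1: "(sin_sol l has_vector_derivative 1) (at 0 within {0..})"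
    using sl_solD(2)[OF cos_sin_sol(2), of 0 l] by (simp add: cos_sin_sol)
  have "\<exists>x>0. sin_sol l x \<noteq> 0"
  proof (rule ccontr)
    assume "\<not> ?thesis"
    then have "sin_sol l x = 0" if "x \<in> {0..}" for x
      using that cos_sin_sol(5) by (cases "x = 0") auto
    then have "(sin_sol l has_vector_derivative 0) (at 0 within {0..})"
      by (intro has_vector_derivative_transform[OF _ _ has_vector_derivative_const]) auto
    then show False using vector_derivative_half_line[OF d1] vector_derivative_half_line by fastforce
  qed
  then show thesis using that by blast
qed

end

section \<open>Regularity and symmetry of the Jost solution\<close>

locale jost_problem = sl_problem +
  fixes e :: "real \<Rightarrow> complex \<Rightarrow> complex"
  assumes jost: "jost_solution a \<alpha> q e"
begin

definition e' :: "real \<Rightarrow> complex \<Rightarrow> complex" where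
  "e' x l = vector_derivative (\<lambda>x. e x l) (at x within {0..})"

lemma deriv0_eq: "deriv0 e l = e' 0 l"
  by (simp add: deriv0_def e'_def)

lemma e_sol: "0 \<le> Im l \<Longrightarrow> sl_sol (wt l) (\<lambda>x. e x l) (\<lambda>x. e' x l)"
  using jost solves_sl_imp_sl_sol unfolding jost_solution_def e'_def by blast

lemma e_lim: "0 \<le> Im l \<Longrightarrow> ((\<lambda>x. e x l * exp (- (\<i> * l * of_real x))) \<longlongrightarrow> 1) at_top"
  using jost unfolding jost_solution_def by blast

lemma e'_lim: "0 \<le> Im l \<Longrightarrow> ((\<lambda>x. e' x l * exp (- (\<i> * l * of_real x))) \<longlongrightarrow> \<i> * l) at_top"
  using jost_deriv_limit[OF e_sol e_lim] by simp

text \<open>The kernel representation is unfolded only here. The estimates for large x and for large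
  \<open>l\<close> come from the equation and the normalization at infinity.\<close>

lemma e_regular:
  assumes "0 \<le> x"
  shows e_continuous: "continuous_on {l. 0 \<le> Im l} (e x)"
    and e_holomorphic: "e x holomorphic_on {l. 0 < Im l}"
proof -
  obtain K :: "real \<Rightarrow> real \<Rightarrow> complex" where K: "set_integrable lebesgue {mu_plus a \<alpha> x..} (K x)"
    and e: "\<And>l. 0 \<le> Im l \<Longrightarrow> e x l = jost_e0 a \<alpha> x l + (LINT t:{mu_plus a \<alpha> x..}|lebesgue. K x t * exp (\<i> * l * of_real t))"
    using jost assms unfolding jost_solution_def by metis
  have "continuous_on {l. 0 \<le> Im l} (\<lambda>l. jost_e0 a \<alpha> x l + (LINT t:{mu_plus a \<alpha> x..}|lebesgue. K x t * exp (\<i> * l * of_real t)))"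
    unfolding jost_e0_def by (intro continuous_intros fourier_laplace_continuous[OF K])
  then show "continuous_on {l. 0 \<le> Im l} (e x)"
    using e by (subst continuous_on_cong[OF refl]) auto
  have "(\<lambda>l. jost_e0 a \<alpha> x l + (LINT t:{mu_plus a \<alpha> x..}|lebesgue. K x t * exp (\<i> * l * of_real t))) holomorphic_on {l. 0 < Im l}"
    unfolding jost_e0_def by (intro holomorphic_intros fourier_laplace_holomorphic[OF K])
  then show "e x holomorphic_on {l. 0 < Im l}"
    using e by (subst holomorphic_cong[OF refl]) auto
qed

lemma e_repr: "0 \<le> Im l \<Longrightarrow> 0 \<le> x \<Longrightarrow> e x l = e 0 l * cos_sol l x + e' 0 l * sin_sol l x"
  using sl_sol_repr[OF e_sol] .

text \<open>The kernel representation says nothing about the derivative. It is recovered by solving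
  \<open>e_repr\<close> for e' at 0, at a point \<open>x\<close> that depends on
  \<open>l\<close>.\<close>

lemma e'0_continuous: "continuous_on {l. 0 \<le> Im l} (e' 0)"
  unfolding continuous_on_eq_continuous_within
proof
  fix l assume l: "l \<in> {l. 0 \<le> Im l}"
  obtain x where x: "0 < x" "sin_sol l x \<noteq> 0" using sin_sol_nonzero .
  have c: "continuous (at w within S) (\<lambda>l. sin_sol l x)" "continuous (at w within S) (\<lambda>l. cos_sol l x)" for w S
    using cos_sin_sol_holomorphic[of x UNIV, THEN holomorphic_on_imp_continuous_on] x
    by (auto simp: continuous_on_eq_continuous_at intro: continuous_at_imp_continuous_at_within)
  have "continuous (at l within {l. 0 \<le> Im l}) (\<lambda>l. (e x l - e 0 l * cos_sol l x) / sin_sol l x)"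
    by (intro continuous_intros c x)
       (use e_continuous[of x] e_continuous[of 0] x l in \<open>auto simp: continuous_on_eq_continuous_within\<close>)
  moreover have "\<forall>\<^sub>F w in at l within {l. 0 \<le> Im l}. (e x w - e 0 w * cos_sol w x) / sin_sol w x = e' 0 w"
  proof -
    have "\<forall>\<^sub>F w in at l within {l. 0 \<le> Im l}. sin_sol w x \<noteq> 0"
      using c(1)[of l "{l. 0 \<le> Im l}"] x(2) unfolding continuous_within by (rule tendsto_imp_eventually_ne)
    moreover have "\<forall>\<^sub>F w in at l within {l. 0 \<le> Im l}. 0 \<le> Im w"
      by (auto simp: eventually_at_filter)
    ultimately show ?thesis by eventually_elim (use e_repr[of _ x] x in auto)
  qed
  moreover have "(e x l - e 0 l * cos_sol l x) / sin_sol l x = e' 0 l"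
    using e_repr[of l x] x l by auto
  ultimately show "continuous (at l within {l. 0 \<le> Im l}) (e' 0)"
    unfolding continuous_within by (auto dest: Lim_transform_eventually)
qed

lemma e'0_holomorphic: "e' 0 holomorphic_on {l. 0 < Im l}"
  unfolding holomorphic_on_def
proof
  fix l assume l: "l \<in> {l. 0 < Im l}"
  obtain x where x: "0 < x" "sin_sol l x \<noteq> 0" using sin_sol_nonzero .
  define S where "S = {l. 0 < Im l} \<inter> {w. sin_sol w x \<noteq> 0}"
  have hs: "(\<lambda>l. sin_sol l x) holomorphic_on UNIV" using cos_sin_sol_holomorphic x by auto
  have "open ((\<lambda>l. sin_sol l x) -` (- {0}))"
    by (rule open_vimage) (use hs holomorphic_on_imp_continuous_on in auto)
  then have "open S" unfolding S_def by (intro open_Int open_halfspace_Im_gt) (simp add: vimage_def)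
  have "(\<lambda>l. (e x l - e 0 l * cos_sol l x) / sin_sol l x) holomorphic_on S"
    using x
    by (intro holomorphic_intros cos_sin_sol_holomorphic holomorphic_on_subset[OF e_holomorphic])
       (auto simp: S_def)
  moreover have "(e x w - e 0 w * cos_sol w x) / sin_sol w x = e' 0 w" if "w \<in> S" for w
    using e_repr[of w x] x that by (auto simp: S_def)
  ultimately have "e' 0 holomorphic_on S" using holomorphic_cong by (metis (no_types, lifting))
  then show "e' 0 field_differentiable (at l within {l. 0 < Im l})"
    using \<open>open S\<close> l x by (auto simp: S_def intro: holomorphic_on_imp_differentiable_at field_differentiable_at_within)
qed

lemma wt_minus_cnj: "wt (- cnj l) t = cnj (wt l t)"
  by (simp add: wt_def)

text \<open>The map from l to - cnj l preserves the upper half plane and, since \<open>q\<close> and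
  rho are real, conjugates the equation; uniqueness does the rest. It yields reality on the
  imaginary axis and, at the end, the oddness of the comparison function.\<close>

lemma e_minus_cnj:
  assumes l: "0 \<le> Im l" and x: "0 \<le> x"
  shows "e x (- cnj l) = cnj (e x l)" "e' x (- cnj l) = cnj (e' x l)"
proof -
  have "sl_sol (wt (- cnj l)) (\<lambda>x. cnj (e x l)) (\<lambda>x. cnj (e' x l))"
    using sl_sol_cnj[OF e_sol[OF l]] wt_minus_cnj by (simp add: wt_minus_cnj[abs_def])
  moreover have "((\<lambda>x. cnj (e x l) * exp (- (\<i> * (- cnj l) * of_real x))) \<longlongrightarrow> 1) at_top"
  proof -
    have "cnj (exp (- (\<i> * l * complex_of_real x))) = exp (- (\<i> * (- cnj l) * of_real x))" for x
      by (simp add: exp_cnj)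
    then show ?thesis using tendsto_cnj[OF e_lim[OF l]] by simp
  qed
  ultimately show "e x (- cnj l) = cnj (e x l)" "e' x (- cnj l) = cnj (e' x l)"
    using jost_unique[OF e_sol _ _ e_lim _ x, of "- cnj l"] l by auto
qed

text \<open>The Wronskian is constant, and its value is read off at infinity, where the exponentials
  have modulus 1.\<close>

lemma e_wronskian_real:
  assumes "Im l = 0" "0 \<le> x"
  shows "e x l * cnj (e' x l) - e' x l * cnj (e x l) = - 2 * \<i> * l"
proof -
  define E where "E = (\<lambda>x. exp (- (\<i> * l * complex_of_real x)))"
  have cl: "cnj l = l" using assms(1) by (simp add: complex_eq_iff)
  have E1: "E x * cnj (E x) = 1" for x
    by (simp add: E_def exp_cnj cl flip: exp_add)
  have wl: "wt (- cnj l) = wt l" by (simp add: wt_def cl fun_eq_iff)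
  have s: "sl_sol (wt l) (\<lambda>x. cnj (e x l)) (\<lambda>x. cnj (e' x l))"
    using sl_sol_cnj[OF e_sol[of l]] assms wl by (simp flip: wt_minus_cnj)
  have c: "wronskian (\<lambda>x. e x l) (\<lambda>x. e' x l) (\<lambda>x. cnj (e x l)) (\<lambda>x. cnj (e' x l)) x
      = wronskian (\<lambda>x. e x l) (\<lambda>x. e' x l) (\<lambda>x. cnj (e x l)) (\<lambda>x. cnj (e' x l)) 0" if "0 \<le> x" for x
    by (rule sl_sol_wronskian_const[OF e_sol s that]) (use assms in auto)
  have lims: "((\<lambda>x. e x l * E x) \<longlongrightarrow> 1) at_top" "((\<lambda>x. e' x l * E x) \<longlongrightarrow> \<i> * l) at_top"
    using e_lim e'_lim assms by (auto simp: E_def)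
  have "((\<lambda>x. (e x l * E x) * cnj (e' x l * E x) - (e' x l * E x) * cnj (e x l * E x)) \<longlongrightarrow> 1 * cnj (\<i> * l) - \<i> * l * cnj 1) at_top"
    by (intro tendsto_intros lims)
  moreover have "(e x l * E x) * cnj (e' x l * E x) - (e' x l * E x) * cnj (e x l * E x)
       = wronskian (\<lambda>x. e x l) (\<lambda>x. e' x l) (\<lambda>x. cnj (e x l)) (\<lambda>x. cnj (e' x l)) x * (E x * cnj (E x))" for x
    by (simp add: wronskian_def algebra_simps)
  ultimately have "((\<lambda>x. wronskian (\<lambda>x. e x l) (\<lambda>x. e' x l) (\<lambda>x. cnj (e x l)) (\<lambda>x. cnj (e' x l)) x) \<longlongrightarrow> - 2 * \<i> * l) at_top"
    by (simp add: E1 cl mult.assoc)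
  moreover have "((\<lambda>x. wronskian (\<lambda>x. e x l) (\<lambda>x. e' x l) (\<lambda>x. cnj (e x l)) (\<lambda>x. cnj (e' x l)) x)
       \<longlongrightarrow> wronskian (\<lambda>x. e x l) (\<lambda>x. e' x l) (\<lambda>x. cnj (e x l)) (\<lambda>x. cnj (e' x l)) 0) at_top"
    by (rule tendsto_eventually[OF eventually_mono[OF eventually_ge_at_top[of "0::real"] c]])
  ultimately have "wronskian (\<lambda>x. e x l) (\<lambda>x. e' x l) (\<lambda>x. cnj (e x l)) (\<lambda>x. cnj (e' x l)) 0 = - 2 * \<i> * l"
    using tendsto_unique[OF trivial_limit_at_top_linorder] by blast
  then show ?thesis using c[OF assms(2)] by (simp only: wronskian_def)
qed

end

subsection \<open>Asymptotics of the Jost solution\<close>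

text \<open>Absorption: the supremum S satisfies S <= c + theta S. The crude bound \<open>B0\<close>
  is what makes S finite.\<close>

lemma sup_bound_improve:
  fixes f :: "'a \<Rightarrow> real"
  assumes bdd: "\<And>t. t \<in> T \<Longrightarrow> f t \<le> B0" and \<theta>: "\<theta> < 1"
    and step: "\<And>B. (\<And>t. t \<in> T \<Longrightarrow> f t \<le> B) \<Longrightarrow> (\<And>t. t \<in> T \<Longrightarrow> f t \<le> c + \<theta> * B)"
    and t: "t \<in> T"
  shows "f t \<le> c / (1 - \<theta>)"
proof -
  define S where "S = (SUP t\<in>T. f t)"
  have bd: "bdd_above (f ` T)" using bdd by (auto simp: bdd_above_def)
  have le: "f t \<le> S" if "t \<in> T" for t unfolding S_def using bd that by (rule cSUP_upper2) simp
  have "S \<le> c + \<theta> * S" unfolding S_def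
    by (rule cSUP_least) (use t step[OF le] in \<open>auto simp: S_def\<close>)
  then have "S \<le> c / (1 - \<theta>)" using \<theta> by (simp add: field_simps)
  then show ?thesis using le[OF t] by linarith
qed

context jost_problem begin

text \<open>Without the free exponential the solution can be bounded uniformly in
  \<open>l\<close>.\<close>

definition g :: "complex \<Rightarrow> real \<Rightarrow> complex" where "g l x = e x l * exp (- (\<i> * l * of_real x))"
definition h :: "complex \<Rightarrow> real \<Rightarrow> complex" where "h l x = e' x l * exp (- (\<i> * l * of_real x))"

lemma e_eq_g: "e x l = g l x * exp (\<i> * l * of_real x)" and e'_eq_h: "e' x l = h l x * exp (\<i> * l * of_real x)"
  by (simp_all add: g_def h_def mult.assoc flip: exp_add)

lemma continuous_on_g: "0 \<le> Im l \<Longrightarrow> continuous_on {0..} (g l)"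
  unfolding g_def[abs_def] by (intro continuous_intros sl_sol_continuous[OF e_sol])

lemma g_lim: "0 \<le> Im l \<Longrightarrow> (g l \<longlongrightarrow> 1) at_top" and h_lim: "0 \<le> Im l \<Longrightarrow> (h l \<longlongrightarrow> \<i> * l) at_top"
  using e_lim e'_lim by (simp_all add: g_def[abs_def] h_def[abs_def])

lemma norm_integral_q_le:
  fixes u :: "real \<Rightarrow> complex"
  assumes "0 \<le> c" "((\<lambda>t. of_real (q t) * u t) has_integral I) {c..d}"
    and "\<And>t. t \<in> {c..d} \<Longrightarrow> norm (u t) \<le> B"
  shows "norm I \<le> \<bar>B\<bar> * qm"
proof -
  have "norm (integral {c..d} (\<lambda>t. of_real (q t) * u t)) \<le> integral {c..d} (\<lambda>t. \<bar>B\<bar> * \<bar>q t\<bar>)"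
  proof (rule Henstock_Kurzweil_Integration.integral_norm_bound_integral)
    show "(\<lambda>t. \<bar>B\<bar> * \<bar>q t\<bar>) integrable_on {c..d}" by (rule integrable_on_mult_right[OF abs_q_int[OF assms(1)]])
    fix t assume "t \<in> {c..d}"
    then have "norm (u t) \<le> \<bar>B\<bar>" using assms(3)[of t] by linarith
    then show "norm (of_real (q t) * u t) \<le> \<bar>B\<bar> * \<bar>q t\<bar>"
      using mult_left_mono[of "norm (u t)" "\<bar>B\<bar>" "\<bar>q t\<bar>"] by (simp add: norm_mult mult.commute)
  qed (use assms(2) in auto)
  also have "\<dots> = \<bar>B\<bar> * integral {c..d} (\<lambda>t. \<bar>q t\<bar>)" by simp
  also have "\<dots> \<le> \<bar>B\<bar> * qm" by (intro mult_left_mono q_le_qm assms) auto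
  finally show ?thesis using assms(2) by (simp add: integral_unique)
qed

text \<open>Two first order combinations diagonalize the free equation: this one changes only
  through \<open>q\<close>, and \<open>transport_plus\<close> treats its counterpart h - i l g.
  Their sum and difference recover \<open>h\<close> and \<open>g\<close>.\<close>

lemma transport_minus:
  assumes "0 \<le> Im l" "a \<le> x" "x \<le> N"
  shows "((\<lambda>t. of_real (q t) * g l t) has_integral ((h l N + \<i> * l * g l N) - (h l x + \<i> * l * g l x))) {x..N}"
  using exp_transport[OF e_sol[OF assms(1)], of "-l" 1 x N] rho_right assms a_pos
  by (simp add: g_def h_def algebra_simps)

lemma transport_plus:
  assumes "0 \<le> Im l" "a \<le> x" "x \<le> N"
  shows "((\<lambda>t. of_real (q t) * (exp (2 * \<i> * l * of_real t) * g l t)) has_integral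
     (exp (2 * \<i> * l * of_real N) * (h l N - \<i> * l * g l N) - exp (2 * \<i> * l * of_real x) * (h l x - \<i> * l * g l x))) {x..N}"
proof -
  have *: "exp (\<i> * l * of_real t) * (u * exp (\<i> * l * of_real t)) = exp (2 * \<i> * l * of_real t) * u" for t :: real and u
    by (simp add: algebra_simps flip: exp_add)
  have **: "exp (\<i> * l * of_real t) * (u * exp (\<i> * l * of_real t) - \<i> * l * (v * exp (\<i> * l * of_real t)))
     = exp (2 * \<i> * l * of_real t) * (u - \<i> * l * v)" for t :: real and u v
    by (simp add: algebra_simps flip: exp_add)
  show ?thesis
    using exp_transport[OF e_sol[OF assms(1)], of l 1 x N] rho_right assms a_pos
    by (simp add: e_eq_g e'_eq_h * **)
qed

context
  fixes l :: complex and B x :: real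
  assumes l: "0 \<le> Im l" and x: "a \<le> x" and B: "\<And>t. x \<le> t \<Longrightarrow> norm (g l t) \<le> B"
begin

lemma B_nonneg: "0 \<le> B"
  using B[of x] norm_ge_zero order_trans by blast

lemma transport_bound_minus: "norm (h l x + \<i> * l * g l x - 2 * \<i> * l) \<le> B * qm"
proof -
  have "((\<lambda>N. norm ((h l N + \<i> * l * g l N) - (h l x + \<i> * l * g l x))) \<longlongrightarrow>
      norm ((\<i> * l + \<i> * l * 1) - (h l x + \<i> * l * g l x))) at_top"
    by (intro tendsto_intros g_lim h_lim l)
  moreover have "\<forall>\<^sub>F N in at_top. norm ((h l N + \<i> * l * g l N) - (h l x + \<i> * l * g l x)) \<le> B * qm"
    using eventually_ge_at_top[of x]
    by eventually_elim
       (use norm_integral_q_le[OF _ transport_minus[OF l x]] B B_nonneg x a_pos in \<open>fastforce simp: abs_of_nonneg\<close>)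
  ultimately have "norm ((\<i> * l + \<i> * l * 1) - (h l x + \<i> * l * g l x)) \<le> B * qm"
    by (rule tendsto_upperbound) simp
  then show ?thesis by (subst norm_minus_commute) (simp add: algebra_simps)
qed

lemma norm_exp2: "norm (exp (2 * \<i> * l * complex_of_real t)) = exp (- (2 * Im l * t))"
  by simp

text \<open>For real \<open>l\<close> the exponential does not decay; the limit is 0 because
  \<open>h\<close> and i l g have the same limit.\<close>

lemma exp2_diff_lim: "((\<lambda>N. exp (2 * \<i> * l * of_real N) * (h l N - \<i> * l * g l N)) \<longlongrightarrow> 0) at_top"
proof (rule Lim_null_comparison)
  have "((\<lambda>N. h l N - \<i> * l * g l N) \<longlongrightarrow> \<i> * l - \<i> * l * 1) at_top"
    by (intro tendsto_intros g_lim h_lim l)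
  then show "((\<lambda>N. norm (h l N - \<i> * l * g l N)) \<longlongrightarrow> 0) at_top" by (simp add: tendsto_norm_zero)
  show "\<forall>\<^sub>F N in at_top. norm (exp (2 * \<i> * l * of_real N) * (h l N - \<i> * l * g l N)) \<le> norm (h l N - \<i> * l * g l N)"
    using eventually_ge_at_top[of "0::real"]
  proof eventually_elim
    case (elim N)
    have "norm (exp (2 * \<i> * l * of_real N)) \<le> 1" using l elim by simp
    from mult_right_mono[OF this norm_ge_zero] show ?case by (simp only: norm_mult mult_1_left)
  qed
qed

text \<open>On [x, infinity) the factor exp (2 i l t) has its largest modulus at t = x, so it
  divides out of the bound.\<close>

lemma transport_bound_plus: "norm (h l x - \<i> * l * g l x) \<le> B * qm"
proof -
  let ?V = "\<lambda>N. exp (2 * \<i> * l * of_real N) * (h l N - \<i> * l * g l N)"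
  have "((\<lambda>N. norm (?V N - ?V x)) \<longlongrightarrow> norm (0 - ?V x)) at_top"
    by (intro tendsto_intros exp2_diff_lim)
  moreover have "\<forall>\<^sub>F N in at_top. norm (?V N - ?V x) \<le> (exp (- (2 * Im l * x)) * B) * qm"
    using eventually_ge_at_top[of x]
  proof eventually_elim
    case (elim N)
    have "norm (?V N - ?V x) \<le> \<bar>exp (- (2 * Im l * x)) * B\<bar> * qm"
    proof (rule norm_integral_q_le[OF _ transport_plus[OF l x elim]])
      fix t assume t: "t \<in> {x..N}"
      have "exp (- (2 * Im l * t)) \<le> exp (- (2 * Im l * x))" using t l by (simp add: mult_left_mono)
      then show "norm (exp (2 * \<i> * l * complex_of_real t) * g l t) \<le> exp (- (2 * Im l * x)) * B"
        unfolding norm_mult norm_exp2 using B[of t] t by (intro mult_mono) auto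
    qed (use x a_pos in auto)
    then show ?case using B_nonneg by (simp add: abs_mult)
  qed
  ultimately have "norm (0 - ?V x) \<le> (exp (- (2 * Im l * x)) * B) * qm"
    by (rule tendsto_upperbound) simp
  then have "exp (- (2 * Im l * x)) * norm (h l x - \<i> * l * g l x) \<le> exp (- (2 * Im l * x)) * (B * qm)"
    by (simp add: norm_mult mult.assoc)
  then show ?thesis by simp
qed

text \<open>Eliminating \<open>h\<close> from the two identities leaves the factor 1 - exp (2 i l (t
  - x)), of size at most 2 |l| (1 + t). The |l| cancels against the 2 i l in front of 1 - g, so the
  estimate does not degenerate as \<open>l\<close> tends to 0; the price is the first moment of
  \<open>q\<close>.\<close>

lemma transport_bound_tail:
  assumes "l \<noteq> 0" and \<epsilon>: "\<And>N. integral {x..N} (\<lambda>t. (1 + t) * \<bar>q t\<bar>) \<le> \<epsilon>"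
  shows "norm (g l x - 1) \<le> B * \<epsilon>"
proof -
  let ?V = "\<lambda>N. exp (2 * \<i> * l * of_real N) * (h l N - \<i> * l * g l N)"
  let ?U = "\<lambda>N. h l N + \<i> * l * g l N"
  let ?c = "exp (- (2 * \<i> * l * of_real x))"
  define D where "D = (\<lambda>N. (?U N - ?U x) - ?c * (?V N - ?V x))"
  have "((\<lambda>N. norm (D N)) \<longlongrightarrow> norm ((\<i> * l + \<i> * l * 1 - ?U x) - ?c * (0 - ?V x))) at_top"
    unfolding D_def by (intro tendsto_intros g_lim h_lim l exp2_diff_lim)
  moreover have "?c * ?V x = h l x - \<i> * l * g l x"
    by (simp add: mult.assoc[symmetric] flip: exp_add)
  moreover have "(\<i> * l + \<i> * l * 1 - u) - k * (0 - v) = (2 * \<i> * l - u) + k * v" for u k v :: complex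
    by (simp add: algebra_simps)
  ultimately have "((\<lambda>N. norm (D N)) \<longlongrightarrow> norm ((2 * \<i> * l - ?U x) + (h l x - \<i> * l * g l x))) at_top"
    by (simp only:)
  then have lim: "((\<lambda>N. norm (D N)) \<longlongrightarrow> norm (2 * \<i> * l * (1 - g l x))) at_top"
    by (simp add: algebra_simps)
  have "\<forall>\<^sub>F N in at_top. norm (D N) \<le> 2 * norm l * B * \<epsilon>"
    using eventually_ge_at_top[of x]
  proof eventually_elim
    case (elim N)
    have I: "((\<lambda>t. of_real (q t) * g l t - ?c * (of_real (q t) * (exp (2 * \<i> * l * of_real t) * g l t))) has_integral D N) {x..N}"
      unfolding D_def by (intro has_integral_diff has_integral_mult_right transport_minus transport_plus l x elim)
    have "norm (integral {x..N} (\<lambda>t. of_real (q t) * g l t - ?c * (of_real (q t) * (exp (2 * \<i> * l * of_real t) * g l t))))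
        \<le> integral {x..N} (\<lambda>t. (2 * norm l * B) * ((1 + t) * \<bar>q t\<bar>))"
    proof (rule Henstock_Kurzweil_Integration.integral_norm_bound_integral)
      show "(\<lambda>t. (2 * norm l * B) * ((1 + t) * \<bar>q t\<bar>)) integrable_on {x..N}"
        by (intro integrable_on_mult_right q1_int_Icc) (use x a_pos in auto)
      fix t assume t: "t \<in> {x..N}"
      have "norm (exp (2 * \<i> * l * of_real (t - x)) - 1) \<le> norm (2 * \<i> * l * complex_of_real (t - x))"
        by (rule norm_exp_minus_one_le) (use l t in auto)
      also have "\<dots> = 2 * norm l * (t - x)" using t by (simp add: norm_mult del: of_real_diff)
      also have "\<dots> \<le> 2 * norm l * (1 + t)" using x a_pos by (intro mult_left_mono) auto
      finally have 1: "norm (1 - exp (2 * \<i> * l * of_real (t - x))) \<le> 2 * norm l * (1 + t)"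
        by (simp add: norm_minus_commute)
      have "of_real (q t) * g l t - ?c * (of_real (q t) * (exp (2 * \<i> * l * of_real t) * g l t))
          = of_real (q t) * (g l t * (1 - exp (2 * \<i> * l * of_real (t - x))))"
      proof -
        have "?c * exp (2 * \<i> * l * of_real t) = exp (2 * \<i> * l * of_real (t - x))"
          by (simp add: algebra_simps flip: exp_add)
        moreover have "A * G - c * (A * (E * G)) = A * (G * (1 - c * E))" for A G c E :: complex
          by (simp add: algebra_simps)
        ultimately show ?thesis by simp
      qed
      also have "norm \<dots> \<le> \<bar>q t\<bar> * (B * (2 * norm l * (1 + t)))"
        unfolding norm_mult using 1 B[of t] B_nonneg t by (intro mult_mono) auto
      finally show "norm (of_real (q t) * g l t - ?c * (of_real (q t) * (exp (2 * \<i> * l * of_real t) * g l t)))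
          \<le> (2 * norm l * B) * ((1 + t) * \<bar>q t\<bar>)" by (simp add: mult_ac)
    qed (use I in auto)
    also have "\<dots> = (2 * norm l * B) * integral {x..N} (\<lambda>t. (1 + t) * \<bar>q t\<bar>)" by simp
    also have "\<dots> \<le> (2 * norm l * B) * \<epsilon>" using B_nonneg by (intro mult_left_mono \<epsilon>) auto
    finally show ?case using I by (simp add: integral_unique)
  qed
  then have "norm (2 * \<i> * l * (1 - g l x)) \<le> 2 * norm l * B * \<epsilon>"
    by (rule tendsto_upperbound[OF lim]) simp
  then have "(2 * norm l) * norm (1 - g l x) \<le> (2 * norm l) * (B * \<epsilon>)" by (simp add: norm_mult mult.assoc)
  then show ?thesis using \<open>l \<noteq> 0\<close> by (simp add: norm_minus_commute)
qed

end

lemma g_bounded: assumes "0 \<le> Im l" obtains B where "\<And>t. 0 \<le> t \<Longrightarrow> norm (g l t) \<le> B"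
  using bounded_at_top_of_limit[OF continuous_on_g[OF assms] g_lim[OF assms]] by blast

lemma g_near_infinity:
  obtains X where "X \<ge> a" "\<And>l x. 0 \<le> Im l \<Longrightarrow> l \<noteq> 0 \<Longrightarrow> X \<le> x \<Longrightarrow> norm (g l x - 1) \<le> 1 / 3"
proof -
  \<comment> \<open>A tail of 1/4 gives sup |g| <= 1 + (1/4) sup |g|, hence |g| <= 4/3 and |g - 1|
    <= 1/3. The point \<open>X\<close> does not depend on \<open>l\<close>.\<close>
  obtain X where X: "X \<ge> a" "\<And>x N. X \<le> x \<Longrightarrow> integral {x..N} (\<lambda>t. (1 + t) * \<bar>q t\<bar>) \<le> 1/4"
    using q1_tail[of "1/4"] by auto
  show thesis
  proof (rule that[OF X(1)])
    fix l x assume l: "0 \<le> Im l" "l \<noteq> 0" and x: "X \<le> x"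
    obtain B0 where B0: "\<And>t. 0 \<le> t \<Longrightarrow> norm (g l t) \<le> B0" using g_bounded[OF l(1)] by blast
    have tail: "norm (g l t - 1) \<le> B * (1/4)" if "\<And>t. t \<in> {X..} \<Longrightarrow> norm (g l t) \<le> B" "t \<in> {X..}" for B t
      by (rule transport_bound_tail[OF l(1) _ _ l(2) X(2)]) (use that X(1) in auto)
    have b: "norm (g l t) \<le> 1 / (1 - 1/4)" if "t \<in> {X..}" for t
    proof (rule sup_bound_improve[OF _ _ _ that])
      show "norm (g l t) \<le> B0" if "t \<in> {X..}" for t using B0 that X(1) a_pos by auto
      fix B t assume "\<And>t. t \<in> {X..} \<Longrightarrow> norm (g l t) \<le> B" "t \<in> {X..}"
      from tail[OF this] norm_triangle_sub[of "g l t" 1] show "norm (g l t) \<le> 1 + 1/4 * B" by simp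
    qed simp
    show "norm (g l x - 1) \<le> 1 / 3" using tail[OF b, of x] x by simp
  qed
qed

text \<open>For large \<open>l\<close> the smallness comes from 1 / |l| instead of a tail, which
  makes the estimates valid from \<open>a\<close> on. The condition on \<open>l\<close> makes qm /
  |l| at most 1/4.\<close>

lemma gh_large:
  assumes l: "0 \<le> Im l" "4 * qm + 1 \<le> norm l" and x: "a \<le> x"
  shows "norm l * norm (g l x - 1) \<le> 4/3 * qm" "norm (h l x - \<i> * l) \<le> 4/3 * qm"
    "norm (g l x - 1) \<le> 1/3"
proof -
  obtain B0 where B0: "\<And>t. 0 \<le> t \<Longrightarrow> norm (g l t) \<le> B0" using g_bounded[OF l(1)] by blast
  have step: "norm l * norm (g l t - 1) \<le> B * qm" "norm (h l t - \<i> * l) \<le> B * qm"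
    if B: "\<And>t. t \<in> {a..} \<Longrightarrow> norm (g l t) \<le> B" and t: "t \<in> {a..}" for B t
  proof -
    have U: "norm (h l t + \<i> * l * g l t - 2 * \<i> * l) \<le> B * qm" and V: "norm (h l t - \<i> * l * g l t) \<le> B * qm"
      by (rule transport_bound_minus transport_bound_plus; use l B t in auto)+
    have "norm (2 * \<i> * l * (g l t - 1)) = norm ((h l t + \<i> * l * g l t - 2 * \<i> * l) - (h l t - \<i> * l * g l t))"
      by (simp add: algebra_simps)
    also have "\<dots> \<le> B * qm + B * qm" using U V norm_triangle_ineq4 by (meson add_mono order_trans)
    finally show "norm l * norm (g l t - 1) \<le> B * qm" by (simp add: norm_mult)
    have "norm (2 * (h l t - \<i> * l)) = norm ((h l t + \<i> * l * g l t - 2 * \<i> * l) + (h l t - \<i> * l * g l t))"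
      by (simp add: algebra_simps)
    also have "\<dots> \<le> B * qm + B * qm" using U V norm_triangle_ineq by (meson add_mono order_trans)
    finally show "norm (h l t - \<i> * l) \<le> B * qm" by (simp only: norm_mult) simp
  qed
  have nl: "norm l > 0" using l(2) qm_nonneg by linarith
  have b: "norm (g l t) \<le> 1 / (1 - 1/4)" if "t \<in> {a..}" for t
  proof (rule sup_bound_improve[OF _ _ _ that])
    show "norm (g l t) \<le> B0" if "t \<in> {a..}" for t using B0 that a_pos by auto
    fix B t assume B: "\<And>t. t \<in> {a..} \<Longrightarrow> norm (g l t) \<le> B" and t: "t \<in> {a..}"
    have B0: "0 \<le> B" using B[of a] norm_ge_zero order_trans by (metis atLeast_iff order_refl)
    have "norm l * norm (g l t - 1) \<le> B * qm" by (rule step(1)[OF B t])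
    also have "\<dots> \<le> B * (norm l * (1/4))" using l(2) B0 by (intro mult_left_mono) auto
    finally have "norm l * norm (g l t - 1) \<le> norm l * (1/4 * B)" by (simp add: mult_ac)
    then have "norm (g l t - 1) \<le> 1/4 * B" using nl by (simp only: mult_le_cancel_left_pos)
    with norm_triangle_sub[of "g l t" 1] show "norm (g l t) \<le> 1 + 1/4 * B" by simp
  qed simp
  then have b': "norm (g l t) \<le> 4/3" if "t \<in> {a..}" for t using that by simp
  show 1: "norm l * norm (g l x - 1) \<le> 4/3 * qm" and "norm (h l x - \<i> * l) \<le> 4/3 * qm"
    using step[OF b'] x by auto
  have "norm l * norm (g l x - 1) \<le> norm l * (1/3)" using 1 l(2) by simp
  then show "norm (g l x - 1) \<le> 1/3" using nl by (simp only: mult_le_cancel_left_pos)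
qed

text \<open>The exponent is \<open>mu_plus\<close> on the inner interval, see
  \<open>mu_plus_left\<close>.\<close>

definition g0 :: "complex \<Rightarrow> real \<Rightarrow> complex" where
  "g0 l x = e x l * exp (- (\<i> * l * of_real (a - \<alpha> * (a - x))))"

text \<open>Transport between \<open>x\<close> and \<open>a\<close> with k = alpha l and with k = -
  alpha l, combined so that e' at \<open>x\<close> drops out. The boundary values at
  \<open>a\<close> are controlled by \<open>gh_large\<close>.\<close>

lemma transport_inner:
  assumes l: "0 \<le> Im l" and x: "0 \<le> x" "x \<le> a"
  shows "((\<lambda>t. of_real (q t) * (g0 l t * (1 - exp (2 * \<i> * \<alpha> * l * of_real (t - x))))) has_integral
     ((h l a + \<i> * \<alpha> * l * g l a) - exp (2 * \<i> * \<alpha> * l * of_real (a - x)) * (h l a - \<i> * \<alpha> * l * g l a)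
        - 2 * \<i> * \<alpha> * l * g0 l x)) {x..a}"
proof -
  define k where "k = \<alpha> * l"
  \<comment> \<open>The factor \<open>c1\<close> turns the first exponential into that of
    \<open>g0\<close>; \<open>c2\<close> makes the two exponentials agree at \<open>x\<close>, which
    cancels e' there.\<close>
  define c1 where "c1 = exp (- (\<i> * l * of_real (a * (1 - \<alpha>))))"
  define c2 where "c2 = c1 * exp (- (2 * \<i> * k * of_real x))"
  have Z: "((\<lambda>t. c1 * (of_real (q t) * (exp (\<i> * (- k) * of_real t) * e t l))) has_integral
     c1 * (exp (\<i> * (- k) * of_real a) * (e' a l - \<i> * (- k) * e a l) - exp (\<i> * (- k) * of_real x) * (e' x l - \<i> * (- k) * e x l))) {x..a}"
    by (intro has_integral_mult_right exp_transport[OF e_sol[OF l], where \<kappa> = \<alpha>])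
       (use x rho_left in \<open>auto simp: k_def power_mult_distrib\<close>)
  have Y: "((\<lambda>t. c2 * (of_real (q t) * (exp (\<i> * k * of_real t) * e t l))) has_integral
     c2 * (exp (\<i> * k * of_real a) * (e' a l - \<i> * k * e a l) - exp (\<i> * k * of_real x) * (e' x l - \<i> * k * e x l))) {x..a}"
    by (intro has_integral_mult_right exp_transport[OF e_sol[OF l], where \<kappa> = \<alpha>])
       (use x rho_left in \<open>auto simp: k_def power_mult_distrib\<close>)
  have E1: "c1 * exp (\<i> * (- k) * of_real t) = exp (- (\<i> * l * of_real (a - \<alpha> * (a - t))))" for t
    by (simp add: c1_def k_def algebra_simps flip: exp_add)
  have E2: "c2 * exp (\<i> * k * of_real t) = exp (- (\<i> * l * of_real (a - \<alpha> * (a - t)))) * exp (2 * \<i> * \<alpha> * l * of_real (t - x))" for t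
    by (simp add: c2_def c1_def k_def algebra_simps flip: exp_add)
  have int: "c1 * (of_real (q t) * (exp (\<i> * (- k) * of_real t) * e t l)) - c2 * (of_real (q t) * (exp (\<i> * k * of_real t) * e t l))
     = of_real (q t) * (g0 l t * (1 - exp (2 * \<i> * \<alpha> * l * of_real (t - x))))" for t
  proof -
    have "c1 * (of_real (q t) * (exp (\<i> * (- k) * of_real t) * e t l)) - c2 * (of_real (q t) * (exp (\<i> * k * of_real t) * e t l))
      = of_real (q t) * e t l * (c1 * exp (\<i> * (- k) * of_real t)) - of_real (q t) * e t l * (c2 * exp (\<i> * k * of_real t))"
      by (simp only: mult_ac)
    also have "\<dots> = of_real (q t) * (g0 l t * (1 - exp (2 * \<i> * \<alpha> * l * of_real (t - x))))"
      unfolding E1 E2 g0_def by (simp only: right_diff_distrib mult_1_right mult_1_left mult_ac)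
    finally show ?thesis .
  qed
  have val: "c1 * (exp (\<i> * (- k) * of_real a) * (e' a l - \<i> * (- k) * e a l) - exp (\<i> * (- k) * of_real x) * (e' x l - \<i> * (- k) * e x l))
     - c2 * (exp (\<i> * k * of_real a) * (e' a l - \<i> * k * e a l) - exp (\<i> * k * of_real x) * (e' x l - \<i> * k * e x l))
     = (h l a + \<i> * \<alpha> * l * g l a) - exp (2 * \<i> * \<alpha> * l * of_real (a - x)) * (h l a - \<i> * \<alpha> * l * g l a) - 2 * \<i> * \<alpha> * l * g0 l x"
  proof -
    have "c1 * (exp (\<i> * (- k) * of_real a) * (e' a l - \<i> * (- k) * e a l) - exp (\<i> * (- k) * of_real x) * (e' x l - \<i> * (- k) * e x l))
     - c2 * (exp (\<i> * k * of_real a) * (e' a l - \<i> * k * e a l) - exp (\<i> * k * of_real x) * (e' x l - \<i> * k * e x l))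
     = (c1 * exp (\<i> * (- k) * of_real a)) * (e' a l + \<i> * k * e a l) - (c1 * exp (\<i> * (- k) * of_real x)) * (e' x l + \<i> * k * e x l)
      - (c2 * exp (\<i> * k * of_real a)) * (e' a l - \<i> * k * e a l) + (c2 * exp (\<i> * k * of_real x)) * (e' x l - \<i> * k * e x l)"
      by (simp add: algebra_simps)
    also have "\<dots> = (h l a + \<i> * \<alpha> * l * g l a) - exp (2 * \<i> * \<alpha> * l * of_real (a - x)) * (h l a - \<i> * \<alpha> * l * g l a) - 2 * \<i> * \<alpha> * l * g0 l x"
      unfolding E1 E2 by (simp add: g0_def g_def h_def k_def algebra_simps)
    finally show ?thesis .
  qed
  show ?thesis using has_integral_diff[OF Z Y] unfolding int val .
qed

lemma norm_g0: "norm (g0 l x) = norm (e x l) * exp (Im l * (a - \<alpha> * (a - x)))"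
  by (simp add: g0_def norm_mult)

text \<open>Replacing h by i l and l g by l at \<open>a\<close>, with errors bounded in
  \<open>l\<close>, leaves the main term i l M. It stays away from 0 because |1 - alpha| < 1 +
  alpha: the part reflected at the jump is weaker than the direct one.\<close>

lemma inner_bounds:
  assumes l: "0 \<le> Im l" "4 * qm + 1 \<le> norm l" and x: "0 \<le> x" "x \<le> a"
    and G: "\<And>t. t \<in> {0..a} \<Longrightarrow> norm (g0 l t) \<le> G"
  shows "norm l * (2 * min 1 \<alpha>) - (8/3 * qm * (1 + \<alpha>) + 2 * G * qm) \<le> 2 * \<alpha> * norm l * norm (g0 l x)"
    and "2 * \<alpha> * norm l * norm (g0 l x) \<le> 2 * (1 + \<alpha>) * norm l + (8/3 * qm * (1 + \<alpha>) + 2 * G * qm)"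
proof -
  define w where "w = exp (2 * \<i> * \<alpha> * l * of_real (a - x))"
  have nw: "norm w \<le> 1" using l x alpha_pos by (simp add: w_def)
  have G0: "0 \<le> G" using G[of a] a_pos norm_ge_zero order_trans by (metis atLeastAtMost_iff less_imp_le order_refl)
  define \<epsilon>1 where "\<epsilon>1 = (h l a - \<i> * l) + \<alpha> * (\<i> * (l * (g l a - 1)))"
  define \<epsilon>2 where "\<epsilon>2 = (h l a - \<i> * l) - \<alpha> * (\<i> * (l * (g l a - 1)))"
  have n1: "norm (\<alpha> * (\<i> * (l * (g l a - 1)))) \<le> \<alpha> * (4/3 * qm)"
    using gh_large(1)[OF l order_refl] alpha_pos by (simp add: norm_mult)
  have e12: "norm \<epsilon>1 \<le> 4/3 * qm * (1 + \<alpha>)" "norm \<epsilon>2 \<le> 4/3 * qm * (1 + \<alpha>)"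
    using norm_triangle_ineq[of "h l a - \<i> * l" "\<alpha> * (\<i> * (l * (g l a - 1)))"]
      norm_triangle_ineq4[of "h l a - \<i> * l" "\<alpha> * (\<i> * (l * (g l a - 1)))"]
      gh_large(2)[OF l order_refl] n1
    unfolding \<epsilon>1_def \<epsilon>2_def by (simp_all add: algebra_simps)
  define I where "I = (h l a + \<i> * \<alpha> * l * g l a) - w * (h l a - \<i> * \<alpha> * l * g l a) - 2 * \<i> * \<alpha> * l * g0 l x"
  have nI: "norm I \<le> \<bar>2 * G\<bar> * qm"
    unfolding I_def w_def
  proof (rule norm_integral_q_le[OF x(1) transport_inner[OF l(1) x]])
    fix t assume t: "t \<in> {x..a}"
    have "norm (1 - exp (2 * \<i> * \<alpha> * l * of_real (t - x))) \<le> 1 + norm (exp (2 * \<i> * \<alpha> * l * of_real (t - x)))"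
      by (metis norm_one norm_triangle_ineq4)
    also have "\<dots> \<le> 2" using l t alpha_pos by simp
    finally have "norm (g0 l t * (1 - exp (2 * \<i> * \<alpha> * l * of_real (t - x)))) \<le> G * 2"
      unfolding norm_mult using G[of t] t x G0 by (intro mult_mono) auto
    then show "norm (g0 l t * (1 - exp (2 * \<i> * \<alpha> * l * of_real (t - x)))) \<le> 2 * G" by simp
  qed
  \<comment> \<open>On the inner interval M / (2 alpha) is \<open>jost_e0\<close> divided by exp (i
    l mu_plus).\<close>
  define M where "M = (1 + \<alpha>) - w * (1 - \<alpha>)"
  have eq: "2 * \<i> * \<alpha> * l * g0 l x = \<i> * l * M + (\<epsilon>1 - w * \<epsilon>2 - I)"
    by (simp add: I_def \<epsilon>1_def \<epsilon>2_def M_def algebra_simps)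
  have nerr: "norm (\<epsilon>1 - w * \<epsilon>2 - I) \<le> 8/3 * qm * (1 + \<alpha>) + 2 * G * qm"
  proof -
    have "norm (w * \<epsilon>2) \<le> 1 * (4/3 * qm * (1 + \<alpha>))"
      unfolding norm_mult using nw e12 by (intro mult_mono) auto
    then have "norm (\<epsilon>1 - w * \<epsilon>2) \<le> 8/3 * qm * (1 + \<alpha>)"
      using norm_triangle_ineq4[of \<epsilon>1 "w * \<epsilon>2"] e12 by simp
    then show ?thesis using norm_triangle_ineq4[of "\<epsilon>1 - w * \<epsilon>2" I] nI G0 by simp
  qed
  have nwa: "norm (w * (1 - complex_of_real \<alpha>)) \<le> \<bar>1 - \<alpha>\<bar>"
  proof -
    have "norm (1 - complex_of_real \<alpha>) = \<bar>1 - \<alpha>\<bar>" by (metis norm_of_real of_real_1 of_real_diff)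
    then show ?thesis unfolding norm_mult using nw by (simp add: mult_left_le_one_le)
  qed
  have n1a: "norm (1 + complex_of_real \<alpha>) = 1 + \<alpha>"
    using alpha_pos by (metis abs_of_nonneg add_nonneg_nonneg less_imp_le norm_of_real of_real_1 of_real_add zero_le_one)
  have M: "2 * min 1 \<alpha> \<le> norm M" "norm M \<le> 2 * (1 + \<alpha>)"
    using norm_triangle_ineq4[of "1 + complex_of_real \<alpha>" "w * (1 - complex_of_real \<alpha>)"]
      norm_triangle_ineq2[of "1 + complex_of_real \<alpha>" "w * (1 - complex_of_real \<alpha>)"] nwa n1a alpha_pos
    unfolding M_def by (auto simp: min_def abs_if split: if_splits)
  have L: "norm (2 * \<i> * \<alpha> * l * g0 l x) = 2 * \<alpha> * norm l * norm (g0 l x)"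
    using alpha_pos by (simp add: norm_mult)
  have "norm l * (2 * min 1 \<alpha>) \<le> norm (\<i> * l * M)" "norm (\<i> * l * M) \<le> norm l * (2 * (1 + \<alpha>))"
    using M by (auto simp: norm_mult intro!: mult_left_mono)
  then show "norm l * (2 * min 1 \<alpha>) - (8/3 * qm * (1 + \<alpha>) + 2 * G * qm) \<le> 2 * \<alpha> * norm l * norm (g0 l x)"
    and "2 * \<alpha> * norm l * norm (g0 l x) \<le> 2 * (1 + \<alpha>) * norm l + (8/3 * qm * (1 + \<alpha>) + 2 * G * qm)"
    using norm_triangle_ineq[of "\<i> * l * M" "\<epsilon>1 - w * \<epsilon>2 - I"] norm_diff_ineq[of "\<i> * l * M" "\<epsilon>1 - w * \<epsilon>2 - I"] nerr
    unfolding L[symmetric] eq by (simp_all add: mult.commute)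
qed

lemma mu_plus_left: "x \<le> a \<Longrightarrow> mu_plus a \<alpha> x = a - \<alpha> * (a - x)"
  and mu_plus_right: "a \<le> x \<Longrightarrow> mu_plus a \<alpha> x = x"
  using alpha_pos by (auto simp: mu_plus_def rho_def algebra_simps)

text \<open>The lower bound matters as much as the upper one: it feeds the flux, through which phi /
  E is estimated.\<close>

lemma e_asymptotics:
  obtains R c C where "0 < R" "0 < c" "0 < C"
    "\<And>l x. 0 \<le> Im l \<Longrightarrow> R \<le> norm l \<Longrightarrow> 0 \<le> x \<Longrightarrow>
       c \<le> norm (e x l) * exp (Im l * mu_plus a \<alpha> x) \<and> norm (e x l) * exp (Im l * mu_plus a \<alpha> x) \<le> C"
proof -
  \<comment> \<open>The bound of \<open>sup_bound_improve\<close> for c = 3 (1 + alpha) / (2 alpha)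
    and theta = 1/2.\<close>
  define C0 where "C0 = 3 * (1 + \<alpha>) / \<alpha>"
  define \<mu> where "\<mu> = min 1 \<alpha>"
  define K where "K = 8/3 * qm * (1 + \<alpha>) + 2 * C0 * qm"
  \<comment> \<open>The three summands give \<open>gh_large\<close>, then 2 qm <= alpha |l| for
    theta = 1/2, then K <= mu |l|, so that the error takes at most half of the main term 2 mu
    |l|.\<close>
  define R where "R = (4 * qm + 1) + 2 * qm / \<alpha> + K / \<mu>"
  have pos: "0 < \<mu>" "0 < C0" "0 \<le> K" "0 \<le> 2 * qm / \<alpha>" "0 \<le> K / \<mu>"
    using alpha_pos qm_nonneg by (auto simp: \<mu>_def C0_def K_def intro!: add_nonneg_nonneg mult_nonneg_nonneg divide_nonneg_nonneg)
  have inner: "norm (g0 l x) \<le> C0 \<and> \<mu> / (2 * \<alpha>) \<le> norm (g0 l x)"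
    if l: "0 \<le> Im l" "R \<le> norm l" and x: "x \<in> {0..a}" for l x
  proof -
    have l4: "4 * qm + 1 \<le> norm l" and l2: "2 * qm / \<alpha> \<le> norm l" and lK: "K / \<mu> \<le> norm l"
      using l(2) pos qm_nonneg unfolding R_def by linarith+
    have nl: "0 < norm l" using l4 qm_nonneg by linarith
    have al: "0 < 2 * \<alpha> * norm l" using nl alpha_pos by simp
    have cont: "continuous_on {0..a} (g0 l)"
      unfolding g0_def[abs_def]
      by (intro continuous_intros continuous_on_subset[OF sl_sol_continuous[OF e_sol[OF l(1)]]]) auto
    have "compact (g0 l ` {0..a})" by (rule compact_continuous_image[OF cont]) auto
    then obtain B0 where B0: "\<And>t. t \<in> {0..a} \<Longrightarrow> norm (g0 l t) \<le> B0"
      using compact_imp_bounded bounded_iff by (metis imageI)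
    have up: "norm (g0 l t) \<le> (3 * (1 + \<alpha>) / (2 * \<alpha>)) / (1 - 1/2)" if "t \<in> {0..a}" for t
    proof (rule sup_bound_improve[OF B0 _ _ that])
      show "1/2 < (1::real)" by simp
      fix G t assume G: "\<And>t. t \<in> {0..a} \<Longrightarrow> norm (g0 l t) \<le> G" and t: "t \<in> {0..a}"
      have G0: "0 \<le> G" using G[OF t] norm_ge_zero order_trans by blast
      have "2 * \<alpha> * norm l * norm (g0 l t) \<le> 2 * (1 + \<alpha>) * norm l + (8/3 * qm * (1 + \<alpha>) + 2 * G * qm)"
        by (rule inner_bounds(2)[OF l(1) l4 _ _ G]) (use t in auto)
      also have "8/3 * qm * (1 + \<alpha>) \<le> norm l * (1 + \<alpha>)"
        using l4 qm_nonneg alpha_pos by (intro mult_right_mono) auto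
      also have "2 * G * qm \<le> G * (\<alpha> * norm l)"
      proof -
        have "2 * qm \<le> \<alpha> * norm l" using l2 alpha_pos by (simp add: field_simps)
        from mult_left_mono[OF this G0] show ?thesis by simp
      qed
      also have "2 * (1 + \<alpha>) * norm l + (norm l * (1 + \<alpha>) + G * (\<alpha> * norm l)) = 3 * (1 + \<alpha>) * norm l + \<alpha> * norm l * G"
        by (simp add: algebra_simps)
      also have "\<dots> = (2 * \<alpha> * norm l) * (3 * (1 + \<alpha>) / (2 * \<alpha>) + 1/2 * G)"
        using alpha_pos by (simp add: field_simps)
      finally have "(2 * \<alpha> * norm l) * norm (g0 l t) \<le> (2 * \<alpha> * norm l) * (3 * (1 + \<alpha>) / (2 * \<alpha>) + 1/2 * G)" by simp
      then show "norm (g0 l t) \<le> 3 * (1 + \<alpha>) / (2 * \<alpha>) + 1/2 * G"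
        using al by (simp only: mult_le_cancel_left_pos)
    qed
    then have up': "norm (g0 l t) \<le> C0" if "t \<in> {0..a}" for t
    proof -
      have "(3 * (1 + \<alpha>) / (2 * \<alpha>)) / (1 - 1/2) = C0" using alpha_pos by (simp add: C0_def divide_simps)
      then show ?thesis using up[OF that] by simp
    qed
    have "norm l * (2 * \<mu>) - K \<le> 2 * \<alpha> * norm l * norm (g0 l x)"
      unfolding \<mu>_def K_def by (rule inner_bounds(1)[OF l(1) l4 _ _ up']) (use x in auto)
    moreover have "K \<le> norm l * \<mu>" using lK pos by (simp add: field_simps)
    ultimately have "(2 * \<alpha> * norm l) * (\<mu> / (2 * \<alpha>)) \<le> (2 * \<alpha> * norm l) * norm (g0 l x)"
      using alpha_pos by (simp add: field_simps)
    then have "\<mu> / (2 * \<alpha>) \<le> norm (g0 l x)" using al by (simp only: mult_le_cancel_left_pos)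
    with up'[OF x] show ?thesis by simp
  qed
  have outer: "2/3 \<le> norm (g l x) \<and> norm (g l x) \<le> 4/3" if "0 \<le> Im l" "R \<le> norm l" "a \<le> x" for l x
  proof -
    have "4 * qm + 1 \<le> norm l" using that(2) pos unfolding R_def by linarith
    from gh_large(3)[OF that(1) this that(3)] norm_triangle_ineq2[of 1 "1 - g l x"] norm_triangle_sub[of "g l x" 1]
    show ?thesis by (simp add: norm_minus_commute)
  qed
  have ng: "norm (g l x) = norm (e x l) * exp (Im l * x)" for l x by (simp add: g_def norm_mult)
  show thesis
  proof (rule that[of R "min (2/3) (\<mu> / (2 * \<alpha>))" "max (4/3) C0"])
    show "0 < R" using pos qm_nonneg unfolding R_def by linarith
    show "0 < min (2/3) (\<mu> / (2 * \<alpha>))" using pos alpha_pos by simp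
    fix l x assume l: "0 \<le> Im l" "R \<le> norm l" and x: "(0::real) \<le> x"
    show "min (2/3) (\<mu> / (2 * \<alpha>)) \<le> norm (e x l) * exp (Im l * mu_plus a \<alpha> x) \<and> norm (e x l) * exp (Im l * mu_plus a \<alpha> x) \<le> max (4/3) C0"
    proof (cases "x \<le> a")
      case True
      then show ?thesis using inner[OF l, of x] x by (auto simp: norm_g0 mu_plus_left)
    next
      case False
      then show ?thesis using outer[OF l, of x] by (auto simp: ng mu_plus_right)
    qed
  qed simp
qed

end

subsection \<open>The energy flux\<close>

context sl_problem begin

lemma rho_bounds: "min 1 (\<alpha>\<^sup>2) \<le> \<rho> x" "\<rho> x \<le> max 1 (\<alpha>\<^sup>2)"
  by (auto simp: rho_def)

lemma rho_sq_integrable: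
  assumes "continuous_on {0..} (y :: real \<Rightarrow> complex)" "0 \<le> c"
  shows "(\<lambda>t. \<rho> t * (norm (y t))\<^sup>2) integrable_on {c..d}"
proof -
  have "(\<lambda>t. of_real (\<rho> t) * (y t * cnj (y t))) integrable_on {c..d}"
    by (intro loc_abs_int_mult(2)[OF loc_abs_int_rho] continuous_intros assms)
  from integrable_linear[OF this bounded_linear_Re]
  show ?thesis by (simp add: o_def flip: complex_norm_square of_real_power)
qed

text \<open>Lagrange's identity for \<open>y\<close> and its conjugate. As \<open>q\<close> is real,
  only the imaginary part of l^2 contributes.\<close>

lemma flux_interval:
  assumes y: "sl_sol (wt l) y y'" and cd: "0 \<le> c" "c \<le> d"
  shows "Im (y' c * cnj (y c)) = Im (y' d * cnj (y d)) + 2 * Re l * Im l * integral {c..d} (\<lambda>t. \<rho> t * (norm (y t))\<^sup>2)"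
proof -
  have "Im ((cnj (wt l t) - wt l t) * y t * cnj (y t)) = (4 * Re l * Im l) * (\<rho> t * (norm (y t))\<^sup>2)" for t
  proof -
    have "cnj (wt l t) - wt l t = \<i> * of_real (4 * Re l * Im l * \<rho> t)"
      by (simp add: wt_def complex_eq_iff power2_eq_square)
    then have "(cnj (wt l t) - wt l t) * y t * cnj (y t) = \<i> * of_real (4 * Re l * Im l * \<rho> t) * of_real ((norm (y t))\<^sup>2)"
      by (simp only: mult.assoc complex_norm_square)
    then show ?thesis by simp
  qed
  then have "((\<lambda>t. (4 * Re l * Im l) * (\<rho> t * (norm (y t))\<^sup>2)) has_integral
      Im (wronskian y y' (\<lambda>t. cnj (y t)) (\<lambda>t. cnj (y' t)) d - wronskian y y' (\<lambda>t. cnj (y t)) (\<lambda>t. cnj (y' t)) c)) {c..d}"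
    using has_integral_linear[OF sl_sol_wronskian[OF y sl_sol_cnj[OF y] cd] bounded_linear_Im] by (simp add: o_def)
  from integral_unique[OF this] have "(4 * Re l * Im l) * integral {c..d} (\<lambda>t. \<rho> t * (norm (y t))\<^sup>2)
     = Im (wronskian y y' (\<lambda>t. cnj (y t)) (\<lambda>t. cnj (y' t)) d - wronskian y y' (\<lambda>t. cnj (y t)) (\<lambda>t. cnj (y' t)) c)"
    by (simp only: integral_mult_right)
  moreover have "Im (wronskian y y' (\<lambda>t. cnj (y t)) (\<lambda>t. cnj (y' t)) x) = - 2 * Im (y' x * cnj (y x))" for x
    by (simp add: wronskian_def algebra_simps)
  ultimately show ?thesis by simp
qed

end

lemma exp_has_integral:
  fixes c :: real assumes "c > 0" "x \<le> N"
  shows "((\<lambda>t. exp (- (c * t))) has_integral (exp (- (c * x)) - exp (- (c * N))) / c) {x..N}"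
proof -
  have "((\<lambda>t. exp (- (c * t))) has_integral (- exp (- (c * N)) / c - - exp (- (c * x)) / c)) {x..N}"
  proof (rule fundamental_theorem_of_calculus[OF assms(2)])
    fix t assume "t \<in> {x..N}"
    have "((\<lambda>t. - exp (- (c * t)) / c) has_real_derivative exp (- (c * t))) (at t within {x..N})"
      using assms by (auto intro!: derivative_eq_intros)
    then show "((\<lambda>t. - exp (- (c * t)) / c) has_vector_derivative exp (- (c * t))) (at t within {x..N})"
      by (simp add: has_real_derivative_iff_has_vector_derivative)
  qed
  then show ?thesis by (simp add: diff_divide_distrib)
qed

lemma exp_decay_lim: "c > 0 \<Longrightarrow> ((\<lambda>N::real. exp (- (c * N))) \<longlongrightarrow> 0) at_top"
  by (rule filterlim_compose[OF exp_at_bot]) (simp add: filterlim_uminus_at_bot filterlim_tendsto_pos_mult_at_top[OF tendsto_const _ filterlim_ident])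

lemma exp_set_integrable: assumes "c > 0" shows "set_integrable lebesgue {0..} (\<lambda>x::real. exp (- (c * x)))"
proof -
  have "(\<lambda>x. exp (- c * x)) integrable_on {0..}" by (rule integrable_on_exp_minus_to_infinity[OF assms])
  then have "(\<lambda>x. exp (- (c * x))) absolutely_integrable_on {0..}"
    by (intro nonnegative_absolutely_integrable_1) auto
  then show ?thesis .
qed

context jost_problem begin

text \<open>For Im l > 0 the flux at infinity is 0, so the flux at \<open>x\<close> is 2 Re l Im l
  times the energy beyond \<open>x\<close>.\<close>

lemma flux_limit:
  assumes l: "0 < Im l" and x: "0 \<le> x"
  shows "((\<lambda>N. 2 * Re l * Im l * integral {x..N} (\<lambda>t. \<rho> t * (norm (e t l))\<^sup>2)) \<longlongrightarrow> Im (e' x l * cnj (e x l))) at_top"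
proof -
  have l': "0 \<le> Im l" using l by simp
  have "((\<lambda>N. Im (h l N * cnj (g l N)) * exp (- (2 * Im l * N))) \<longlongrightarrow> Im ((\<i> * l) * cnj 1) * 0) at_top"
    by (intro tendsto_intros h_lim g_lim l' exp_decay_lim) (use l in auto)
  moreover have "Im (e' N l * cnj (e N l)) = Im (h l N * cnj (g l N)) * exp (- (2 * Im l * N))" for N
  proof -
    have E: "exp (\<i> * l * of_real N) * cnj (exp (\<i> * l * of_real N)) = of_real (exp (- (2 * Im l * N)))"
      by (simp flip: complex_norm_square of_real_power exp_of_nat_mult)
    then have "e' N l * cnj (e N l) = h l N * cnj (g l N) * of_real (exp (- (2 * Im l * N)))"
      by (simp only: e_eq_g e'_eq_h E[symmetric]) (simp only: complex_cnj_mult mult_ac)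
    then show ?thesis by simp
  qed
  ultimately have "((\<lambda>N. Im (e' N l * cnj (e N l))) \<longlongrightarrow> 0) at_top" by simp
  then have "((\<lambda>N. Im (e' x l * cnj (e x l)) - Im (e' N l * cnj (e N l))) \<longlongrightarrow> Im (e' x l * cnj (e x l)) - 0) at_top"
    by (intro tendsto_intros)
  moreover have "\<forall>\<^sub>F N in at_top. Im (e' x l * cnj (e x l)) - Im (e' N l * cnj (e N l))
      = 2 * Re l * Im l * integral {x..N} (\<lambda>t. \<rho> t * (norm (e t l))\<^sup>2)"
    using eventually_ge_at_top[of x]
  proof eventually_elim
    case (elim N)
    show ?case using flux_interval[OF e_sol[OF l'] x elim] by linarith
  qed
  ultimately show ?thesis by (auto intro: Lim_transform_eventually)
qed

text \<open>Integrating the exponential produces 1 / (2 Im l beta), which cancels the Im l of the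
  flux formula. The bound therefore does not degenerate as Im l tends to 0 and loses only |Re
  l|.\<close>

lemma flux_lower:
  assumes l: "0 < Im l" and x: "0 \<le> x" "x \<le> x0" and \<kappa>: "0 \<le> \<kappa>" and \<beta>: "0 < \<beta>"
    and low: "\<And>t. x0 \<le> t \<Longrightarrow> \<kappa> * exp (- (2 * Im l * \<beta> * t)) \<le> \<rho> t * (norm (e t l))\<^sup>2"
  shows "\<bar>Re l\<bar> * \<kappa> / \<beta> * exp (- (2 * Im l * \<beta> * x0)) \<le> \<bar>Im (e' x l * cnj (e x l))\<bar>"
proof -
  define c where "c = 2 * Im l * \<beta>"
  have c: "c > 0" using l \<beta> by (simp add: c_def)
  have cont: "continuous_on {0..} (\<lambda>x. e x l)" using sl_sol_continuous[OF e_sol] l by simp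
  have "((\<lambda>N. \<bar>Re l\<bar> * \<kappa> / \<beta> * (exp (- (c * x0)) - exp (- (c * N)))) \<longlongrightarrow> \<bar>Re l\<bar> * \<kappa> / \<beta> * (exp (- (c * x0)) - 0)) at_top"
    by (intro tendsto_intros exp_decay_lim c)
  moreover have "((\<lambda>N. \<bar>2 * Re l * Im l * integral {x..N} (\<lambda>t. \<rho> t * (norm (e t l))\<^sup>2)\<bar>) \<longlongrightarrow> \<bar>Im (e' x l * cnj (e x l))\<bar>) at_top"
    by (rule tendsto_rabs[OF flux_limit[OF l x(1)]])
  moreover have "\<forall>\<^sub>F N in at_top. \<bar>Re l\<bar> * \<kappa> / \<beta> * (exp (- (c * x0)) - exp (- (c * N)))
      \<le> \<bar>2 * Re l * Im l * integral {x..N} (\<lambda>t. \<rho> t * (norm (e t l))\<^sup>2)\<bar>"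
    using eventually_ge_at_top[of x0]
  proof eventually_elim
    case (elim N)
    have nn: "0 \<le> \<rho> t * (norm (e t l))\<^sup>2" for t using rho_pos[of t] by simp
    have I: "((\<lambda>t. \<kappa> * exp (- (c * t))) has_integral \<kappa> * ((exp (- (c * x0)) - exp (- (c * N))) / c)) {x0..N}"
      by (intro has_integral_mult_right exp_has_integral c elim)
    have "\<kappa> * ((exp (- (c * x0)) - exp (- (c * N))) / c) = integral {x0..N} (\<lambda>t. \<kappa> * exp (- (c * t)))"
      using integral_unique[OF I] by (rule sym)
    also have "\<dots> \<le> integral {x0..N} (\<lambda>t. \<rho> t * (norm (e t l))\<^sup>2)"
    proof (rule Henstock_Kurzweil_Integration.integral_le)
      show "(\<lambda>t. \<kappa> * exp (- (c * t))) integrable_on {x0..N}" using I by blast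
      show "(\<lambda>t. \<rho> t * (norm (e t l))\<^sup>2) integrable_on {x0..N}"
        using x by (intro rho_sq_integrable cont) auto
    qed (use low in \<open>auto simp: c_def\<close>)
    also have "\<dots> \<le> integral {x..N} (\<lambda>t. \<rho> t * (norm (e t l))\<^sup>2)"
      using x by (intro integral_subset_le rho_sq_integrable cont) (auto simp: nn)
    finally have *: "\<kappa> * ((exp (- (c * x0)) - exp (- (c * N))) / c) \<le> integral {x..N} (\<lambda>t. \<rho> t * (norm (e t l))\<^sup>2)" .
    have "\<bar>Re l\<bar> * \<kappa> / \<beta> * (exp (- (c * x0)) - exp (- (c * N)))
        = (2 * \<bar>Re l\<bar> * Im l) * (\<kappa> * ((exp (- (c * x0)) - exp (- (c * N))) / c))"
      using l \<beta> by (simp add: c_def field_simps)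
    also have "\<dots> \<le> (2 * \<bar>Re l\<bar> * Im l) * integral {x..N} (\<lambda>t. \<rho> t * (norm (e t l))\<^sup>2)"
      using l by (intro mult_left_mono *) auto
    also have "\<dots> \<le> \<bar>2 * Re l * Im l * integral {x..N} (\<lambda>t. \<rho> t * (norm (e t l))\<^sup>2)\<bar>"
    proof -
      have "0 \<le> integral {x..N} (\<lambda>t. \<rho> t * (norm (e t l))\<^sup>2)"
        by (intro Henstock_Kurzweil_Integration.integral_nonneg rho_sq_integrable cont x) (auto simp: nn)
      then show ?thesis unfolding abs_mult using l by simp
    qed
    finally show ?case .
  qed
  ultimately have "\<bar>Re l\<bar> * \<kappa> / \<beta> * (exp (- (c * x0)) - 0) \<le> \<bar>Im (e' x l * cnj (e x l))\<bar>"
    by (intro tendsto_le[OF trivial_limit_at_top_linorder])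
  then show ?thesis by (simp add: c_def)
qed

lemma flux_sign:
  assumes l: "0 < Im l" and x: "0 \<le> x"
  shows "0 \<le> Re l * Im (e' x l * cnj (e x l))"
proof (rule tendsto_lowerbound[OF tendsto_mult[OF tendsto_const flux_limit[OF l x]]])
  have cont: "continuous_on {0..} (\<lambda>x. e x l)" using sl_sol_continuous[OF e_sol] l by simp
  have "0 \<le> Re l * (2 * Re l * Im l * integral {x..N} (\<lambda>t. \<rho> t * (norm (e t l))\<^sup>2))" for N
  proof -
    have "0 \<le> \<rho> t * (norm (e t l))\<^sup>2" for t using rho_pos[of t] by simp
    then have "0 \<le> integral {x..N} (\<lambda>t. \<rho> t * (norm (e t l))\<^sup>2)"
      by (intro Henstock_Kurzweil_Integration.integral_nonneg rho_sq_integrable cont x) auto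
    then have "0 \<le> (Re l * Re l) * (2 * Im l * integral {x..N} (\<lambda>t. \<rho> t * (norm (e t l))\<^sup>2))"
      using l by simp
    then show ?thesis by (simp only: mult_ac)
  qed
  then show "\<forall>\<^sub>F N in at_top. 0 \<le> Re l * (2 * Re l * Im l * integral {x..N} (\<lambda>t. \<rho> t * (norm (e t l))\<^sup>2))"
    by (rule always_eventually[OF allI])
qed simp

text \<open>Beyond \<open>X\<close> one has |g| >= 2/3, hence the 4/9. The exponent is not sharp for
  large \<open>l\<close>, but it is harmless for |l| <= 1, and positivity is enough in
  \<open>flux_nonzero\<close>.\<close>

lemma flux_lower_all:
  assumes x: "0 \<le> x"
  obtains X where "x \<le> X" "\<And>l. 0 < Im l \<Longrightarrow> \<bar>Re l\<bar> * (4 / 9) * exp (- (2 * Im l * X)) \<le> \<bar>Im (e' x l * cnj (e x l))\<bar>"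
proof -
  obtain X0 where X0: "X0 \<ge> a" "\<And>l x. 0 \<le> Im l \<Longrightarrow> l \<noteq> 0 \<Longrightarrow> X0 \<le> x \<Longrightarrow> norm (g l x - 1) \<le> 1 / 3"
    using g_near_infinity by blast
  define X where "X = max x X0"
  have "\<bar>Re l\<bar> * (4 / 9) * exp (- (2 * Im l * X)) \<le> \<bar>Im (e' x l * cnj (e x l))\<bar>" if l: "0 < Im l" for l
  proof -
    have "\<bar>Re l\<bar> * (4 / 9) / 1 * exp (- (2 * Im l * 1 * X)) \<le> \<bar>Im (e' x l * cnj (e x l))\<bar>"
    proof (rule flux_lower[OF l x])
      show "x \<le> X" by (simp add: X_def)
      fix t assume t: "X \<le> t"
      have "norm (g l t - 1) \<le> 1/3" using X0(2)[of l t] l t by (cases "l = 0") (auto simp: X_def)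
      then have "2/3 \<le> norm (g l t)" using norm_triangle_ineq2[of 1 "1 - g l t"] by (simp add: norm_minus_commute)
      then have "(2/3)\<^sup>2 \<le> (norm (g l t))\<^sup>2" by (intro power_mono) auto
      then have "4/9 * exp (- (2 * Im l * t)) \<le> (norm (g l t))\<^sup>2 * exp (- (2 * Im l * t))"
        by (intro mult_right_mono) (auto simp: power2_eq_square)
      also have "\<dots> = (norm (e t l))\<^sup>2"
        by (simp add: e_eq_g norm_mult power_mult_distrib flip: exp_of_nat_mult)
      also have "\<dots> = \<rho> t * (norm (e t l))\<^sup>2" using t X0(1) by (auto simp: rho_def X_def)
      finally show "4/9 * exp (- (2 * Im l * 1 * t)) \<le> \<rho> t * (norm (e t l))\<^sup>2" by simp
    qed auto
    then show ?thesis by simp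
  qed
  then show thesis by (intro that[of X]) (auto simp: X_def)
qed

lemma flux_nonzero:
  assumes "0 < Im l" "Re l \<noteq> 0" "0 \<le> x"
  shows "Im (e' x l * cnj (e x l)) \<noteq> 0"
proof -
  obtain X where "\<bar>Re l\<bar> * (4 / 9) * exp (- (2 * Im l * X)) \<le> \<bar>Im (e' x l * cnj (e x l))\<bar>"
    using flux_lower_all[OF assms(3)] assms(1) by blast
  moreover have "0 < \<bar>Re l\<bar> * (4 / 9) * exp (- (2 * Im l * X))" using assms(2) by simp
  ultimately show ?thesis by linarith
qed

lemma mu_plus_growth:
  assumes "x \<le> t" shows "mu_plus a \<alpha> t \<le> mu_plus a \<alpha> x + max 1 \<alpha> * (t - x)"
proof -
  have m1: "mu_plus a \<alpha> t \<le> mu_plus a \<alpha> x + max 1 \<alpha> * (t - x)" if "x \<le> t" "t \<le> a" for x t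
  proof -
    have "\<alpha> * (t - x) \<le> max 1 \<alpha> * (t - x)" using that by (intro mult_right_mono) auto
    then show ?thesis using that by (simp add: mu_plus_left algebra_simps)
  qed
  have m2: "mu_plus a \<alpha> t \<le> mu_plus a \<alpha> x + max 1 \<alpha> * (t - x)" if "x \<le> t" "a \<le> x" for x t
  proof -
    have "1 * (t - x) \<le> max 1 \<alpha> * (t - x)" using that by (intro mult_right_mono) auto
    then show ?thesis using that by (simp add: mu_plus_right)
  qed
  consider "t \<le> a" | "a \<le> x" | "x \<le> a" "a \<le> t" by linarith
  then show ?thesis
  proof cases
    case 3
    have "max 1 \<alpha> * (a - x) + max 1 \<alpha> * (t - a) = max 1 \<alpha> * (t - x)" by (simp add: algebra_simps)
    then show ?thesis using m1[of x a] m2[of a t] 3 by linarith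
  qed (use m1 m2 assms in auto)
qed

text \<open>The flux has to be bounded below with the sharp exponential exp (- 2 Im l mu_plus), so
  that it matches the square of the bound for \<open>e\<close>.\<close>

lemma flux_large:
  obtains R C where "0 < R" "0 < C"
    "\<And>l x. 0 < Im l \<Longrightarrow> R \<le> norm l \<Longrightarrow> 0 \<le> x \<Longrightarrow>
        \<bar>Re l\<bar> * exp (- (2 * Im l * mu_plus a \<alpha> x)) \<le> C * \<bar>Im (e' x l * cnj (e x l))\<bar>"
    "\<And>l x. 0 \<le> Im l \<Longrightarrow> R \<le> norm l \<Longrightarrow> 0 \<le> x \<Longrightarrow> norm (e x l) \<le> C * exp (- (Im l * mu_plus a \<alpha> x))"
proof -
  obtain R c C where R: "0 < R" "0 < c" "0 < C" and as:
    "\<And>l x. 0 \<le> Im l \<Longrightarrow> R \<le> norm l \<Longrightarrow> 0 \<le> x \<Longrightarrow>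
       c \<le> norm (e x l) * exp (Im l * mu_plus a \<alpha> x) \<and> norm (e x l) * exp (Im l * mu_plus a \<alpha> x) \<le> C"
    using e_asymptotics by blast
  define \<beta> where "\<beta> = max 1 \<alpha>"
  define r where "r = min 1 (\<alpha>\<^sup>2)"
  have \<beta>: "0 < \<beta>" and r: "0 < r" using alpha_pos by (auto simp: \<beta>_def r_def)
  define C1 where "C1 = max C (\<beta> / (r * c\<^sup>2))"
  show thesis
  proof (rule that[of R C1])
    show "0 < C1" using R by (simp add: C1_def)
    fix l x assume l: "0 < Im l" "R \<le> norm l" and x: "(0::real) \<le> x"
    let ?m = "mu_plus a \<alpha>"
    \<comment> \<open>Chosen so that kappa exp (- 2 Im l beta t) is the lower bound of the integrand
      that follows from mu_plus t <= mu_plus x + beta (t - x).\<close>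
    define \<kappa> where "\<kappa> = r * c\<^sup>2 * exp (- (2 * Im l * ?m x) + 2 * Im l * \<beta> * x)"
    have "\<bar>Re l\<bar> * \<kappa> / \<beta> * exp (- (2 * Im l * \<beta> * x)) \<le> \<bar>Im (e' x l * cnj (e x l))\<bar>"
    proof (rule flux_lower[OF l(1) x order_refl _ \<beta>])
      show "0 \<le> \<kappa>" using r by (simp add: \<kappa>_def)
      fix t assume t: "x \<le> t"
      have "c \<le> norm (e t l) * exp (Im l * ?m t)" using as[of l t] l x t by auto
      then have "c\<^sup>2 \<le> (norm (e t l) * exp (Im l * ?m t))\<^sup>2" using R by (intro power_mono) auto
      also have "\<dots> = (norm (e t l))\<^sup>2 * exp (2 * Im l * ?m t)"
        by (simp add: power_mult_distrib mult.assoc flip: exp_of_nat_mult)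
      finally have 1: "c\<^sup>2 * exp (- (2 * Im l * ?m t)) \<le> (norm (e t l))\<^sup>2"
        by (simp add: exp_minus field_simps)
      have "2 * Im l * ?m t \<le> 2 * Im l * (?m x + \<beta> * (t - x))"
        using mu_plus_growth[OF t] l by (intro mult_left_mono) (auto simp: \<beta>_def)
      then have "- (2 * Im l * ?m x) + 2 * Im l * \<beta> * x - 2 * Im l * \<beta> * t \<le> - (2 * Im l * ?m t)"
        by (simp add: algebra_simps)
      then have "exp (- (2 * Im l * ?m x) + 2 * Im l * \<beta> * x - 2 * Im l * \<beta> * t) \<le> exp (- (2 * Im l * ?m t))"
        by (simp only: exp_le_cancel_iff)
      then have "r * (c\<^sup>2 * exp (- (2 * Im l * ?m x) + 2 * Im l * \<beta> * x - 2 * Im l * \<beta> * t)) \<le> r * (norm (e t l))\<^sup>2"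
        using r 1 by (intro mult_left_mono) (auto intro: order.trans[OF mult_left_mono 1])
      also have "\<dots> \<le> \<rho> t * (norm (e t l))\<^sup>2"
        using rho_bounds(1)[of t] by (intro mult_right_mono) (auto simp: r_def)
      finally show "\<kappa> * exp (- (2 * Im l * \<beta> * t)) \<le> \<rho> t * (norm (e t l))\<^sup>2"
        by (simp add: \<kappa>_def exp_diff exp_minus divide_inverse mult_ac)
    qed
    moreover have "\<kappa> * exp (- (2 * Im l * \<beta> * x)) = r * c\<^sup>2 * exp (- (2 * Im l * ?m x))"
      by (simp add: \<kappa>_def mult.assoc flip: exp_add)
    moreover have "\<bar>Re l\<bar> * \<kappa> / \<beta> * Z = \<bar>Re l\<bar> / \<beta> * (\<kappa> * Z)" for Z by simp
    ultimately have "\<bar>Re l\<bar> / \<beta> * (r * c\<^sup>2 * exp (- (2 * Im l * ?m x))) \<le> \<bar>Im (e' x l * cnj (e x l))\<bar>"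
      by (simp only:)
    then have "\<bar>Re l\<bar> * (r * c\<^sup>2 / \<beta>) * exp (- (2 * Im l * ?m x)) \<le> \<bar>Im (e' x l * cnj (e x l))\<bar>"
      by simp
    then have "(\<beta> / (r * c\<^sup>2)) * (\<bar>Re l\<bar> * (r * c\<^sup>2 / \<beta>) * exp (- (2 * Im l * ?m x))) \<le> (\<beta> / (r * c\<^sup>2)) * \<bar>Im (e' x l * cnj (e x l))\<bar>"
      using \<beta> r R by (intro mult_left_mono) auto
    also have "\<dots> \<le> C1 * \<bar>Im (e' x l * cnj (e x l))\<bar>"
      by (intro mult_right_mono) (auto simp: C1_def)
    finally show "\<bar>Re l\<bar> * exp (- (2 * Im l * ?m x)) \<le> C1 * \<bar>Im (e' x l * cnj (e x l))\<bar>"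
      using \<beta> r R by (simp add: field_simps)
  next
    fix l x assume l: "0 \<le> Im l" "R \<le> norm l" and x: "(0::real) \<le> x"
    have "norm (e x l) * exp (Im l * mu_plus a \<alpha> x) \<le> C1" using as[OF l x] by (auto simp: C1_def)
    then show "norm (e x l) \<le> C1 * exp (- (Im l * mu_plus a \<alpha> x))" by (simp add: exp_minus field_simps)
  qed (use R in auto)
qed

text \<open>Continuity up to l = 0 comes from the kernel representation; the uniform estimate of
  \<open>g\<close> excludes that point.\<close>

lemma e_bounded_near_zero:
  assumes "0 \<le> x" obtains C where "\<And>l. 0 \<le> Im l \<Longrightarrow> norm l \<le> 1 \<Longrightarrow> norm (e x l) \<le> C"
proof -
  have "compact ({l. 0 \<le> Im l} \<inter> cball 0 1)"
    by (intro closed_Int_compact closed_halfspace_Im_ge compact_cball)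
  then have "compact (e x ` ({l. 0 \<le> Im l} \<inter> cball 0 1))"
    by (intro compact_continuous_image continuous_on_subset[OF e_continuous[OF assms]]) auto
  then obtain C where "\<And>y. y \<in> e x ` ({l. 0 \<le> Im l} \<inter> cball 0 1) \<Longrightarrow> norm y \<le> C"
    using compact_imp_bounded bounded_iff by metis
  then show thesis using that[of C] by auto
qed

text \<open>Supplies the dominating function for \<open>J_continuous\<close>. The radius keeps Im l
  >= kappa / 2 on the disc; beyond \<open>X\<close> the bound on \<open>g\<close> is uniform in
  \<open>l\<close>, and [0, X] is covered by the fundamental solutions.\<close>

lemma e_local_decay:
  assumes \<kappa>: "0 < \<kappa>"
  obtains M where "0 \<le> M" "\<And>l x. norm (l - \<i> * of_real \<kappa>) \<le> \<kappa> / 2 \<Longrightarrow> 0 \<le> x \<Longrightarrow> norm (e x l) \<le> M * exp (- (\<kappa> / 2 * x))"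
proof -
  define D where "D = cball (\<i> * of_real \<kappa>) (\<kappa> / 2)"
  have Dim: "\<kappa> / 2 \<le> Im l" "l \<noteq> 0" "norm l \<le> 2 * \<kappa>" if "l \<in> D" for l
  proof -
    have d: "norm (l - \<i> * of_real \<kappa>) \<le> \<kappa> / 2" using that by (simp add: D_def dist_norm norm_minus_commute)
    show 1: "\<kappa> / 2 \<le> Im l" using abs_Im_le_cmod[of "l - \<i> * of_real \<kappa>"] d by auto
    then show "l \<noteq> 0" using \<kappa> by auto
    show "norm l \<le> 2 * \<kappa>" using norm_triangle_sub[of l "\<i> * of_real \<kappa>"] d \<kappa> by (simp add: norm_mult)
  qed
  have Dsub: "D \<subseteq> {l. 0 \<le> Im l}" using Dim(1) \<kappa> by force
  have bd: "\<exists>B. \<forall>l\<in>D. norm (f l) \<le> B" if "continuous_on {l. 0 \<le> Im l} f" for f :: "complex \<Rightarrow> complex"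
  proof -
    have "compact (f ` D)"
      by (intro compact_continuous_image continuous_on_subset[OF that Dsub]) (simp add: D_def)
    then show ?thesis using compact_imp_bounded bounded_iff by (metis imageI)
  qed
  obtain B1 where B1: "\<And>l. l \<in> D \<Longrightarrow> norm (e 0 l) \<le> B1" using bd[OF e_continuous[of 0]] by auto
  obtain B2 where B2: "\<And>l. l \<in> D \<Longrightarrow> norm (e' 0 l) \<le> B2" using bd[OF e'0_continuous] by auto
  obtain X where X: "X \<ge> a" "\<And>l x. 0 \<le> Im l \<Longrightarrow> l \<noteq> 0 \<Longrightarrow> X \<le> x \<Longrightarrow> norm (g l x - 1) \<le> 1 / 3"
    using g_near_infinity by blast
  obtain B3 where B3: "\<And>l x. norm l \<le> 2 * \<kappa> \<Longrightarrow> x \<in> {0..X} \<Longrightarrow> norm (cos_sol l x) \<le> B3 \<and> norm (sin_sol l x) \<le> B3"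
    using cos_sin_sol_bounded[of "2 * \<kappa>" X] by blast
  define M where "M = max (4/3) ((B1 * B3 + B2 * B3) * exp (\<kappa> / 2 * X))"
  show thesis
  proof (rule that[of M])
    show "0 \<le> M" by (simp add: M_def)
    fix l x assume l: "norm (l - \<i> * of_real \<kappa>) \<le> \<kappa> / 2" and x: "(0::real) \<le> x"
    have lD: "l \<in> D" using l by (simp add: D_def dist_norm norm_minus_commute)
    have Il: "0 \<le> Im l" using Dim(1)[OF lD] \<kappa> by simp
    show "norm (e x l) \<le> M * exp (- (\<kappa> / 2 * x))"
    proof (cases "x \<le> X")
      case True
      have cs: "norm (cos_sol l x) \<le> B3" "norm (sin_sol l x) \<le> B3" using B3[OF Dim(3)[OF lD], of x] True x by auto
      have "norm (e x l) \<le> norm (e 0 l) * norm (cos_sol l x) + norm (e' 0 l) * norm (sin_sol l x)"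
        using e_repr[OF Il x] norm_triangle_ineq by (metis norm_mult)
      also have "\<dots> \<le> B1 * B3 + B2 * B3"
        using B1[OF lD] B2[OF lD] cs by (intro add_mono mult_mono) (auto intro: order.trans[OF norm_ge_zero])
      finally have 1: "norm (e x l) \<le> B1 * B3 + B2 * B3" .
      then have nn: "0 \<le> B1 * B3 + B2 * B3" using norm_ge_zero order_trans by blast
      have "1 \<le> exp (\<kappa> / 2 * X - \<kappa> / 2 * x)" using True \<kappa> by simp
      then have "(B1 * B3 + B2 * B3) * 1 \<le> (B1 * B3 + B2 * B3) * exp (\<kappa> / 2 * X - \<kappa> / 2 * x)"
        using nn by (intro mult_left_mono)
      also have "\<dots> = ((B1 * B3 + B2 * B3) * exp (\<kappa> / 2 * X)) * exp (- (\<kappa> / 2 * x))"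
        by (simp add: mult.assoc flip: exp_add)
      also have "\<dots> \<le> M * exp (- (\<kappa> / 2 * x))" by (intro mult_right_mono) (auto simp: M_def)
      finally show ?thesis using 1 by simp
    next
      case False
      have "norm (g l x) \<le> 4/3" using X(2)[OF Il Dim(2)[OF lD], of x] False norm_triangle_sub[of "g l x" 1] by simp
      moreover have "exp (- (Im l * x)) \<le> exp (- (\<kappa> / 2 * x))" using mult_right_mono[OF Dim(1)[OF lD] x] by simp
      ultimately have "norm (g l x) * exp (- (Im l * x)) \<le> M * exp (- (\<kappa> / 2 * x))"
        by (intro mult_mono) (auto simp: M_def)
      then show ?thesis by (simp add: e_eq_g norm_mult)
    qed
  qed
qed

end

subsection \<open>The boundary condition and the norming constants\<close>

context jost_problem begin

lemma e_cnj_sol: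
  assumes "Im l = 0" shows "sl_sol (wt l) (\<lambda>x. cnj (e x l)) (\<lambda>x. cnj (e' x l))"
proof -
  have "wt (- cnj l) = wt l" using assms by (simp add: wt_def fun_eq_iff complex_eq_iff power2_eq_square)
  then show ?thesis using sl_sol_cnj[OF e_sol[of l]] assms by (simp flip: wt_minus_cnj)
qed

lemma e_imaginary_real:
  assumes "0 \<le> \<kappa>" "0 \<le> x" shows "cnj (e x (\<i> * of_real \<kappa>)) = e x (\<i> * of_real \<kappa>)"
  using e_minus_cnj(1)[of "\<i> * of_real \<kappa>" x] assms by simp

text \<open>Bilinear, without conjugation, because it has to represent a complex difference quotient
  of \<open>E\<close>. On the imaginary axis \<open>e\<close> is real, which leads to
  \<open>J_diagonal\<close>.\<close>

definition J :: "complex \<Rightarrow> complex \<Rightarrow> complex" where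
  "J k l = (LINT t:{0..}|lebesgue. of_real (\<rho> t) * e t l * e t k)"

context
  fixes \<kappa> M :: real
  assumes \<kappa>: "0 < \<kappa>" and M: "0 \<le> M"
    and decay: "\<And>l x. norm (l - \<i> * of_real \<kappa>) \<le> \<kappa> / 2 \<Longrightarrow> 0 \<le> x \<Longrightarrow> norm (e x l) \<le> M * exp (- (\<kappa> / 2 * x))"
begin

private abbreviation k :: complex where "k \<equiv> \<i> * of_real \<kappa>"

lemma near_Im: "norm (l - k) \<le> \<kappa> / 2 \<Longrightarrow> \<kappa> / 2 \<le> Im l"
  using abs_Im_le_cmod[of "l - k"] by auto

lemma J_bound:
  assumes "norm (l - k) \<le> \<kappa> / 2" "0 \<le> t"
  shows "norm (of_real (\<rho> t) * e t l * e t k) \<le> max 1 (\<alpha>\<^sup>2) * M\<^sup>2 * exp (- (\<kappa> * t))"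
proof -
  have "norm (of_real (\<rho> t) * e t l * e t k) \<le> max 1 (\<alpha>\<^sup>2) * (M * exp (- (\<kappa> / 2 * t))) * (M * exp (- (\<kappa> / 2 * t)))"
    unfolding norm_mult
    by (intro mult_mono decay) (use assms rho_bounds(2)[of t] rho_pos[of t] M \<kappa> in auto)
  also have "\<dots> = max 1 (\<alpha>\<^sup>2) * M\<^sup>2 * (exp (- (\<kappa> / 2 * t)) * exp (- (\<kappa> / 2 * t)))"
    by (simp add: power2_eq_square mult_ac)
  also have "exp (- (\<kappa> / 2 * t)) * exp (- (\<kappa> / 2 * t)) = exp (- (\<kappa> * t))"
    by (simp flip: exp_add)
  finally show ?thesis .
qed

lemma J_measurable:
  assumes "norm (l - k) \<le> \<kappa> / 2"
  shows "(\<lambda>t. of_real (\<rho> t) * e t l * e t k) \<in> borel_measurable (lebesgue_on {0..})"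
proof (intro borel_measurable_times)
  have c: "continuous_on {0..} (\<lambda>t. e t w)" if "0 \<le> Im w" for w
    using sl_sol_continuous[OF e_sol[OF that]] .
  show "(\<lambda>t. e t l) \<in> borel_measurable (lebesgue_on {0..})"
    by (rule continuous_imp_measurable_on_sets_lebesgue[OF c]) (use near_Im[OF assms] \<kappa> in auto)
  show "(\<lambda>t. e t k) \<in> borel_measurable (lebesgue_on {0..})"
    by (rule continuous_imp_measurable_on_sets_lebesgue[OF c]) (use \<kappa> in auto)
  have "(\<lambda>t. complex_of_real (\<rho> t)) \<in> borel_measurable borel" using rho_measurable by simp
  then show "(\<lambda>t. complex_of_real (\<rho> t)) \<in> borel_measurable (lebesgue_on {0..})"
    by (intro measurable_restrict_space1 measurable_completion) simp
qed

lemma J_integrable: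
  assumes "norm (l - k) \<le> \<kappa> / 2"
  shows "set_integrable lebesgue {0..} (\<lambda>t. of_real (\<rho> t) * e t l * e t k)"
proof (rule measurable_bounded_by_integrable_imp_absolutely_integrable[OF J_measurable[OF assms]])
  show "(\<lambda>t. max 1 (\<alpha>\<^sup>2) * M\<^sup>2 * exp (- (\<kappa> * t))) integrable_on {0..}"
    using exp_set_integrable[OF \<kappa>] by (intro integrable_on_mult_right) (simp add: absolutely_integrable_on_def)
qed (use J_bound[OF assms] in auto)

text \<open>Lagrange's identity on the half line; the boundary term at infinity decays like exp (-
  (Im l + kappa) x).\<close>

lemma green_identity:
  assumes l: "norm (l - k) \<le> \<kappa> / 2"
  shows "(l\<^sup>2 - k\<^sup>2) * J k l = e' 0 l * e 0 k - e 0 l * e' 0 k"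
proof -
  have Il: "0 \<le> Im l" "0 < Im l" using near_Im[OF l] \<kappa> by auto
  have Ik: "0 \<le> Im k" using \<kappa> by simp
  define W where "W = wronskian (\<lambda>x. e x l) (\<lambda>x. e' x l) (\<lambda>x. e x k) (\<lambda>x. e' x k)"
  have I: "((\<lambda>t. (l\<^sup>2 - k\<^sup>2) * (of_real (\<rho> t) * e t l * e t k)) has_integral (W N - W 0)) {0..N}" if "0 \<le> N" for N
  proof -
    have "(wt k t - wt l t) * e t l * e t k = (l\<^sup>2 - k\<^sup>2) * (of_real (\<rho> t) * e t l * e t k)" for t
    proof -
      have "wt k t - wt l t = (l\<^sup>2 - k\<^sup>2) * of_real (\<rho> t)" by (simp only: wt_def) (simp add: left_diff_distrib)
      then show ?thesis by (simp only: mult.assoc)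
    qed
    then show ?thesis using sl_sol_wronskian[OF e_sol[OF Il(1)] e_sol[OF Ik] order_refl that] by (simp only: W_def)
  qed
  have "(W \<longlongrightarrow> (1 * (\<i> * k) - (\<i> * l) * 1) * 0) at_top"
  proof -
    have W: "W x = (g l x * h k x - h l x * g k x) * (exp (\<i> * l * of_real x) * exp (\<i> * k * of_real x))" for x
      by (simp only: W_def wronskian_def e_eq_g e'_eq_h) (simp only: left_diff_distrib right_diff_distrib mult_ac)
    have "((\<lambda>x. exp (\<i> * l * of_real x) * exp (\<i> * k * of_real x)) \<longlongrightarrow> 0) at_top"
    proof (rule Lim_null_comparison[OF _ exp_decay_lim[of "Im l + \<kappa>"]])
      show "0 < Im l + \<kappa>" using Il \<kappa> by simp
      show "\<forall>\<^sub>F x in at_top. norm (exp (\<i> * l * of_real x) * exp (\<i> * k * of_real x)) \<le> exp (- ((Im l + \<kappa>) * x))"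
        by (intro always_eventually allI) (simp add: norm_mult algebra_simps flip: exp_add)
    qed
    then show ?thesis unfolding W[abs_def] by (intro tendsto_intros g_lim h_lim Il Ik)
  qed
  then have lim1: "((\<lambda>N. W N - W 0) \<longlongrightarrow> 0 - W 0) at_top" by (intro tendsto_intros) simp
  have lim2: "((\<lambda>N. (l\<^sup>2 - k\<^sup>2) * (LINT t:{0..N}|lebesgue. of_real (\<rho> t) * e t l * e t k)) \<longlongrightarrow> (l\<^sup>2 - k\<^sup>2) * J k l) at_top"
    unfolding J_def
    by (intro tendsto_intros tendsto_set_lebesgue_integral_at_top[OF _ J_integrable[OF l]]) auto
  have ev: "\<forall>\<^sub>F N in at_top. (l\<^sup>2 - k\<^sup>2) * (LINT t:{0..N}|lebesgue. of_real (\<rho> t) * e t l * e t k) = W N - W 0"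
    using eventually_ge_at_top[of "0::real"]
  proof eventually_elim
    case (elim N)
    have "set_integrable lebesgue {0..N} (\<lambda>t. of_real (\<rho> t) * e t l * e t k)"
      by (rule set_integrable_subset[OF J_integrable[OF l]]) auto
    from set_lebesgue_integral_eq_integral(2)[OF this]
    show ?case using integral_unique[OF I[OF elim]] by simp
  qed
  have "(l\<^sup>2 - k\<^sup>2) * J k l = 0 - W 0"
    by (rule tendsto_unique[OF trivial_limit_at_top_linorder Lim_transform_eventually[OF lim2 ev] lim1])
  then show ?thesis by (simp add: W_def wronskian_def)
qed

lemma J_continuous: "((\<lambda>l. J k l) \<longlongrightarrow> J k k) (at k)"
  unfolding tendsto_at_iff_sequentially
proof (intro allI impI)
  fix x assume x: "\<forall>n. x n \<in> UNIV - {k}" "x \<longlonglongrightarrow> k"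
  have "\<forall>\<^sub>F n in sequentially. dist (x n) k < \<kappa> / 2" using x(2) \<kappa> tendstoD by (metis half_gt_zero)
  then obtain n0 where n0: "\<And>n. n \<ge> n0 \<Longrightarrow> norm (x n - k) \<le> \<kappa> / 2"
    unfolding eventually_sequentially dist_norm by (meson less_imp_le)
  define z where "z = (\<lambda>n. x (n + n0))"
  have z: "norm (z n - k) \<le> \<kappa> / 2" for n using n0[of "n + n0"] by (auto simp: z_def)
  have zl: "z \<longlonglongrightarrow> k" unfolding z_def using x(2) by (rule LIMSEQ_ignore_initial_segment)
  have "(\<lambda>n. J k (z n)) \<longlonglongrightarrow> J k k"
    unfolding J_def set_lebesgue_integral_def
  proof (rule integral_dominated_convergence)
    show "integrable lebesgue (\<lambda>t. indicator {0..} t *\<^sub>R (max 1 (\<alpha>\<^sup>2) * M\<^sup>2 * exp (- (\<kappa> * t))))"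
      using set_integrable_mult_right[of "max 1 (\<alpha>\<^sup>2) * M\<^sup>2", OF exp_set_integrable[OF \<kappa>]]
      by (simp add: set_integrable_def)
    show "AE t in lebesgue. norm (indicator {0..} t *\<^sub>R (of_real (\<rho> t) * e t (z n) * e t k))
          \<le> indicator {0..} t *\<^sub>R (max 1 (\<alpha>\<^sup>2) * M\<^sup>2 * exp (- (\<kappa> * t)))" for n
      by (rule AE_I2) (use J_bound[OF z] in \<open>auto simp: indicator_def\<close>)
    show "AE t in lebesgue. (\<lambda>n. indicator {0..} t *\<^sub>R (of_real (\<rho> t) * e t (z n) * e t k))
         \<longlonglongrightarrow> indicator {0..} t *\<^sub>R (of_real (\<rho> t) * e t k * e t k)"
    proof (rule AE_I2)
      fix t
      show "(\<lambda>n. indicator {0..} t *\<^sub>R (of_real (\<rho> t) * e t (z n) * e t k))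
         \<longlonglongrightarrow> indicator {0..} t *\<^sub>R (of_real (\<rho> t) * e t k * e t k)"
      proof (cases "0 \<le> t")
        case True
        have "isCont (e t) k"
          using holomorphic_on_imp_continuous_on[OF e_holomorphic[OF True]] \<kappa>
          by (auto simp: continuous_on_eq_continuous_at open_halfspace_Im_gt)
        then have "(\<lambda>n. e t (z n)) \<longlonglongrightarrow> e t k" using zl isCont_tendsto_compose by blast
        then show ?thesis by (intro tendsto_intros)
      qed auto
    qed
    have kk: "norm (k - k) \<le> \<kappa> / 2" using \<kappa> by simp
    show "(\<lambda>t. indicator {0..} t *\<^sub>R (of_real (\<rho> t) * e t k * e t k)) \<in> borel_measurable lebesgue"
      using J_integrable[OF kk] unfolding set_integrable_def by (rule borel_measurable_integrable)
    show "(\<lambda>t. indicator {0..} t *\<^sub>R (of_real (\<rho> t) * e t (z n) * e t k)) \<in> borel_measurable lebesgue" for n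
      using J_integrable[OF z] unfolding set_integrable_def by (rule borel_measurable_integrable)
  qed
  then show "((\<lambda>l. J k l) \<circ> x) \<longlonglongrightarrow> J k k"
    unfolding z_def o_def by (rule LIMSEQ_offset)
qed

end

lemma J_diagonal:
  assumes "0 < \<kappa>"
  shows "J (\<i> * of_real \<kappa>) (\<i> * of_real \<kappa>) = of_real (LINT x:{0..}|lebesgue. (norm (e x (\<i> * of_real \<kappa>)))\<^sup>2 * \<rho> x)"
proof -
  have "indicator {0..} t *\<^sub>R (of_real (\<rho> t) * e t (\<i> * of_real \<kappa>) * e t (\<i> * of_real \<kappa>))
      = complex_of_real (indicator {0..} t *\<^sub>R ((norm (e t (\<i> * of_real \<kappa>)))\<^sup>2 * \<rho> t))" for t :: real
  proof (cases "0 \<le> t")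
    case True
    have "e t (\<i> * of_real \<kappa>) * e t (\<i> * of_real \<kappa>) = of_real ((norm (e t (\<i> * of_real \<kappa>)))\<^sup>2)"
      using e_imaginary_real[of \<kappa> t] assms True by (simp add: complex_norm_square del: of_real_power)
    then show ?thesis using True by (simp add: mult_ac)
  qed auto
  then show ?thesis by (simp add: J_def set_lebesgue_integral_def del: of_real_mult)
qed

end

text \<open>At a common zero of the two polynomials both \<open>E\<close> and \<open>phi\<close>
  vanish whatever the potential is, which breaks the link between zeros and eigenfunctions. By
  \<open>bc_poly_common_zero\<close> the sign conditions exclude such points other than 0 unless all
  delta vanish.\<close>

locale bc_problem = jost_problem +
  fixes \<alpha>s \<beta>s :: "nat \<Rightarrow> real"
  assumes delta: "delta1 \<alpha>s \<beta>s \<le> 0" "delta2 \<alpha>s \<beta>s \<le> 0" "delta3 \<alpha>s \<beta>s \<ge> 0"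
    and no_common_zero: "\<And>l. 0 \<le> Im l \<Longrightarrow> l \<noteq> 0 \<Longrightarrow> bc_poly \<alpha>s l \<noteq> 0 \<or> bc_poly \<beta>s l \<noteq> 0"
begin

abbreviation A :: "complex \<Rightarrow> complex" where "A \<equiv> bc_poly \<alpha>s"
abbreviation B :: "complex \<Rightarrow> complex" where "B \<equiv> bc_poly \<beta>s"
abbreviation E :: "complex \<Rightarrow> complex" where "E \<equiv> E_fun \<alpha>s \<beta>s e"

definition phi :: "complex \<Rightarrow> real \<Rightarrow> complex" where "phi l x = B l * cos_sol l x + (- A l) * sin_sol l x"
definition phi' :: "complex \<Rightarrow> real \<Rightarrow> complex" where "phi' l x = B l * cos_deriv l x + (- A l) * sin_deriv l x"

lemma E_eq: "E l = B l * e' 0 l + A l * e 0 l"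
  by (simp add: E_fun_def deriv0_eq)

lemma phi_sol: "sl_sol (wt l) (phi l) (phi' l)"
  using sl_sol_cmult_add[OF cos_sin_sol(1,2)] by (simp only: phi_def[abs_def] phi'_def[abs_def])

lemma phi_zero: "phi l 0 = B l" "phi' l 0 = - A l"
  by (simp_all add: phi_def phi'_def cos_sin_sol)

lemma bc_poly_holomorphic: "bc_poly c holomorphic_on S"
  unfolding bc_poly_def[abs_def] by (intro holomorphic_intros)

lemma phi_holomorphic: "0 \<le> x \<Longrightarrow> (\<lambda>l. phi l x) holomorphic_on S"
  unfolding phi_def by (intro holomorphic_intros bc_poly_holomorphic cos_sin_sol_holomorphic)

lemma E_holomorphic: "E holomorphic_on {l. 0 < Im l}"
  unfolding E_eq[abs_def] by (intro holomorphic_intros bc_poly_holomorphic e'0_holomorphic e_holomorphic) simp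

lemma bc_poly_continuous: "continuous_on S (bc_poly c)"
  unfolding bc_poly_def[abs_def] by (intro continuous_intros)

lemma E_continuous: "continuous_on {l. 0 \<le> Im l} E"
  unfolding E_eq[abs_def] by (intro continuous_intros bc_poly_continuous e'0_continuous e_continuous) simp

lemma phi_wronskian: "0 \<le> Im l \<Longrightarrow> 0 \<le> x \<Longrightarrow> phi l x * e' x l - phi' l x * e x l = E l"
  using sl_sol_wronskian_const[OF phi_sol e_sol, of l x] by (simp add: wronskian_def phi_zero E_eq)

text \<open>The flux of \<open>phi\<close> at 0 is - Im (A cnj B). The sign conditions make each
  summand of the bracket nonnegative.\<close>

lemma bc_flux:
  assumes "0 \<le> Im l" shows "0 \<le> Re l * Im (A l * cnj (B l))"
proof -
  have "Im (A l * cnj (B l)) = Re l * (- delta1 \<alpha>s \<beta>s - 2 * delta2 \<alpha>s \<beta>s * Im l + delta3 \<alpha>s \<beta>s * ((Re l)\<^sup>2 + (Im l)\<^sup>2))"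
    by (simp add: bc_poly_def delta1_def delta2_def delta3_def power2_eq_square algebra_simps)
  then have "Re l * Im (A l * cnj (B l)) = (Re l)\<^sup>2 * (- delta1 \<alpha>s \<beta>s + 2 * (- delta2 \<alpha>s \<beta>s) * Im l + delta3 \<alpha>s \<beta>s * ((Re l)\<^sup>2 + (Im l)\<^sup>2))"
    by (simp add: power2_eq_square mult.assoc)
  also have "0 \<le> \<dots>"
    using delta assms by (intro mult_nonneg_nonneg add_nonneg_nonneg) auto
  finally show ?thesis .
qed

lemma phi_flux:
  assumes l: "0 \<le> Im l" and x: "0 \<le> x"
  shows "Re l * Im (phi' l x * cnj (phi l x)) \<le> 0"
proof -
  let ?I = "integral {0..x} (\<lambda>t. \<rho> t * (norm (phi l t))\<^sup>2)"
  have "Im (phi' l x * cnj (phi l x)) = - Im (A l * cnj (B l)) - 2 * Re l * Im l * ?I"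
    using flux_interval[OF phi_sol order_refl x, of l] by (simp add: phi_zero)
  then have "Re l * Im (phi' l x * cnj (phi l x)) = - (Re l * Im (A l * cnj (B l))) - (Re l)\<^sup>2 * (2 * Im l * ?I)"
    by (simp only:) (simp add: power2_eq_square algebra_simps)
  moreover have "0 \<le> ?I"
    by (intro Henstock_Kurzweil_Integration.integral_nonneg rho_sq_integrable sl_sol_continuous[OF phi_sol])
       (auto intro: mult_nonneg_nonneg less_imp_le[OF rho_pos])
  then have "0 \<le> (Re l)\<^sup>2 * (2 * Im l * ?I)" using l by simp
  ultimately show ?thesis using bc_flux[OF l] by linarith
qed

text \<open>Multiplying the Wronskian by the conjugate of phi e and taking imaginary parts gives
  |phi|^2 times the flux of \<open>e\<close> minus |e|^2 times the flux of \<open>phi\<close>.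
  Nothing cancels in this difference, so its second term may be dropped.\<close>

lemma phi_bound:
  assumes l: "0 < Im l" "Re l \<noteq> 0" and x: "0 \<le> x"
  shows "norm (phi l x) * \<bar>Im (e' x l * cnj (e x l))\<bar> \<le> norm (E l) * norm (e x l)"
proof (cases "phi l x = 0")
  case False
  let ?p = "phi l x" and ?p' = "phi' l x" and ?e = "e x l" and ?e' = "e' x l"
  define Ie where "Ie = Im (?e' * cnj ?e)"
  define Ip where "Ip = Im (?p' * cnj ?p)"
  have signs: "0 \<le> Re l * Ie" "Re l * Ip \<le> 0"
    using flux_sign[OF l(1) x] phi_flux[of l x] l x by (auto simp: Ie_def Ip_def)
  have "(?p * ?e' - ?p' * ?e) * (cnj ?p * cnj ?e) = (?p * cnj ?p) * (?e' * cnj ?e) - (?e * cnj ?e) * (?p' * cnj ?p)"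
    by (simp add: algebra_simps)
  also have "\<dots> = of_real ((norm ?p)\<^sup>2) * (?e' * cnj ?e) - of_real ((norm ?e)\<^sup>2) * (?p' * cnj ?p)"
    by (simp only: complex_norm_square)
  finally have "Im (E l * (cnj ?p * cnj ?e)) = (norm ?p)\<^sup>2 * Ie - (norm ?e)\<^sup>2 * Ip"
    using phi_wronskian[of l x] l x by (simp add: Ie_def Ip_def)
  then have "Re l * Im (E l * (cnj ?p * cnj ?e)) = (norm ?p)\<^sup>2 * (Re l * Ie) + (norm ?e)\<^sup>2 * (- (Re l * Ip))"
    by (simp only:) (simp add: algebra_simps)
  then have "(norm ?p)\<^sup>2 * (Re l * Ie) \<le> Re l * Im (E l * (cnj ?p * cnj ?e))"
    using signs by (simp add: mult_nonneg_nonpos)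
  also have "\<dots> \<le> \<bar>Re l\<bar> * norm (E l * (cnj ?p * cnj ?e))"
  proof -
    have "Re l * x \<le> \<bar>Re l\<bar> * y" if "\<bar>x\<bar> \<le> y" for x y
      using abs_ge_self[of "Re l * x"] mult_left_mono[OF that, of "\<bar>Re l\<bar>"] by (simp add: abs_mult)
    then show ?thesis using abs_Im_le_cmod by blast
  qed
  also have "\<dots> = \<bar>Re l\<bar> * (norm ?p * (norm (E l) * norm ?e))" by (simp add: norm_mult mult_ac)
  finally have "(norm ?p)\<^sup>2 * \<bar>Re l * Ie\<bar> \<le> \<bar>Re l\<bar> * (norm ?p * (norm (E l) * norm ?e))"
    using signs(1) by simp
  moreover have "(norm ?p)\<^sup>2 * \<bar>Re l * Ie\<bar> = (\<bar>Re l\<bar> * norm ?p) * (norm ?p * \<bar>Ie\<bar>)"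
    by (simp add: abs_mult power2_eq_square mult_ac)
  ultimately have "(\<bar>Re l\<bar> * norm ?p) * (norm ?p * \<bar>Ie\<bar>) \<le> (\<bar>Re l\<bar> * norm ?p) * (norm (E l) * norm ?e)"
    by (simp only: mult.assoc)
  moreover have "0 < \<bar>Re l\<bar> * norm ?p" using l False by simp
  ultimately show ?thesis unfolding Ie_def by (simp only: mult_le_cancel_left_pos)
qed simp

text \<open>At x = 0, where phi = B, the bound forces B = 0 if E = 0. Then A e = 0 as well, against
  the nonzero flux of \<open>e\<close> or the absence of common zeros.\<close>

lemma E_nonzero_off_axis:
  assumes l: "0 < Im l" "Re l \<noteq> 0" shows "E l \<noteq> 0"
proof
  assume E0: "E l = 0"
  have I: "Im (e' 0 l * cnj (e 0 l)) \<noteq> 0" by (rule flux_nonzero[OF l order_refl])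
  have "norm (phi l 0) * \<bar>Im (e' 0 l * cnj (e 0 l))\<bar> \<le> 0"
    using phi_bound[OF l order_refl] E0 by simp
  then have B0: "B l = 0" using I
    by (simp add: mult_le_0_iff phi_zero)
  have "l \<noteq> 0" using l(1) by force
  then have "A l \<noteq> 0" using no_common_zero[of l] l B0 by auto
  then have "e 0 l = 0" using E0 B0 by (simp add: E_eq)
  then show False using I by simp
qed

text \<open>The flux formulas at infinity need Im l > 0. On the real line the flux of
  \<open>e\<close> is Re l, by the Wronskian with the conjugate, and the same comparison of signs
  applies.\<close>

lemma E_nonzero_real:
  assumes l: "Im l = 0" "l \<noteq> 0" shows "E l \<noteq> 0"
proof
  assume E0: "E l = 0"
  have I: "Im (e' 0 l * cnj (e 0 l)) = Re l"
    using arg_cong[OF e_wronskian_real[OF l(1) order_refl], of Im] by (simp add: algebra_simps)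
  have R: "Re l \<noteq> 0" using l by (auto simp: complex_eq_iff)
  have "B l * e' 0 l = - (A l * e 0 l)" using E0 by (simp add: E_eq eq_neg_iff_add_eq_0)
  then have "(B l * e' 0 l) * (cnj (B l) * cnj (e 0 l)) = - (A l * e 0 l) * (cnj (B l) * cnj (e 0 l))" by simp
  then have "(B l * cnj (B l)) * (e' 0 l * cnj (e 0 l)) = - ((A l * cnj (B l)) * (e 0 l * cnj (e 0 l)))"
    by (simp only: mult_ac mult_minus_left mult_minus_right)
  then have "of_real ((norm (B l))\<^sup>2) * (e' 0 l * cnj (e 0 l)) = - ((A l * cnj (B l)) * of_real ((norm (e 0 l))\<^sup>2))"
    by (simp only: complex_norm_square)
  from arg_cong[OF this, of Im] have "(norm (B l))\<^sup>2 * Re l = - (Im (A l * cnj (B l)) * (norm (e 0 l))\<^sup>2)"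
    using I by simp
  then have "Re l * ((norm (B l))\<^sup>2 * Re l) = - (Re l * Im (A l * cnj (B l))) * (norm (e 0 l))\<^sup>2" by simp
  also have "\<dots> \<le> 0" using bc_flux[of l] l by (simp add: mult_nonneg_nonneg)
  finally have "(norm (B l) * Re l)\<^sup>2 \<le> 0" by (simp add: power2_eq_square mult_ac)
  then have B0: "B l = 0" using R by simp
  then have "A l \<noteq> 0" using no_common_zero[of l] l by auto
  then have "e 0 l = 0" using E0 B0 by (simp add: E_eq)
  then show False using I R by simp
qed

text \<open>The expansion of \<open>phi\<close> in \<open>e\<close> and its conjugate; the
  coefficients are Wronskians, evaluated at 0.\<close>

lemma phi_real:
  assumes l: "Im l = 0" and x: "0 \<le> x"
  shows "2 * \<i> * l * phi l x = cnj (e x l) * E l - e x l * (B l * cnj (e' 0 l) + A l * cnj (e 0 l))"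
proof -
  have w1: "phi l x * e' x l - phi' l x * e x l = E l" using phi_wronskian l x by simp
  have w2: "phi l x * cnj (e' x l) - phi' l x * cnj (e x l) = B l * cnj (e' 0 l) + A l * cnj (e 0 l)"
    using sl_sol_wronskian_const[OF phi_sol e_cnj_sol[OF l] x] by (simp add: wronskian_def phi_zero)
  have w3: "e x l * cnj (e' x l) - e' x l * cnj (e x l) = - 2 * \<i> * l" by (rule e_wronskian_real[OF l x])
  have "cnj (e x l) * E l - e x l * (B l * cnj (e' 0 l) + A l * cnj (e 0 l))
      = - (e x l * cnj (e' x l) - e' x l * cnj (e x l)) * phi l x"
    unfolding w1[symmetric] w2[symmetric] by (simp add: algebra_simps)
  then show ?thesis unfolding w3 by simp
qed

lemma bc_poly_deriv: "(bc_poly c has_field_derivative (\<i> * of_real (c 1) + 2 * of_real (c 2) * l)) (at l)"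
  unfolding bc_poly_def[abs_def] by (auto intro!: derivative_eq_intros)

text \<open>The difference quotient of \<open>E\<close> at the zero is split: varying the
  polynomials gives the boundary term of the norming value, and varying \<open>e\<close> with the
  polynomials frozen gives the integral, by Green's identity. The factor \<open>c\<close> is the
  ratio of \<open>phi\<close> to \<open>e\<close>.\<close>

lemma norming_deriv:
  assumes \<kappa>: "0 < \<kappa>" and E0: "E (\<i> * of_real \<kappa>) = 0"
    and den: "norming_den \<beta>s \<kappa> = 0 \<longrightarrow> norming_num \<alpha>s \<beta>s \<kappa> = 0"
  obtains c where "c \<noteq> 0" "\<And>x. 0 \<le> x \<Longrightarrow> phi (\<i> * of_real \<kappa>) x = c * e x (\<i> * of_real \<kappa>)"
    "deriv E (\<i> * of_real \<kappa>) = c * (2 * \<i> * of_real \<kappa> * of_real (norming_value a \<alpha> \<alpha>s \<beta>s e \<kappa>))"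
proof -
  define k where "k = \<i> * complex_of_real \<kappa>"
  have k: "0 \<le> Im k" "0 < Im k" "k \<noteq> 0" using \<kappa> by (auto simp: k_def)
  have eq: "B k * e' 0 k = - (A k * e 0 k)" using E0 by (simp add: E_eq k_def eq_neg_iff_add_eq_0)
  have nz: "e 0 k \<noteq> 0 \<or> e' 0 k \<noteq> 0"
  proof (rule ccontr)
    assume "\<not> ?thesis"
    then have "e x k = 0" if "x \<ge> 0" for x using sl_sol_zero_unique(1)[OF e_sol[OF k(1)]] that by auto
    then have "g k x = 0" if "x \<ge> 0" for x using that by (simp add: g_def)
    then have "(g k \<longlongrightarrow> 0) at_top"
      by (intro tendsto_eventually eventually_mono[OF eventually_ge_at_top[of "0::real"]])
    then show False using g_lim[OF k(1)] tendsto_unique trivial_limit_at_top_linorder zero_neq_one by metis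
  qed
  \<comment> \<open>E = 0 says that \<open>phi\<close> and \<open>e\<close> have proportional
    initial values; either component of \<open>e\<close> may vanish.\<close>
  define c where "c = (if e 0 k \<noteq> 0 then B k / e 0 k else - A k / e' 0 k)"
  have c: "B k = c * e 0 k + 0 * e 0 k" "- A k = c * e' 0 k + 0 * e' 0 k"
    using eq nz by (auto simp: c_def field_simps)
  have c0: "c \<noteq> 0" using no_common_zero[OF k(1,3)] c by auto
  have phi_c: "phi k x = c * e x k" if "0 \<le> x" for x
    using sl_sol_unique(1)[OF phi_sol sl_sol_cmult_add[OF e_sol[OF k(1)] e_sol[OF k(1)], of c 0] _ _ that] c
    by (simp add: phi_zero)
  obtain M where M: "0 \<le> M" "\<And>l x. norm (l - k) \<le> \<kappa> / 2 \<Longrightarrow> 0 \<le> x \<Longrightarrow> norm (e x l) \<le> M * exp (- (\<kappa> / 2 * x))"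
    using e_local_decay[OF \<kappa>] unfolding k_def by blast
  have green: "(l\<^sup>2 - k\<^sup>2) * J k l = e' 0 l * e 0 k - e 0 l * e' 0 k" if "norm (l - k) \<le> \<kappa> / 2" for l
    using green_identity[OF \<kappa> M[unfolded k_def]] that unfolding k_def by blast
  have Jc: "((\<lambda>l. J k l) \<longlongrightarrow> J k k) (at k)"
    using J_continuous[OF \<kappa> M[unfolded k_def]] unfolding k_def by blast
  define D where "D = deriv E k"
  define A' where "A' = \<i> * of_real (\<alpha>s 1) + 2 * of_real (\<alpha>s 2) * k"
  define B' where "B' = \<i> * of_real (\<beta>s 1) + 2 * of_real (\<beta>s 2) * k"
  have quot: "((\<lambda>l. (E l - E k) / (l - k)) \<longlongrightarrow> D) (at k)"
    "((\<lambda>l. (A l - A k) / (l - k)) \<longlongrightarrow> A') (at k)" "((\<lambda>l. (B l - B k) / (l - k)) \<longlongrightarrow> B') (at k)"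
    using holomorphic_derivI[OF E_holomorphic open_halfspace_Im_gt, of k] bc_poly_deriv[of \<alpha>s k] bc_poly_deriv[of \<beta>s k] k
    by (auto simp: has_field_derivative_iff D_def A'_def B'_def)
  have ec: "(e 0 \<longlongrightarrow> e 0 k) (at k)" "(e' 0 \<longlongrightarrow> e' 0 k) (at k)"
    using holomorphic_on_imp_continuous_on[OF e_holomorphic[of 0]] holomorphic_on_imp_continuous_on[OF e'0_holomorphic] k
    by (auto simp: continuous_on_eq_continuous_at open_halfspace_Im_gt isCont_def)
  have lim1: "((\<lambda>l. (E l - E k) / (l - k) - (B l - B k) / (l - k) * e' 0 l - (A l - A k) / (l - k) * e 0 l)
      \<longlongrightarrow> D - B' * e' 0 k - A' * e 0 k) (at k)"
    by (intro tendsto_intros quot ec)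
  have lim2: "((\<lambda>l. c * (l + k) * J k l) \<longlongrightarrow> c * (k + k) * J k k) (at k)"
    by (intro tendsto_intros Jc)
  have ev: "\<forall>\<^sub>F l in at k. (E l - E k) / (l - k) - (B l - B k) / (l - k) * e' 0 l - (A l - A k) / (l - k) * e 0 l
      = c * (l + k) * J k l"
    unfolding eventually_at
  proof (intro exI[of _ "\<kappa> / 2"] conjI ballI impI)
    fix l assume l: "l \<noteq> k \<and> dist l k < \<kappa> / 2"
    have "(E l - E k) - (B l - B k) * e' 0 l - (A l - A k) * e 0 l = B k * e' 0 l + A k * e 0 l"
      using E0 by (simp add: E_eq k_def algebra_simps)
    also have "\<dots> = c * (e' 0 l * e 0 k - e 0 l * e' 0 k)"
    proof -
      have "- A k = c * e' 0 k" "B k = c * e 0 k" using c by simp_all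
      moreover have "A k = - (- A k)" by simp
      ultimately have "A k = - (c * e' 0 k)" "B k = c * e 0 k" by simp_all
      then show ?thesis by (simp add: algebra_simps)
    qed
    also have "e' 0 l * e 0 k - e 0 l * e' 0 k = (l\<^sup>2 - k\<^sup>2) * J k l"
      using green[of l] l by (simp add: dist_norm less_imp_le)
    also have "l\<^sup>2 - k\<^sup>2 = (l - k) * (l + k)" by (simp add: power2_eq_square algebra_simps)
    finally have *: "(E l - E k) - (B l - B k) * e' 0 l - (A l - A k) * e 0 l = (l - k) * (c * (l + k) * J k l)"
      by (simp add: mult_ac)
    have "(E l - E k) / (l - k) - (B l - B k) / (l - k) * e' 0 l - (A l - A k) / (l - k) * e 0 l
       = ((E l - E k) - (B l - B k) * e' 0 l - (A l - A k) * e 0 l) / (l - k)"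
    proof -
      have "x / d - y / d * u - z / d * v = (x - y * u - z * v) / d" for x y z u v d :: complex
        by (simp add: diff_divide_distrib)
      then show ?thesis .
    qed
    then show "(E l - E k) / (l - k) - (B l - B k) / (l - k) * e' 0 l - (A l - A k) / (l - k) * e 0 l = c * (l + k) * J k l"
      using l by (simp add: *)
  qed (use \<kappa> in auto)
  have main: "D - B' * e' 0 k - A' * e 0 k = c * (k + k) * J k k"
    by (rule tendsto_unique[OF trivial_limit_at Lim_transform_eventually[OF lim1 ev] lim2])
  \<comment> \<open>The contribution of the varying polynomials, once c e and c e' at 0 are replaced
    by B and - A.\<close>
  have num: "A' * B k - B' * A k = - \<i> * of_real (norming_num \<alpha>s \<beta>s \<kappa>)"
    by (simp add: A'_def B'_def bc_poly_def norming_num_def delta1_def delta2_def delta3_def k_def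
        power2_eq_square algebra_simps complex_eq_iff)
  have Bk: "B k = of_real (norming_den \<beta>s \<kappa>)"
    by (simp add: bc_poly_def norming_den_def k_def power2_eq_square complex_eq_iff)
  define I where "I = (LINT x:{0..}|lebesgue. (norm (e x k))\<^sup>2 * \<rho> x)"
  have Jk: "J k k = of_real I" using J_diagonal[OF \<kappa>] by (simp add: k_def I_def)
  have cD: "c * D = 2 * k * c\<^sup>2 * of_real I - \<i> * of_real (norming_num \<alpha>s \<beta>s \<kappa>)"
  proof -
    have ck: "c * e' 0 k = - A k" "c * e 0 k = B k" using c by auto
    have "c * D = c * (c * (k + k) * J k k) + B' * (c * e' 0 k) + A' * (c * e 0 k)"
      unfolding main[symmetric] by (simp add: algebra_simps)
    then have "c * D = c * (c * (k + k) * J k k) + (A' * B k - B' * A k)" by (simp add: ck)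
    then show ?thesis unfolding num Jk by (simp add: power2_eq_square algebra_simps)
  qed
  have nv: "norming_value a \<alpha> \<alpha>s \<beta>s e \<kappa> = I - norming_num \<alpha>s \<beta>s \<kappa> * (norm (e 0 k))\<^sup>2 / (2 * \<kappa> * (norming_den \<beta>s \<kappa>)\<^sup>2)"
    by (simp add: norming_value_def I_def k_def)
  have fin: "\<i> * of_real (norming_num \<alpha>s \<beta>s \<kappa>)
      = 2 * k * c\<^sup>2 * of_real (norming_num \<alpha>s \<beta>s \<kappa> * (norm (e 0 k))\<^sup>2 / (2 * \<kappa> * (norming_den \<beta>s \<kappa>)\<^sup>2))"
  \<comment> \<open>If the denominator is 0, so is the numerator, and both sides are 0 since x / 0 =
    0.\<close>
  proof (cases "norming_den \<beta>s \<kappa> = 0")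
    case True
    then show ?thesis using den by simp
  next
    case False
    have "of_real ((norm (e 0 k))\<^sup>2) = e 0 k * e 0 k"
      using e_imaginary_real[of \<kappa> 0] \<kappa> by (simp add: complex_norm_square k_def del: of_real_power)
    then have "c\<^sup>2 * of_real ((norm (e 0 k))\<^sup>2) = (B k)\<^sup>2" using c(1) by (simp add: power2_eq_square mult_ac)
    also have "\<dots> = of_real ((norming_den \<beta>s \<kappa>)\<^sup>2)" by (simp add: Bk)
    finally have c2: "c\<^sup>2 * of_real ((norm (e 0 k))\<^sup>2) = of_real ((norming_den \<beta>s \<kappa>)\<^sup>2)" .
    have "2 * k * c\<^sup>2 * of_real (norming_num \<alpha>s \<beta>s \<kappa> * (norm (e 0 k))\<^sup>2 / (2 * \<kappa> * (norming_den \<beta>s \<kappa>)\<^sup>2))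
       = 2 * k * of_real (norming_num \<alpha>s \<beta>s \<kappa>) * (c\<^sup>2 * of_real ((norm (e 0 k))\<^sup>2)) / of_real (2 * \<kappa> * (norming_den \<beta>s \<kappa>)\<^sup>2)"
      by simp
    also have "\<dots> = \<i> * of_real (norming_num \<alpha>s \<beta>s \<kappa>)"
      unfolding c2 using False \<kappa> by (simp add: k_def)
    finally show ?thesis by simp
  qed
  have "c * D = c * (c * (2 * k * of_real (norming_value a \<alpha> \<alpha>s \<beta>s e \<kappa>)))"
    unfolding cD nv fin by (simp add: power2_eq_square algebra_simps)
  then have "D = c * (2 * k * of_real (norming_value a \<alpha> \<alpha>s \<beta>s e \<kappa>))" using c0 by simp
  then show thesis using that[OF c0] phi_c by (simp add: D_def k_def mult_ac)
qed

end

subsection \<open>A Liouville theorem\<close>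

text \<open>On the circle r^2 = z cnj z, so the factor equals z (z + cnj z).\<close>

lemma norm_annulus_factor:
  fixes z :: complex assumes "norm z = r" shows "norm (z\<^sup>2 + of_real (r\<^sup>2)) = 2 * r * \<bar>Re z\<bar>"
proof -
  have "z\<^sup>2 + of_real (r\<^sup>2) = z * (z + cnj z)"
    using complex_norm_square[of z] assms by (simp add: power2_eq_square algebra_simps)
  also have "\<dots> = z * of_real (2 * Re z)" by (simp add: complex_add_cnj)
  finally show ?thesis using assms by (simp add: norm_mult)
qed

text \<open>A bound of the form \<open>C / \<bar>cos \<theta>\<bar>\<close> along circles degenerates only on the imaginary axis.
  The factors \<open>z\<^sup>2 + r\<^sup>2\<close> and \<open>z\<^sup>2 + R\<^sup>2\<close> compensate this on the circles of radius \<open>r\<close> and \<open>R\<close>, so that the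
  maximum principle on the annulus \<open>\<bar>w\<bar> / 2 \<le> \<bar>z\<bar> \<le> 2 \<bar>w\<bar>\<close> bounds the function at \<open>w\<close>.\<close>

lemma annulus_bound:
  fixes F :: "complex \<Rightarrow> complex"
  assumes F: "F holomorphic_on - {0}" and w: "w \<noteq> 0"
    and b: "\<And>z. norm z = norm w / 2 \<or> norm z = 2 * norm w \<Longrightarrow> norm (F z) * \<bar>Re z\<bar> \<le> C * norm z"
  shows "norm (F w) \<le> 16 * \<bar>C\<bar>"
proof -
  define r R where "r = norm w / 2" and "R = 2 * norm w"
  have rR: "0 < r" "r < R" "norm w = 2 * r" "R = 4 * r" using w by (auto simp: r_def R_def)
  define S where "S = cball 0 R - ball (0::complex) r"
  define H where "H = (\<lambda>z. F z * (z\<^sup>2 + of_real (r\<^sup>2)) * (z\<^sup>2 + of_real (R\<^sup>2)))"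
  have S0: "0 \<notin> S" using rR by (simp add: S_def)
  have holH: "H holomorphic_on S"
    unfolding H_def using S0 by (intro holomorphic_intros holomorphic_on_subset[OF F]) auto
  have "norm (H w) \<le> (2 * \<bar>C\<bar> * R\<^sup>2) * (R\<^sup>2 + r\<^sup>2)"
  proof (rule maximum_modulus_frontier[where S = S and f = H])
    show "H holomorphic_on interior S" by (rule holomorphic_on_subset[OF holH interior_subset])
    have "closed S" unfolding S_def by (intro closed_Diff) auto
    then show "continuous_on (closure S) H" using holH holomorphic_on_imp_continuous_on by simp
    show "bounded S" unfolding S_def by (intro bounded_diff) auto
    show "w \<in> S" using rR by (auto simp: S_def)
    fix z assume "z \<in> frontier S"
    moreover have "frontier S \<subseteq> sphere 0 R \<union> sphere 0 r"
      unfolding S_def Diff_eq using frontier_Int_subset[of "cball 0 R" "- ball (0::complex) r"] rR by (auto simp: frontier_complement)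
    ultimately have z: "norm z = R \<or> norm z = r" by auto
    have Fz: "norm (F z) * \<bar>Re z\<bar> \<le> \<bar>C\<bar> * norm z"
      using b[of z] z mult_right_mono[OF abs_ge_self[of C] norm_ge_zero[of z]] by (auto simp: r_def R_def)
    have fac: "norm (z\<^sup>2 + of_real (t\<^sup>2)) \<le> (norm z)\<^sup>2 + t\<^sup>2" for t
      using norm_triangle_ineq[of "z\<^sup>2" "of_real (t\<^sup>2)"] by (simp add: norm_power)
    have key: "norm (F z) * norm (z\<^sup>2 + of_real (t\<^sup>2)) \<le> 2 * \<bar>C\<bar> * t\<^sup>2" if "norm z = t" "0 < t" for t
    proof -
      have "norm (F z) * norm (z\<^sup>2 + of_real (t\<^sup>2)) = 2 * t * (norm (F z) * \<bar>Re z\<bar>)"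
        unfolding norm_annulus_factor[OF that(1)] by simp
      also have "\<dots> \<le> 2 * t * (\<bar>C\<bar> * t)" using Fz that by (intro mult_left_mono) auto
      finally show ?thesis by (simp add: power2_eq_square mult_ac)
    qed
    have rR2: "r\<^sup>2 \<le> R\<^sup>2" using rR by (intro power_mono) auto
    from z show "norm (H z) \<le> (2 * \<bar>C\<bar> * R\<^sup>2) * (R\<^sup>2 + r\<^sup>2)"
    proof
      assume z: "norm z = R"
      have "norm (H z) = (norm (F z) * norm (z\<^sup>2 + of_real (R\<^sup>2))) * norm (z\<^sup>2 + of_real (r\<^sup>2))"
        by (simp add: H_def norm_mult)
      also have "\<dots> \<le> (2 * \<bar>C\<bar> * R\<^sup>2) * (R\<^sup>2 + r\<^sup>2)"
        using mult_mono[OF key[OF z] fac[of r]] z rR by simp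
      finally show ?thesis .
    next
      assume z: "norm z = r"
      have "norm (H z) = (norm (F z) * norm (z\<^sup>2 + of_real (r\<^sup>2))) * norm (z\<^sup>2 + of_real (R\<^sup>2))"
        by (simp add: H_def norm_mult)
      also have "\<dots> \<le> (2 * \<bar>C\<bar> * r\<^sup>2) * (r\<^sup>2 + R\<^sup>2)"
        using mult_mono[OF key[OF z] fac[of R]] z rR by simp
      also have "\<dots> \<le> (2 * \<bar>C\<bar> * R\<^sup>2) * (R\<^sup>2 + r\<^sup>2)"
        using mult_right_mono[OF mult_left_mono[OF rR2, of "2 * \<bar>C\<bar>"], of "R\<^sup>2 + r\<^sup>2"] by (simp add: add.commute)
      finally show ?thesis .
    qed
  qed
  moreover have "(norm w)\<^sup>2 - r\<^sup>2 \<le> norm (w\<^sup>2 + of_real (r\<^sup>2))"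
    using norm_diff_ineq[of "w\<^sup>2" "of_real (r\<^sup>2)"] by (simp add: norm_power)
  moreover have "R\<^sup>2 - (norm w)\<^sup>2 \<le> norm (w\<^sup>2 + of_real (R\<^sup>2))"
    using norm_diff_ineq[of "of_real (R\<^sup>2)" "w\<^sup>2"] by (simp add: norm_power add.commute)
  \<comment> \<open>With |w| = 2 r and R = 4 r, the bound on \<open>H\<close> has the constant 2 *
    16 * 17 = 544, and the two factors are at least 3 r^2 and 12 r^2. The constant 16 of the lemma
    comes from 544 <= 16 * 36.\<close>
  ultimately have H: "norm (H w) \<le> 544 * \<bar>C\<bar> * r ^ 4" and lo: "3 * r\<^sup>2 \<le> norm (w\<^sup>2 + of_real (r\<^sup>2))" "12 * r\<^sup>2 \<le> norm (w\<^sup>2 + of_real (R\<^sup>2))"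
    unfolding rR(3,4) by (simp_all add: power2_eq_square power4_eq_xxxx)
  have "norm (F w) * (36 * r ^ 4) = norm (F w) * ((3 * r\<^sup>2) * (12 * r\<^sup>2))" by (simp add: power2_eq_square power4_eq_xxxx)
  also have "\<dots> \<le> norm (F w) * (norm (w\<^sup>2 + of_real (r\<^sup>2)) * norm (w\<^sup>2 + of_real (R\<^sup>2)))"
    using lo by (intro mult_left_mono mult_mono) auto
  also have "\<dots> = norm (H w)" by (simp add: H_def norm_mult)
  also have "\<dots> \<le> 544 * \<bar>C\<bar> * r ^ 4" by (rule H)
  also have "\<dots> \<le> (16 * \<bar>C\<bar>) * (36 * r ^ 4)" by simp
  finally have "norm (F w) * (36 * r ^ 4) \<le> (16 * \<bar>C\<bar>) * (36 * r ^ 4)" .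
  then show ?thesis using rR(1) by (simp only: mult_le_cancel_right_pos[OF mult_pos_pos[OF _ zero_less_power]] zero_less_numeral)
qed

text \<open>The hypothesis speaks only of small and of large \<open>z\<close>. Near 0 it makes the
  singularity removable; the extension is then bounded near infinity by the hypothesis and in
  between by compactness.\<close>

lemma punctured_liouville:
  fixes F :: "complex \<Rightarrow> complex"
  assumes F: "F holomorphic_on - {0}" and r0: "0 < r0"
    and b: "\<And>z. z \<noteq> 0 \<Longrightarrow> norm z \<le> r0 \<or> R0 \<le> norm z \<Longrightarrow> norm (F z) * \<bar>Re z\<bar> \<le> C * norm z"
  obtains c where "\<And>z. z \<noteq> 0 \<Longrightarrow> F z = c"
proof -
  define R1 where "R1 = max 1 R0"
  \<comment> \<open>Both circles of \<open>annulus_bound\<close>, of radii |w| / 2 and 2 |w|, have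
    to lie where the hypothesis holds; hence r0 / 2 and 2 R1.\<close>
  have bd': "norm (F w) \<le> 16 * \<bar>C\<bar>" if "w \<noteq> 0" "norm w \<le> r0 / 2 \<or> 2 * R1 \<le> norm w" for w
  proof (rule annulus_bound[OF F that(1)])
    fix z :: complex assume "norm z = norm w / 2 \<or> norm z = 2 * norm w"
    with that norm_ge_zero[of w] r0 have "z \<noteq> 0" "norm z \<le> r0 \<or> R0 \<le> norm z"
      unfolding R1_def by auto
    then show "norm (F z) * \<bar>Re z\<bar> \<le> C * norm z" by (rule b)
  qed
  have "\<forall>\<^sub>F z in at 0. norm (F z) \<le> 16 * \<bar>C\<bar>"
    unfolding eventually_at by (intro exI[of _ "r0/2"]) (use bd' r0 in \<open>auto simp: less_imp_le\<close>)
  moreover have "F holomorphic_on UNIV - {0}" using F by (simp add: Compl_eq_Diff_UNIV)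
  ultimately obtain G where G: "G holomorphic_on UNIV" "\<And>z. z \<noteq> 0 \<Longrightarrow> G z = F z"
    using holomorphic_on_extend_bounded[of F UNIV 0] by auto
  have "compact (G ` cball 0 (2 * R1))"
    by (intro compact_continuous_image holomorphic_on_imp_continuous_on holomorphic_on_subset[OF G(1)]) auto
  then obtain K where K: "\<And>z. z \<in> cball 0 (2 * R1) \<Longrightarrow> norm (G z) \<le> K"
    using compact_imp_bounded bounded_iff by (metis imageI)
  have "norm (G z) \<le> max K (16 * \<bar>C\<bar>)" for z
  proof (cases "norm z \<le> 2 * R1")
    case True then show ?thesis using K[of z] by simp
  next
    case False
    then have "z \<noteq> 0" by (auto simp: R1_def)
    then show ?thesis using bd'[of z] G(2)[of z] False by simp
  qed
  then have "bounded (range G)" by (auto simp: bounded_iff)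
  then have "G constant_on UNIV" using Liouville_theorem G(1) by blast
  then obtain c where "\<And>z. G z = c" by (auto simp: constant_on_def)
  then show thesis using that G(2) by metis
qed

text \<open>Riemann's theorem, one point at a time: removing one singularity keeps the condition at
  the others, since limits are local.\<close>

lemma removable_finite:
  assumes "finite Z" "open U" "Z \<subseteq> U" "f holomorphic_on (U - Z)"
    and "\<And>z. z \<in> Z \<Longrightarrow> ((\<lambda>l. (l - z) * f l) \<longlongrightarrow> 0) (at z)"
  shows "\<exists>g. g holomorphic_on U \<and> (\<forall>l\<in>U - Z. g l = f l)"
  using assms
proof (induction Z arbitrary: f rule: finite_induct)
  case empty
  then show ?case by auto
next
  case (insert z Z)
  have op: "open (U - Z)" using insert.hyps insert.prems by (simp add: finite_imp_closed open_Diff)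
  have "f holomorphic_on (U - Z) - {z}" by (rule holomorphic_on_subset[OF insert.prems(3)]) auto
  moreover have "z \<in> interior (U - Z)" using op insert by (simp add: interior_open)
  ultimately obtain g where g: "g holomorphic_on U - Z" "\<And>l. l \<in> U - Z - {z} \<Longrightarrow> g l = f l"
    using holomorphic_on_extend_lim[of f "U - Z" z] insert.prems(4)[of z] by auto
  have "\<exists>h. h holomorphic_on U \<and> (\<forall>l\<in>U - Z. h l = g l)"
  proof (rule insert.IH[OF insert.prems(1) _ g(1)])
    show "Z \<subseteq> U" using insert by auto
    fix y assume y: "y \<in> Z"
    have "open (U - insert z Z \<union> {y})"
    proof -
      have "U - insert z Z \<union> {y} = U - (insert z Z - {y})" using y insert by auto
      then show ?thesis using insert by (simp add: finite_imp_closed open_Diff)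
    qed
    then have "\<forall>\<^sub>F l in at y. l \<in> U - insert z Z \<union> {y}" by (rule eventually_at_in_open') auto
    then have ev: "\<forall>\<^sub>F l in at y. (l - y) * f l = (l - y) * g l"
    proof eventually_elim
      case (elim l)
      then show ?case using g(2)[of l] by (cases "l = y") auto
    qed
    then show "((\<lambda>l. (l - y) * g l) \<longlongrightarrow> 0) (at y)"
      using y by (intro Lim_transform_eventually[OF insert.prems(4) ev]) simp
  qed
  then obtain h where "h holomorphic_on U" "\<And>l. l \<in> U - Z \<Longrightarrow> h l = g l" by blast
  then show ?case using g(2) by (intro exI[of _ h]) auto
qed

section \<open>Bounds for phi / E\<close>

context bc_problem begin

text \<open>With m = Im l mu_plus, \<open>phi_bound\<close> is divided by a flux of order exp (- 2
  m) and contains |e| of order exp (- m), which leaves exp m.\<close>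

lemma quotient_bound_large:
  obtains R C where "0 < R" "0 < C"
    "\<And>l x. 0 < Im l \<Longrightarrow> Re l \<noteq> 0 \<Longrightarrow> R \<le> norm l \<Longrightarrow> 0 \<le> x \<Longrightarrow>
        norm (phi l x / E l) * \<bar>Re l\<bar> \<le> C * exp (Im l * mu_plus a \<alpha> x)"
    "\<And>l x. 0 \<le> Im l \<Longrightarrow> R \<le> norm l \<Longrightarrow> 0 \<le> x \<Longrightarrow> norm (e x l) \<le> C * exp (- (Im l * mu_plus a \<alpha> x))"
proof -
  obtain R C where R: "0 < R" "0 < C"
    and fl: "\<And>l x. 0 < Im l \<Longrightarrow> R \<le> norm l \<Longrightarrow> 0 \<le> x \<Longrightarrow>
        \<bar>Re l\<bar> * exp (- (2 * Im l * mu_plus a \<alpha> x)) \<le> C * \<bar>Im (e' x l * cnj (e x l))\<bar>"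
    and el: "\<And>l x. 0 \<le> Im l \<Longrightarrow> R \<le> norm l \<Longrightarrow> 0 \<le> x \<Longrightarrow> norm (e x l) \<le> C * exp (- (Im l * mu_plus a \<alpha> x))"
    using flux_large by blast
  show thesis
  proof (rule that[of R "max C (C\<^sup>2)"])
    fix l x assume l: "0 < Im l" "Re l \<noteq> 0" "R \<le> norm l" and x: "(0::real) \<le> x"
    define m where "m = Im l * mu_plus a \<alpha> x"
    have E0: "0 < norm (E l)" using E_nonzero_off_axis[OF l(1,2)] by simp
    have "norm (phi l x) * (\<bar>Re l\<bar> * exp (- (2 * m))) \<le> norm (phi l x) * (C * \<bar>Im (e' x l * cnj (e x l))\<bar>)"
      using fl[OF l(1,3) x] by (intro mult_left_mono) (auto simp: m_def mult.assoc)
    also have "\<dots> \<le> C * (norm (E l) * norm (e x l))"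
      using mult_left_mono[OF phi_bound[OF l(1,2) x] less_imp_le[OF R(2)]] by (simp only: mult_ac)
    also have "\<dots> \<le> C * (norm (E l) * (C * exp (- m)))"
      using el[OF less_imp_le[OF l(1)] l(3) x] R by (intro mult_left_mono) (auto simp: m_def)
    finally have "norm (phi l x) * (\<bar>Re l\<bar> * exp (- (2 * m))) * exp (2 * m) \<le> C * (norm (E l) * (C * exp (- m))) * exp (2 * m)"
      by (intro mult_right_mono) auto
    moreover have "norm (phi l x) * (\<bar>Re l\<bar> * exp (- (2 * m))) * exp (2 * m) = norm (phi l x) * \<bar>Re l\<bar>"
      by (simp add: mult.assoc flip: exp_add)
    moreover have "C * (norm (E l) * (C * exp (- m))) * exp (2 * m) = C\<^sup>2 * exp m * norm (E l)"
    proof -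
      have "C * (norm (E l) * (C * exp (- m))) * exp (2 * m) = C\<^sup>2 * norm (E l) * (exp (- m) * exp (2 * m))"
        by (simp only: power2_eq_square mult_ac)
      also have "exp (- m) * exp (2 * m) = exp m" by (simp flip: exp_add)
      finally show ?thesis by (simp only: mult_ac)
    qed
    ultimately have "norm (phi l x) * \<bar>Re l\<bar> \<le> C\<^sup>2 * exp m * norm (E l)" by simp
    also have "\<dots> \<le> max C (C\<^sup>2) * exp m * norm (E l)" by (intro mult_right_mono) auto
    finally show "norm (phi l x / E l) * \<bar>Re l\<bar> \<le> max C (C\<^sup>2) * exp (Im l * mu_plus a \<alpha> x)"
      using E0 by (simp add: norm_divide field_simps m_def)
  next
    fix l x assume "0 \<le> Im l" "R \<le> norm l" "(0::real) \<le> x"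
    from el[OF this] show "norm (e x l) \<le> max C (C\<^sup>2) * exp (- (Im l * mu_plus a \<alpha> x))"
      by (elim order.trans) (intro mult_right_mono, auto)
  qed (use R in auto)
qed

text \<open>\<open>E\<close> may be small near 0, so the bound again rests on the flux; for |l| <= 1
  its exponential factor is at least exp (- 2 X).\<close>

lemma quotient_bound_small:
  assumes x: "0 \<le> x"
  obtains C where "0 < C"
    "\<And>l. 0 < Im l \<Longrightarrow> Re l \<noteq> 0 \<Longrightarrow> norm l \<le> 1 \<Longrightarrow> norm (phi l x / E l) * \<bar>Re l\<bar> \<le> C"
    "\<And>l. 0 \<le> Im l \<Longrightarrow> norm l \<le> 1 \<Longrightarrow> norm (e x l) \<le> C"
proof -
  obtain C where C: "\<And>l. 0 \<le> Im l \<Longrightarrow> norm l \<le> 1 \<Longrightarrow> norm (e x l) \<le> C"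
    using e_bounded_near_zero[OF x] by blast
  have C0: "0 \<le> C" using order.trans[OF norm_ge_zero C[of 0]] by simp
  obtain X where X: "x \<le> X" "\<And>l. 0 < Im l \<Longrightarrow> \<bar>Re l\<bar> * (4 / 9) * exp (- (2 * Im l * X)) \<le> \<bar>Im (e' x l * cnj (e x l))\<bar>"
    using flux_lower_all[OF x] by blast
  define c where "c = 4/9 * exp (- (2 * X))"
  have c: "0 < c" by (simp add: c_def)
  show thesis
  proof (rule that[of "max 1 (max C (C / c))"])
    fix l assume l: "0 < Im l" "Re l \<noteq> 0" "norm l \<le> 1"
    have E0: "0 < norm (E l)" using E_nonzero_off_axis[OF l(1,2)] by simp
    have "Im l \<le> 1" using abs_Im_le_cmod[of l] l by linarith
    then have "Im l * X \<le> 1 * X" using X(1) x by (intro mult_right_mono) auto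
    then have "\<bar>Re l\<bar> * c \<le> \<bar>Re l\<bar> * (4 / 9) * exp (- (2 * Im l * X))"
      unfolding c_def mult.assoc by (intro mult_left_mono) auto
    also have "\<dots> \<le> \<bar>Im (e' x l * cnj (e x l))\<bar>" by (rule X(2)[OF l(1)])
    finally have "norm (phi l x) * (\<bar>Re l\<bar> * c) \<le> norm (phi l x) * \<bar>Im (e' x l * cnj (e x l))\<bar>"
      by (intro mult_left_mono) auto
    also have "\<dots> \<le> norm (E l) * norm (e x l)" by (rule phi_bound[OF l(1,2) x])
    also have "\<dots> \<le> norm (E l) * C" using C[of l] l by (intro mult_left_mono) auto
    finally have "norm (phi l x / E l) * \<bar>Re l\<bar> \<le> C / c"
      using E0 c by (simp add: norm_divide field_simps)
    then show "norm (phi l x / E l) * \<bar>Re l\<bar> \<le> max 1 (max C (C / c))" by simp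
  next
    fix l :: complex assume "0 \<le> Im l" "norm l \<le> 1"
    from C[OF this] show "norm (e x l) \<le> max 1 (max C (C / c))" by simp
  qed auto
qed

end

subsection \<open>Comparison of two problems\<close>

text \<open>\<open>K\<close> indexes the common zeros of the two functions \<open>E\<close>.
  \<open>T\<close> collects real points at which the scattering functions are not compared; in the
  degenerate case these are the zeros of the common factor. Simplicity is asked of the first
  problem; equality of the norming values passes it on to the second.\<close>

locale bc_pair = P: bc_problem a \<alpha> q e \<alpha>s \<beta>s + Q: bc_problem a \<alpha> q2 e2 \<alpha>s \<beta>s
  for a \<alpha> q e \<alpha>s \<beta>s q2 e2 +
  fixes K T :: "real set"
  assumes finite_K: "finite K" and finite_T: "finite T" and K_pos: "\<And>\<kappa>. \<kappa> \<in> K \<Longrightarrow> 0 < \<kappa>"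
    and zeros_P: "{l. Im l > 0 \<and> P.E l = 0} = (\<lambda>\<kappa>. \<i> * of_real \<kappa>) ` K"
    and zeros_Q: "{l. Im l > 0 \<and> Q.E l = 0} = (\<lambda>\<kappa>. \<i> * of_real \<kappa>) ` K"
    and simple: "\<And>\<kappa>. \<kappa> \<in> K \<Longrightarrow> deriv P.E (\<i> * of_real \<kappa>) \<noteq> 0"
    and den: "\<And>\<kappa>. \<kappa> \<in> K \<Longrightarrow> norming_den \<beta>s \<kappa> = 0 \<longrightarrow> norming_num \<alpha>s \<beta>s \<kappa> = 0"
    and norming: "\<And>\<kappa>. \<kappa> \<in> K \<Longrightarrow> norming_value a \<alpha> \<alpha>s \<beta>s e \<kappa> = norming_value a \<alpha> \<alpha>s \<beta>s e2 \<kappa>"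
    and scattering: "\<And>r. r \<noteq> 0 \<Longrightarrow> r \<notin> T \<Longrightarrow> S_fun \<alpha>s \<beta>s e r = S_fun \<alpha>s \<beta>s e2 r"
begin

definition Z :: "complex set" where "Z = (\<lambda>\<kappa>. \<i> * of_real \<kappa>) ` K"

lemma finite_Z: "finite Z" and Z_Im: "z \<in> Z \<Longrightarrow> 0 < Im z" and Z_Re: "z \<in> Z \<Longrightarrow> Re z = 0"
  using finite_K K_pos by (auto simp: Z_def)

lemma E_nonzero:
  assumes "0 \<le> Im l" "l \<noteq> 0" "l \<notin> Z" shows "P.E l \<noteq> 0" "Q.E l \<noteq> 0"
proof -
  show "P.E l \<noteq> 0"
    using P.E_nonzero_real[of l] zeros_P assms by (cases "Im l = 0") (force simp: Z_def)+
  show "Q.E l \<noteq> 0"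
    using Q.E_nonzero_real[of l] zeros_Q assms by (cases "Im l = 0") (force simp: Z_def)+
qed

text \<open>Up to the factor \<open>- 1 / l\<close>, this is the off-diagonal entry of the quotient of the fundamental matrices that
  are built from \<open>e\<close> and \<open>2 \<i> l phi / E\<close>.\<close>

definition mixed :: "real \<Rightarrow> complex \<Rightarrow> complex" where
  "mixed x l = l * (P.phi l x / P.E l * e2 x l - Q.phi l x / Q.E l * e x l)"

context
  fixes x :: real
  assumes x: "0 \<le> x"
begin

lemma mixed_continuous: "continuous_on ({l. 0 \<le> Im l} - {0} - Z) (mixed x)"
  unfolding mixed_def
  by (intro continuous_intros continuous_on_subset[OF P.E_continuous] continuous_on_subset[OF Q.E_continuous]
        continuous_on_subset[OF P.e_continuous[OF x]] continuous_on_subset[OF Q.e_continuous[OF x]]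
        holomorphic_on_imp_continuous_on P.phi_holomorphic[OF x] Q.phi_holomorphic[OF x])
     (use E_nonzero in auto)

lemma mixed_holomorphic: "mixed x holomorphic_on ({l. 0 < Im l} - Z)"
proof -
  have nz: "P.E l \<noteq> 0" "Q.E l \<noteq> 0" if "l \<in> {l. 0 < Im l} - Z" for l
  proof -
    have "l \<noteq> 0" using that by force
    then show "P.E l \<noteq> 0" "Q.E l \<noteq> 0" using E_nonzero[of l] that by auto
  qed
  show ?thesis
    unfolding mixed_def
  by (intro holomorphic_intros holomorphic_on_subset[OF P.E_holomorphic] holomorphic_on_subset[OF Q.E_holomorphic]
        holomorphic_on_subset[OF P.e_holomorphic[OF x]] holomorphic_on_subset[OF Q.e_holomorphic[OF x]]
        P.phi_holomorphic[OF x] Q.phi_holomorphic[OF x])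
     (use nz in auto)
qed

text \<open>At a zero, phi = c e and E' = c v, where \<open>v\<close> is the same for both problems.
  The factor c cancels, so the two products contribute the same term z e e2 / v.\<close>

lemma mixed_removable:
  assumes "z \<in> Z" shows "((\<lambda>l. (l - z) * mixed x l) \<longlongrightarrow> 0) (at z)"
proof -
  obtain \<kappa> where \<kappa>: "\<kappa> \<in> K" "z = \<i> * of_real \<kappa>" using assms by (auto simp: Z_def)
  have pos: "0 < \<kappa>" "0 < Im z" using \<kappa> K_pos by auto
  have E0: "P.E z = 0" "Q.E z = 0" using zeros_P zeros_Q \<kappa> by auto
  obtain c where c: "c \<noteq> 0" "P.phi z x = c * e x z"
    "deriv P.E z = c * (2 * \<i> * of_real \<kappa> * of_real (norming_value a \<alpha> \<alpha>s \<beta>s e \<kappa>))"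
    using P.norming_deriv[OF pos(1) _ den[OF \<kappa>(1)]] E0(1) x unfolding \<kappa>(2) by metis
  obtain c2 where c2: "c2 \<noteq> 0" "Q.phi z x = c2 * e2 x z"
    "deriv Q.E z = c2 * (2 * \<i> * of_real \<kappa> * of_real (norming_value a \<alpha> \<alpha>s \<beta>s e2 \<kappa>))"
    using Q.norming_deriv[OF pos(1) _ den[OF \<kappa>(1)]] E0(2) x unfolding \<kappa>(2) by metis
  define v where "v = 2 * \<i> * of_real \<kappa> * complex_of_real (norming_value a \<alpha> \<alpha>s \<beta>s e \<kappa>)"
  have dP: "deriv P.E z = c * v" and dQ: "deriv Q.E z = c2 * v"
    using c(3) c2(3) norming[OF \<kappa>(1)] by (simp_all add: v_def)
  have v: "v \<noteq> 0" using simple[OF \<kappa>(1)] dP \<kappa>(2) by auto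
  have quot: "((\<lambda>l. P.E l / (l - z)) \<longlongrightarrow> c * v) (at z)" "((\<lambda>l. Q.E l / (l - z)) \<longlongrightarrow> c2 * v) (at z)"
    using holomorphic_derivI[OF P.E_holomorphic open_halfspace_Im_gt, of z]
      holomorphic_derivI[OF Q.E_holomorphic open_halfspace_Im_gt, of z] pos E0 dP dQ
    by (auto simp: has_field_derivative_iff)
  have pc: "((\<lambda>l. P.phi l x) \<longlongrightarrow> c * e x z) (at z)" "((\<lambda>l. Q.phi l x) \<longlongrightarrow> c2 * e2 x z) (at z)"
    unfolding c(2)[symmetric] c2(2)[symmetric]
    using holomorphic_on_imp_continuous_on[OF P.phi_holomorphic[OF x, of UNIV]]
      holomorphic_on_imp_continuous_on[OF Q.phi_holomorphic[OF x, of UNIV]]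
    by (auto simp: continuous_on_eq_continuous_at isCont_def)
  have ec: "(e x \<longlongrightarrow> e x z) (at z)" "(e2 x \<longlongrightarrow> e2 x z) (at z)"
    using holomorphic_on_imp_continuous_on[OF P.e_holomorphic[OF x]] holomorphic_on_imp_continuous_on[OF Q.e_holomorphic[OF x]] pos
    by (auto simp: continuous_on_eq_continuous_at open_halfspace_Im_gt isCont_def)
  have "((\<lambda>l. l * (P.phi l x / (P.E l / (l - z)) * e2 x l - Q.phi l x / (Q.E l / (l - z)) * e x l))
      \<longlongrightarrow> z * (c * e x z / (c * v) * e2 x z - c2 * e2 x z / (c2 * v) * e x z)) (at z)"
    by (intro tendsto_intros quot pc ec) (use c(1) c2(1) v in auto)
  moreover have "z * (c * e x z / (c * v) * e2 x z - c2 * e2 x z / (c2 * v) * e x z) = 0"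
    using c(1) c2(1) v by simp
  moreover have "(\<lambda>l. l * (P.phi l x / (P.E l / (l - z)) * e2 x l - Q.phi l x / (Q.E l / (l - z)) * e x l))
      = (\<lambda>l. (l - z) * mixed x l)"
    by (auto simp: mixed_def algebra_simps)
  ultimately show ?thesis by (simp only:)
qed

lemma mixed_real:
  assumes r: "r \<noteq> 0"
  shows "mixed x (of_real r) = of_real (Im (cnj (e x (of_real r)) * e2 x (of_real r)))"
proof -
  \<comment> \<open>At the points of \<open>T\<close> the identity follows by continuity of this
    difference, since \<open>T\<close> is finite.\<close>
  define d where "d = (\<lambda>r. mixed x (of_real r) - of_real (Im (cnj (e x (of_real r)) * e2 x (of_real r))))"
  have d0: "d r = 0" if r: "r \<noteq> 0" "r \<notin> T" for r
  proof -
    let ?l = "complex_of_real r"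
    have nz: "P.E ?l \<noteq> 0" "Q.E ?l \<noteq> 0" using E_nonzero[of ?l] Z_Im r by fastforce+
    define s where "s = S_fun \<alpha>s \<beta>s e r"
    have sP: "P.B ?l * cnj (P.e' 0 ?l) + P.A ?l * cnj (e 0 ?l) = s * P.E ?l"
      using nz by (simp add: s_def S_fun_def P.deriv0_eq)
    have sQ: "Q.B ?l * cnj (Q.e' 0 ?l) + Q.A ?l * cnj (e2 0 ?l) = s * Q.E ?l"
      unfolding s_def scattering[OF r] using nz by (simp add: S_fun_def Q.deriv0_eq)
    have "2 * \<i> * ?l * P.phi ?l x = (cnj (e x ?l) - e x ?l * s) * P.E ?l"
      using P.phi_real[of ?l x, unfolded sP, OF _ x] by (simp add: algebra_simps)
    then have P1: "2 * \<i> * ?l * (P.phi ?l x / P.E ?l) = cnj (e x ?l) - e x ?l * s" using nz by simp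
    have "2 * \<i> * ?l * Q.phi ?l x = (cnj (e2 x ?l) - e2 x ?l * s) * Q.E ?l"
      using Q.phi_real[of ?l x, unfolded sQ, OF _ x] by (simp add: algebra_simps)
    then have Q1: "2 * \<i> * ?l * (Q.phi ?l x / Q.E ?l) = cnj (e2 x ?l) - e2 x ?l * s" using nz by simp
    have "2 * \<i> * mixed x ?l = (2 * \<i> * ?l * (P.phi ?l x / P.E ?l)) * e2 x ?l - (2 * \<i> * ?l * (Q.phi ?l x / Q.E ?l)) * e x ?l"
      by (simp add: mixed_def algebra_simps)
    \<comment> \<open>Both products contain the term - s e e2, which cancels.\<close>
    also have "\<dots> = cnj (e x ?l) * e2 x ?l - cnj (cnj (e x ?l) * e2 x ?l)"
      unfolding P1 Q1 by (simp add: algebra_simps)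
    also have "\<dots> = 2 * \<i> * of_real (Im (cnj (e x ?l) * e2 x ?l))"
      by (simp only: complex_diff_cnj) (simp add: mult_ac)
    finally show ?thesis by (simp add: d_def)
  qed
  have "((\<lambda>r. d r) \<longlongrightarrow> d r) (at r)"
  proof -
    have "continuous_on (- {0}) d"
      unfolding d_def
    proof (intro continuous_intros)
      show "continuous_on (- {0}) (\<lambda>r. mixed x (of_real r))"
        by (rule continuous_on_compose2[OF mixed_continuous]) (use Z_Im in \<open>fastforce intro!: continuous_intros\<close>)+
      show "continuous_on (- {0}) (\<lambda>r. e x (of_real r))"
        by (rule continuous_on_compose2[OF P.e_continuous[OF x]]) (auto intro!: continuous_intros)
      show "continuous_on (- {0}) (\<lambda>r. e2 x (of_real r))"
        by (rule continuous_on_compose2[OF Q.e_continuous[OF x]]) (auto intro!: continuous_intros)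
    qed
    then show ?thesis using r by (simp add: continuous_on_eq_continuous_at isCont_def open_Compl)
  qed
  moreover have "\<forall>\<^sub>F r in at r. d r = 0"
  proof -
    have "open (- (insert 0 (T - {r})))" using finite_T by (intro open_Compl finite_imp_closed) auto
    then have "\<forall>\<^sub>F s in at r. s \<in> - (insert 0 (T - {r}))" using r by (intro eventually_at_in_open') auto
    moreover have "\<forall>\<^sub>F s in at r. s \<noteq> r" by (simp add: eventually_at_filter)
    ultimately show ?thesis by eventually_elim (use d0 in auto)
  qed
  then have "((\<lambda>r. d r) \<longlongrightarrow> 0) (at r)" by (rule tendsto_eventually)
  ultimately have "d r = 0" using tendsto_unique[OF trivial_limit_at] by blast
  then show ?thesis by (simp add: d_def)
qed

text \<open>The growth of each quotient phi / E meets the decay of the other Jost solution, with the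
  same \<open>mu_plus\<close>. On the real line, which the quotient bounds leave out,
  \<open>mixed_real\<close> is used.\<close>

lemma mixed_bound:
  obtains r0 R0 C where "0 < r0"
    "\<And>l. 0 \<le> Im l \<Longrightarrow> l \<noteq> 0 \<Longrightarrow> Re l \<noteq> 0 \<Longrightarrow> norm l \<le> r0 \<or> R0 \<le> norm l \<Longrightarrow> norm (mixed x l) * \<bar>Re l\<bar> \<le> C * norm l"
proof -
  obtain R1 C1 where R1: "0 < R1" "0 < C1"
    and P1: "\<And>l x. 0 < Im l \<Longrightarrow> Re l \<noteq> 0 \<Longrightarrow> R1 \<le> norm l \<Longrightarrow> 0 \<le> x \<Longrightarrow>
        norm (P.phi l x / P.E l) * \<bar>Re l\<bar> \<le> C1 * exp (Im l * mu_plus a \<alpha> x)"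
    and E1: "\<And>l x. 0 \<le> Im l \<Longrightarrow> R1 \<le> norm l \<Longrightarrow> 0 \<le> x \<Longrightarrow> norm (e x l) \<le> C1 * exp (- (Im l * mu_plus a \<alpha> x))"
    using P.quotient_bound_large by blast
  obtain R2 C2 where R2: "0 < R2" "0 < C2"
    and P2: "\<And>l x. 0 < Im l \<Longrightarrow> Re l \<noteq> 0 \<Longrightarrow> R2 \<le> norm l \<Longrightarrow> 0 \<le> x \<Longrightarrow>
        norm (Q.phi l x / Q.E l) * \<bar>Re l\<bar> \<le> C2 * exp (Im l * mu_plus a \<alpha> x)"
    and E2: "\<And>l x. 0 \<le> Im l \<Longrightarrow> R2 \<le> norm l \<Longrightarrow> 0 \<le> x \<Longrightarrow> norm (e2 x l) \<le> C2 * exp (- (Im l * mu_plus a \<alpha> x))"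
    using Q.quotient_bound_large by blast
  obtain C3 where C3: "0 < C3" "\<And>l. 0 < Im l \<Longrightarrow> Re l \<noteq> 0 \<Longrightarrow> norm l \<le> 1 \<Longrightarrow> norm (P.phi l x / P.E l) * \<bar>Re l\<bar> \<le> C3"
    "\<And>l. 0 \<le> Im l \<Longrightarrow> norm l \<le> 1 \<Longrightarrow> norm (e x l) \<le> C3"
    using P.quotient_bound_small[OF x] by blast
  obtain C4 where C4: "0 < C4" "\<And>l. 0 < Im l \<Longrightarrow> Re l \<noteq> 0 \<Longrightarrow> norm l \<le> 1 \<Longrightarrow> norm (Q.phi l x / Q.E l) * \<bar>Re l\<bar> \<le> C4"
    "\<And>l. 0 \<le> Im l \<Longrightarrow> norm l \<le> 1 \<Longrightarrow> norm (e2 x l) \<le> C4"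
    using Q.quotient_bound_small[OF x] by blast
  define C where "C = 2 * (C1 * C2) + 2 * (C3 * C4)"
  have Cge: "2 * (C1 * C2) \<le> C" "2 * (C3 * C4) \<le> C" using R1 R2 C3 C4 by (simp_all add: C_def)
  have combine: "norm (mixed x l) * \<bar>Re l\<bar> \<le> norm l * (2 * (X * Y))"
    if "norm (P.phi l x / P.E l) * \<bar>Re l\<bar> \<le> X * m" "norm (e2 x l) \<le> Y / m"
      "norm (Q.phi l x / Q.E l) * \<bar>Re l\<bar> \<le> Y * m" "norm (e x l) \<le> X / m" "0 < m" "0 < X" "0 < Y" for l X Y m
  proof -
    have "norm (mixed x l) \<le> norm l * (norm (P.phi l x / P.E l) * norm (e2 x l) + norm (Q.phi l x / Q.E l) * norm (e x l))"
      unfolding mixed_def norm_mult[of l] by (intro mult_left_mono order.trans[OF norm_triangle_ineq4]) (simp_all only: norm_mult order_refl norm_ge_zero)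
    then have "norm (mixed x l) * \<bar>Re l\<bar> \<le> norm l * (norm (P.phi l x / P.E l) * norm (e2 x l) + norm (Q.phi l x / Q.E l) * norm (e x l)) * \<bar>Re l\<bar>"
      by (intro mult_right_mono) auto
    also have "\<dots> = norm l * ((norm (P.phi l x / P.E l) * \<bar>Re l\<bar>) * norm (e2 x l) + (norm (Q.phi l x / Q.E l) * \<bar>Re l\<bar>) * norm (e x l))"
      by (simp add: algebra_simps)
    also have "\<dots> \<le> norm l * ((X * m) * (Y / m) + (Y * m) * (X / m))"
    proof -
      have "(norm (P.phi l x / P.E l) * \<bar>Re l\<bar>) * norm (e2 x l) \<le> (X * m) * (Y / m)"
        by (rule mult_mono[OF that(1,2)]) (use that in auto)
      moreover have "(norm (Q.phi l x / Q.E l) * \<bar>Re l\<bar>) * norm (e x l) \<le> (Y * m) * (X / m)"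
        by (rule mult_mono[OF that(3,4)]) (use that in auto)
      ultimately show ?thesis by (intro mult_left_mono add_mono) auto
    qed
    also have "(X * m) * (Y / m) + (Y * m) * (X / m) = 2 * (X * Y)" using that(5) by simp
    finally show ?thesis .
  qed
  have real_case: "norm (mixed x l) * \<bar>Re l\<bar> \<le> norm l * (2 * (X * Y))"
    if "Im l = 0" "l \<noteq> 0" "norm (e x l) \<le> X" "norm (e2 x l) \<le> Y" for l X Y
  proof -
    have l: "l = of_real (Re l)" using that(1) by (simp add: complex_eq_iff)
    have "norm (mixed x l) = \<bar>Im (cnj (e x l) * e2 x l)\<bar>"
      using mixed_real[of "Re l"] that l by (metis norm_of_real of_real_0)
    also have "\<dots> \<le> norm (e x l) * norm (e2 x l)"
      using abs_Im_le_cmod[of "cnj (e x l) * e2 x l"] by (simp add: norm_mult)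
    also have "\<dots> \<le> X * Y" using that by (intro mult_mono) (auto intro: order.trans[OF norm_ge_zero])
    finally have "norm (mixed x l) * \<bar>Re l\<bar> \<le> (X * Y) * norm l"
      using abs_Re_le_cmod[of l] by (intro mult_mono) (auto intro: order.trans[OF norm_ge_zero])
    moreover have "0 \<le> (X * Y) * norm l"
      using that by (intro mult_nonneg_nonneg) (auto intro: order.trans[OF norm_ge_zero])
    ultimately show ?thesis by (simp add: mult_ac)
  qed
  show thesis
  proof (rule that[of 1 "max R1 R2" C])
    fix l assume l: "0 \<le> Im l" "l \<noteq> 0" "Re l \<noteq> 0" "norm l \<le> 1 \<or> max R1 R2 \<le> norm l"
    from l(4) show "norm (mixed x l) * \<bar>Re l\<bar> \<le> C * norm l"
    proof
      assume n: "norm l \<le> 1"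
      have "norm (mixed x l) * \<bar>Re l\<bar> \<le> norm l * (2 * (C3 * C4))"
      proof (cases "Im l = 0")
        case True
        then show ?thesis using real_case[OF True l(2)] C3(3)[of l] C4(3)[of l] n by simp
      next
        case False
        show ?thesis by (rule combine[where m = 1]) (use C3 C4 l n False in auto)
      qed
      also have "\<dots> \<le> norm l * C" using Cge by (intro mult_left_mono) auto
      finally show ?thesis by (simp add: mult.commute)
    next
      assume n: "max R1 R2 \<le> norm l"
      have "norm (mixed x l) * \<bar>Re l\<bar> \<le> norm l * (2 * (C1 * C2))"
      proof (cases "Im l = 0")
        case True
        then show ?thesis using real_case[OF True l(2)] E1[of l x] E2[of l x] n x by simp
      next
        case False
        show ?thesis by (rule combine[where m = "exp (Im l * mu_plus a \<alpha> x)"])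
           (use P1[of l x] P2[of l x] E1[of l x] E2[of l x] R1 R2 l n False x in \<open>auto simp: exp_minus divide_inverse\<close>)
      qed
      also have "\<dots> \<le> norm l * C" using Cge by (intro mult_left_mono) auto
      finally show ?thesis by (simp add: mult.commute)
    qed
  qed simp
qed

lemma mixed_vanishes:
  assumes l: "0 < Im l" "l \<notin> Z" shows "mixed x l = 0"
proof -
  define U where "U = {l. 0 < Im l}"
  have U: "open U" by (simp add: U_def open_halfspace_Im_gt)
  obtain g where g: "g holomorphic_on U" "\<And>l. l \<in> U - Z \<Longrightarrow> g l = mixed x l"
    using removable_finite[OF finite_Z U, of "mixed x"] Z_Im mixed_holomorphic mixed_removable unfolding U_def by blast
  \<comment> \<open>In the open half plane the extension over \<open>Z\<close> is taken, on the real
    line \<open>mixed\<close> itself.\<close>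
  define f where "f = (\<lambda>l. if 0 < Im l then g l else mixed x l)"
  define G where "G = (\<lambda>z. if 0 \<le> Im z then f z else cnj (f (cnj z)))"
  have f_mixed: "f l = mixed x l" if "l \<notin> Z" for l using that g(2)[of l] by (simp add: f_def U_def)
  have cont: "continuous_on (- {0} \<inter> {z. 0 \<le> Im z}) f"
  proof -
    \<comment> \<open>Continuity up to the real line: both pieces are relatively open in their
      union, and \<open>f\<close> is continuous on each.\<close>
    define A1 where "A1 = {l. 0 \<le> Im l} - {0} - Z"
    have un: "- {0} \<inter> {z. 0 \<le> Im z} = A1 \<union> U"
      using Z_Im by (auto simp: A1_def U_def)
    have "continuous_on (A1 \<union> U) f"
    proof (rule continuous_on_Un_local_open)
      have "A1 = (A1 \<union> U) \<inter> (- Z)" using Z_Im by (auto simp: A1_def U_def)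
      then show "openin (top_of_set (A1 \<union> U)) A1"
        using finite_Z by (metis openin_open_Int open_Compl finite_imp_closed)
      have "U = (A1 \<union> U) \<inter> U" by auto
      then show "openin (top_of_set (A1 \<union> U)) U" using U by (metis openin_open_Int)
      show "continuous_on A1 f"
        by (rule continuous_on_cong[THEN iffD2, OF refl _ mixed_continuous[folded A1_def]]) (use f_mixed in \<open>auto simp: A1_def\<close>)
      show "continuous_on U f"
        by (rule continuous_on_cong[THEN iffD2, OF refl _ holomorphic_on_imp_continuous_on[OF g(1)]]) (auto simp: f_def U_def)
    qed
    then show ?thesis by (simp only: un)
  qed
  have G: "G holomorphic_on - {0}"
    unfolding G_def
  proof (rule Schwarz_reflection)
    have "f holomorphic_on U" by (rule holomorphic_cong[THEN iffD2, OF refl _ g(1)]) (auto simp: f_def U_def)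
    then show "f holomorphic_on - {0} \<inter> {z. 0 < Im z}" by (rule holomorphic_on_subset) (auto simp: U_def)
    fix z :: complex assume z: "z \<in> - {0}" "z \<in> \<real>"
    then obtain r where r: "z = of_real r" "r \<noteq> 0" by (auto simp: Reals_def)
    then show "f z \<in> \<real>" using mixed_real[OF r(2)] by (simp add: f_def)
  qed (use cont in auto)
  obtain r0 R0 C where r0: "0 < r0" and b:
    "\<And>l. 0 \<le> Im l \<Longrightarrow> l \<noteq> 0 \<Longrightarrow> Re l \<noteq> 0 \<Longrightarrow> norm l \<le> r0 \<or> R0 \<le> norm l \<Longrightarrow> norm (mixed x l) * \<bar>Re l\<bar> \<le> C * norm l"
    using mixed_bound by blast
  have "norm (G z) * \<bar>Re z\<bar> \<le> \<bar>C\<bar> * norm z" if z: "z \<noteq> 0" "norm z \<le> r0 \<or> R0 \<le> norm z" for z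
    proof (cases "Re z = 0")
      case False
      have *: "norm (f l) * \<bar>Re l\<bar> \<le> \<bar>C\<bar> * norm l" if "0 \<le> Im l" "l \<noteq> 0" "Re l \<noteq> 0" "norm l \<le> r0 \<or> R0 \<le> norm l" for l
      proof -
        have "l \<notin> Z" using Z_Re that(3) by blast
        then show ?thesis
          using b[OF that] mult_right_mono[OF abs_ge_self[of C] norm_ge_zero[of l]] by (simp add: f_mixed)
      qed
      show ?thesis using *[of z] *[of "cnj z"] z False by (auto simp: G_def)
    qed simp
  then obtain c where c: "\<And>z. z \<noteq> 0 \<Longrightarrow> G z = c"
    using punctured_liouville[OF G r0] by blast
  have G1: "G (of_real r) = of_real (Im (cnj (e x (of_real r)) * e2 x (of_real r)))" if "r \<noteq> 0" for r
    using mixed_real[OF that] by (simp add: G_def f_def)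
  \<comment> \<open>Oddness at the single pair 1, -1 is enough to determine the constant.\<close>
  have "e x (-1) = cnj (e x 1)" "e2 x (-1) = cnj (e2 x 1)"
    using P.e_minus_cnj(1)[of 1 x] Q.e_minus_cnj(1)[of 1 x] x by simp_all
  then have "G (-1) = - G 1" using G1[of 1] G1[of "-1"] by simp
  then have "c = 0" using c[of 1] c[of "-1"] by simp
  then have "G l = 0" using c[of l] l by fastforce
  then show ?thesis using f_mixed[OF l(2)] l by (simp add: G_def)
qed

end

text \<open>One point off the imaginary axis suffices: at 1 + i neither \<open>E\<close> vanishes
  nor, by \<open>flux_nonzero\<close>, does \<open>e\<close> at any x.\<close>

lemma jost_square_eq:
  assumes "0 \<le> x" shows "(e x (Complex 1 1))\<^sup>2 = (e2 x (Complex 1 1))\<^sup>2"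
proof -
  let ?l = "Complex 1 1"
  have l: "0 < Im ?l" "?l \<notin> Z" "?l \<noteq> 0" "0 \<le> Im ?l" using Z_Re[of ?l] by (auto simp: complex_eq_iff)
  have nz: "P.E ?l \<noteq> 0" "Q.E ?l \<noteq> 0" using E_nonzero[OF l(4,3,2)] by auto
  have eq: "P.phi ?l x * e2 x ?l * Q.E ?l = Q.phi ?l x * e x ?l * P.E ?l" if "0 \<le> x" for x
  proof -
    have "P.phi ?l x / P.E ?l * e2 x ?l = Q.phi ?l x / Q.E ?l * e x ?l"
      using mixed_vanishes[OF that l(1,2)] l(3) by (simp add: mixed_def)
    then show ?thesis using nz by (simp add: field_simps)
  qed
  define d where "d = (\<lambda>x. P.phi ?l x * e2 x ?l * Q.E ?l - Q.phi ?l x * e x ?l * P.E ?l)"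
  have "(d has_vector_derivative
     (P.phi ?l x * Q.e' x ?l + P.phi' ?l x * e2 x ?l) * Q.E ?l - (Q.phi ?l x * P.e' x ?l + Q.phi' ?l x * e x ?l) * P.E ?l) (at x within {0..})"
    unfolding d_def
    by (intro has_vector_derivative_diff has_vector_derivative_mult_left has_vector_derivative_mult
          sl_solD(2)[OF P.phi_sol] sl_solD(2)[OF Q.phi_sol] sl_solD(2)[OF P.e_sol] sl_solD(2)[OF Q.e_sol] assms l(4))
  moreover have "(d has_vector_derivative 0) (at x within {0..})"
    by (rule has_vector_derivative_transform[OF _ _ has_vector_derivative_const[of 0]]) (use eq assms in \<open>auto simp: d_def\<close>)
  ultimately have eq': "(P.phi ?l x * Q.e' x ?l + P.phi' ?l x * e2 x ?l) * Q.E ?l = (Q.phi ?l x * P.e' x ?l + Q.phi' ?l x * e x ?l) * P.E ?l"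
    using P.vector_derivative_half_line[OF _ assms] by (metis eq_iff_diff_eq_0)
  define p p' y y' where "p = P.phi ?l x" and "p' = P.phi' ?l x" and "y = e x ?l" and "y' = P.e' x ?l"
  define s s' z z' where "s = Q.phi ?l x" and "s' = Q.phi' ?l x" and "z = e2 x ?l" and "z' = Q.e' x ?l"
  have W1: "p * y' - p' * y = P.E ?l" and W2: "s * z' - s' * z = Q.E ?l"
    using P.phi_wronskian[OF l(4) assms] Q.phi_wronskian[OF l(4) assms] by (simp_all add: p_def p'_def y_def y'_def s_def s'_def z_def z'_def)
  have e1: "p * z * Q.E ?l = s * y * P.E ?l" using eq[OF assms] by (simp add: p_def z_def s_def y_def)
  have e2: "(p * z' + p' * z) * Q.E ?l = (s * y' + s' * y) * P.E ?l"
    using eq' by (simp add: p_def p'_def y_def y'_def s_def s'_def z_def z'_def)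
  \<comment> \<open>Take the differentiated identity times y z. The Wronskians eliminate p' y and s'
    z, the other terms agree by \<open>e1\<close>, and the product of the two \<open>E\<close> times
    z^2 on one side and times y^2 on the other is left over.\<close>
  have "P.E ?l * Q.E ?l * (y\<^sup>2 - z\<^sup>2) = 0"
  proof -
    have p'y: "p' * y = p * y' - P.E ?l" and s'z: "s' * z = s * z' - Q.E ?l"
      using W1 W2 by (simp_all add: algebra_simps)
    have "(p * z' + p' * z) * Q.E ?l * (y * z) = (p * z * Q.E ?l) * (z' * y) + (p' * y) * (z * z * Q.E ?l)"
      by (simp add: algebra_simps)
    also have "(p' * y) * (z * z * Q.E ?l) = (p * z * Q.E ?l) * (y' * z) - P.E ?l * (z * z * Q.E ?l)"
      unfolding p'y by (simp add: algebra_simps)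
    finally have L: "(p * z' + p' * z) * Q.E ?l * (y * z) = s * y * P.E ?l * z' * y + s * y * P.E ?l * y' * z - P.E ?l * Q.E ?l * z\<^sup>2"
      unfolding e1 by (simp add: power2_eq_square algebra_simps)
    have "(s * y' + s' * y) * P.E ?l * (y * z) = (s * y * P.E ?l) * (y' * z) + (s' * z) * (y * y * P.E ?l)"
      by (simp add: algebra_simps)
    then have R: "(s * y' + s' * y) * P.E ?l * (y * z) = s * y * P.E ?l * y' * z + s * y * P.E ?l * z' * y - P.E ?l * Q.E ?l * y\<^sup>2"
      unfolding s'z by (simp add: power2_eq_square algebra_simps)
    have "P.E ?l * Q.E ?l * z\<^sup>2 = P.E ?l * Q.E ?l * y\<^sup>2"
      using L R unfolding e2 by auto
    then show ?thesis by (simp only: right_diff_distrib) simp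
  qed
  then show ?thesis using nz by (simp add: y_def z_def)
qed

text \<open>The quotient e2 / e is continuous with values 1 and -1, hence constant. So e2 solves
  both equations, and (q2 - q) e2 has integral 0 over every interval; Lebesgue differentiation and
  the absence of zeros of e2 finish the proof.\<close>

lemma potentials_eq: "AE x in lebesgue. x \<ge> 0 \<longrightarrow> q x = q2 x"
proof -
  let ?l = "Complex 1 1"
  have l: "0 \<le> Im ?l" "0 < Im ?l" "Re ?l \<noteq> 0" by auto
  have nz: "e x ?l \<noteq> 0" "e2 x ?l \<noteq> 0" if "0 \<le> x" for x
    using P.flux_nonzero[OF l(2,3) that] Q.flux_nonzero[OF l(2,3) that] by auto
  define s where "s = (\<lambda>x. e2 x ?l / e x ?l)"
  have "continuous_on {0..} s"
    unfolding s_def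
    by (intro continuous_intros sl_sol_continuous[OF P.e_sol[OF l(1)]] sl_sol_continuous[OF Q.e_sol[OF l(1)]]) (use nz in auto)
  moreover have "s ` {0..} \<subseteq> {1, -1}"
  proof (intro image_subsetI)
    fix x :: real assume "x \<in> {0..}"
    then have "(s x)\<^sup>2 = 1" using jost_square_eq[of x] nz[of x] by (simp add: s_def power_divide)
    then show "s x \<in> {1, -1}" by (simp add: power2_eq_1_iff)
  qed
  ultimately have "s constant_on {0..}"
    by (intro continuous_finite_range_constant) (auto intro: finite_subset)
  then obtain s0 where s0: "\<And>x. 0 \<le> x \<Longrightarrow> s x = s0" by (auto simp: constant_on_def)
  then have e2: "e2 x ?l = s0 * e x ?l" if "0 \<le> x" for x
    using s0[OF that] nz(1)[OF that] by (simp add: s_def divide_eq_eq)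
  have e2': "Q.e' x ?l = s0 * P.e' x ?l" if x: "0 \<le> x" for x
  proof -
    have "((\<lambda>x. s0 * e x ?l) has_vector_derivative s0 * P.e' x ?l) (at x within {0..})"
      using sl_solD(2)[OF P.e_sol[OF l(1)] x] by (rule has_vector_derivative_mult_right)
    then have "((\<lambda>x. e2 x ?l) has_vector_derivative s0 * P.e' x ?l) (at x within {0..})"
      by (rule has_vector_derivative_transform[rotated 2]) (use x e2 in auto)
    then show ?thesis unfolding Q.e'_def by (rule P.vector_derivative_half_line[OF _ x])
  qed
  define h where "h = (\<lambda>t. (of_real (q2 t) - of_real (q t)) * e2 t ?l)"
  have h: "(h has_integral 0) {c..d}" if c: "0 \<le> c" for c d
  proof (cases "c \<le> d")
    case True
    have "((\<lambda>t. s0 * (P.wt ?l t * e t ?l)) has_integral s0 * (P.e' d ?l - P.e' c ?l)) {c..d}"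
      by (intro has_integral_mult_right sl_solD(3)[OF P.e_sol[OF l(1)] c True])
    from has_integral_diff[OF sl_solD(3)[OF Q.e_sol[OF l(1)] c True] this]
    have "((\<lambda>t. Q.wt ?l t * e2 t ?l - s0 * (P.wt ?l t * e t ?l)) has_integral 0) {c..d}"
      using e2'[of c] e2'[of d] c True by (simp add: right_diff_distrib)
    then show ?thesis
      by (rule has_integral_eq[rotated]) (use c e2 in \<open>auto simp: h_def P.wt_def Q.wt_def algebra_simps\<close>)
  qed auto
  \<comment> \<open>Extended by 0, because the differentiation theorem is for functions on the whole
    line.\<close>
  define f where "f = (\<lambda>t. if t \<in> {0..} then h t else 0)"
  have f: "(f has_integral 0) {c..d}" for c d
  proof -
    have "{0..} \<inter> {c..d} = {max 0 c..d}" by auto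
    then show ?thesis
      unfolding f_def has_integral_restrict_Int using h[of "max 0 c" d] by simp
  qed
  then have "f integrable_on cbox c d" for c d by auto
  then obtain N where N: "negligible N"
    "\<And>x e. x \<notin> N \<Longrightarrow> 0 < e \<Longrightarrow> \<exists>d>0. \<forall>h. 0 < h \<and> h < d \<longrightarrow>
       norm (integral (cbox x (x + h *\<^sub>R One)) f /\<^sub>R h ^ DIM(real) - f x) < e"
    using integrable_ccontinuous_explicit by blast
  have f_zero: "f x = 0" if xN: "x \<notin> N" for x
  proof (rule ccontr)
    assume "f x \<noteq> 0"
    then obtain d where d: "d > 0" "\<And>h. 0 < h \<Longrightarrow> h < d \<Longrightarrow>
       norm (integral (cbox x (x + h *\<^sub>R One)) f /\<^sub>R h ^ DIM(real) - f x) < norm (f x)"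
      using N(2)[OF xN, of "norm (f x)"] by auto
    from d(2)[of "d/2"] d(1) show False using integral_unique[OF f] by simp
  qed
  have "q x = q2 x" if "x \<notin> N" "0 \<le> x" for x
    using f_zero[OF that(1)] that nz(2)[of x] by (simp add: f_def h_def)
  moreover have "AE x in lebesgue. x \<notin> N"
    using N(1) by (intro AE_not_in) (simp add: negligible_iff_null_sets)
  ultimately show ?thesis by (auto elim: eventually_mono)
qed

end

section \<open>Boundary polynomials with common zeros\<close>

lemma delta_zero_proportional:
  assumes "delta1 \<alpha>s \<beta>s = 0" "delta2 \<alpha>s \<beta>s = 0" "delta3 \<alpha>s \<beta>s = 0"
    and nz: "\<exists>i\<in>{0,1,2}. \<alpha>s i \<noteq> 0 \<or> \<beta>s i \<noteq> 0"
  obtains p :: "nat \<Rightarrow> real" and a0 b0 :: real where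
    "a0 \<noteq> 0 \<or> b0 \<noteq> 0" "\<exists>i\<in>{0,1,2}. p i \<noteq> 0"
    "\<And>l. bc_poly \<alpha>s l = of_real a0 * bc_poly p l" "\<And>l. bc_poly \<beta>s l = of_real b0 * bc_poly p l"
proof (cases "\<exists>i\<in>{0,1,2}. \<alpha>s i \<noteq> 0")
  case True
  then obtain j where j: "j \<in> {0,1,2}" "\<alpha>s j \<noteq> 0" by blast
  \<comment> \<open>The three delta are the 2 by 2 minors of the coefficient matrix; if they vanish,
    its rows are proportional.\<close>
  have b: "\<beta>s i = \<beta>s j / \<alpha>s j * \<alpha>s i" if "i \<in> {0,1,2}" for i
    using that j assms(1-3) by (auto simp: delta1_def delta2_def delta3_def field_simps)
  show thesis
  proof (rule that[of 1 "\<beta>s j / \<alpha>s j" \<alpha>s])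
    show "bc_poly \<beta>s l = of_real (\<beta>s j / \<alpha>s j) * bc_poly \<alpha>s l" for l
      using b[of 0] b[of 1] b[of 2] unfolding bc_poly_def
      by (simp only: insert_iff simp_thms) (simp only: of_real_mult distrib_left mult_ac)
  qed (use True in auto)
next
  case False
  show thesis
  proof (rule that[of 0 1 \<beta>s])
    show "bc_poly \<alpha>s l = of_real 0 * bc_poly \<beta>s l" for l
      using False by (simp add: bc_poly_def)
  qed (use False nz in auto)
qed

lemma finite_real_zeros_bc_poly:
  assumes "\<exists>i\<in>{0,1,2}. p i \<noteq> 0"
  shows "finite {r. bc_poly p (of_real r) = 0}"
proof -
  have sub: "{r. bc_poly p (of_real r) = 0} \<subseteq> {r. p 0 + p 2 * r\<^sup>2 = 0 \<and> p 1 * r = 0}"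
    by (auto simp: bc_poly_def complex_eq_iff power2_eq_square)
  show ?thesis
  proof (cases "p 1 = 0")
    case True
    then have "[:p 0, 0, p 2:] \<noteq> 0" using assms by auto
    then have "finite {r. poly [:p 0, 0, p 2:] r = 0}" by (rule poly_roots_finite)
    then show ?thesis by (rule finite_subset[rotated]) (use sub in \<open>auto simp: power2_eq_square mult_ac\<close>)
  next
    case False
    then have "{r. bc_poly p (of_real r) = 0} \<subseteq> {0}" using sub by auto
    then show ?thesis by (rule finite_subset) simp
  qed
qed

text \<open>A common zero makes a sum of three terms of one sign vanish, so each term vanishes. On
  the imaginary axis the sum is the Wronskian of the two polynomials, elsewhere it comes from Im (A
  cnj B).\<close>

lemma bc_poly_common_zero:
  assumes delta: "delta1 \<alpha>s \<beta>s \<le> 0" "delta2 \<alpha>s \<beta>s \<le> 0" "delta3 \<alpha>s \<beta>s \<ge> 0"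
    and l: "0 \<le> Im l" "l \<noteq> 0" and z: "bc_poly \<alpha>s l = 0" "bc_poly \<beta>s l = 0"
  shows "delta1 \<alpha>s \<beta>s = 0 \<and> delta2 \<alpha>s \<beta>s = 0 \<and> delta3 \<alpha>s \<beta>s = 0"
proof (cases "Re l = 0")
  case True
  define \<kappa> where "\<kappa> = Im l"
  have \<kappa>: "0 < \<kappa>" and lk: "l = \<i> * of_real \<kappa>" using l True by (auto simp: \<kappa>_def complex_eq_iff)
  have A: "\<alpha>s 0 - \<alpha>s 1 * \<kappa> - \<alpha>s 2 * \<kappa>\<^sup>2 = 0" and B: "\<beta>s 0 - \<beta>s 1 * \<kappa> - \<beta>s 2 * \<kappa>\<^sup>2 = 0"
    using z by (auto simp: lk bc_poly_def complex_eq_iff power2_eq_square)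
  have "delta1 \<alpha>s \<beta>s + 2 * delta2 \<alpha>s \<beta>s * \<kappa> - delta3 \<alpha>s \<beta>s * \<kappa>\<^sup>2
    = (\<beta>s 1 + 2 * \<beta>s 2 * \<kappa>) * (\<alpha>s 0 - \<alpha>s 1 * \<kappa> - \<alpha>s 2 * \<kappa>\<^sup>2) - (\<alpha>s 1 + 2 * \<alpha>s 2 * \<kappa>) * (\<beta>s 0 - \<beta>s 1 * \<kappa> - \<beta>s 2 * \<kappa>\<^sup>2)"
    by (simp add: delta1_def delta2_def delta3_def power2_eq_square algebra_simps)
  then have sum: "delta1 \<alpha>s \<beta>s + 2 * (delta2 \<alpha>s \<beta>s * \<kappa>) - delta3 \<alpha>s \<beta>s * \<kappa>\<^sup>2 = 0" unfolding A B by simp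
  have "delta2 \<alpha>s \<beta>s * \<kappa> \<le> 0" "0 \<le> delta3 \<alpha>s \<beta>s * \<kappa>\<^sup>2" using delta \<kappa> by (auto intro: mult_nonpos_nonneg)
  then have "delta1 \<alpha>s \<beta>s = 0" "delta2 \<alpha>s \<beta>s * \<kappa> = 0" "delta3 \<alpha>s \<beta>s * \<kappa>\<^sup>2 = 0" using sum delta by linarith+
  then show ?thesis using \<kappa> by simp
next
  case False
  have "Im (bc_poly \<alpha>s l * cnj (bc_poly \<beta>s l))
     = Re l * (- delta1 \<alpha>s \<beta>s - 2 * delta2 \<alpha>s \<beta>s * Im l + delta3 \<alpha>s \<beta>s * ((Re l)\<^sup>2 + (Im l)\<^sup>2))"
    by (simp add: bc_poly_def delta1_def delta2_def delta3_def power2_eq_square algebra_simps)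
  then have sum: "- delta1 \<alpha>s \<beta>s - 2 * (delta2 \<alpha>s \<beta>s * Im l) + delta3 \<alpha>s \<beta>s * ((Re l)\<^sup>2 + (Im l)\<^sup>2) = 0"
    using z False by simp
  have pos: "0 < (Re l)\<^sup>2 + (Im l)\<^sup>2" using False by (simp add: sum_power2_gt_zero_iff)
  have "delta2 \<alpha>s \<beta>s * Im l \<le> 0" "0 \<le> delta3 \<alpha>s \<beta>s * ((Re l)\<^sup>2 + (Im l)\<^sup>2)"
    using delta l pos by (auto intro: mult_nonpos_nonneg)
  then have d: "delta1 \<alpha>s \<beta>s = 0" "delta2 \<alpha>s \<beta>s * Im l = 0" "delta3 \<alpha>s \<beta>s * ((Re l)\<^sup>2 + (Im l)\<^sup>2) = 0"
    using sum delta by linarith+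
  \<comment> \<open>On the real line the term with delta2 carries the factor Im l = 0, so the real
    parts of the two equations are used instead.\<close>
  have "delta2 \<alpha>s \<beta>s = 0"
  proof (cases "Im l = 0")
    case True
    then have "\<alpha>s 0 = - (\<alpha>s 2 * (Re l)\<^sup>2)" "\<beta>s 0 = - (\<beta>s 2 * (Re l)\<^sup>2)"
      using z by (auto simp: bc_poly_def complex_eq_iff power2_eq_square)
    then show ?thesis by (simp add: delta2_def)
  qed (use d in auto)
  then show ?thesis using d False by simp
qed

lemma infinite_upper_half_plane: "infinite {l :: complex. 0 < Im l}"
proof
  assume "finite {l :: complex. 0 < Im l}"
  moreover have "(\<lambda>n. Complex 0 (real (Suc n))) ` UNIV \<subseteq> {l. 0 < Im l}" by auto
  ultimately have "finite ((\<lambda>n. Complex 0 (real (Suc n))) ` UNIV)" using finite_subset by blast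
  moreover have "inj (\<lambda>n. Complex 0 (real (Suc n)))" by (auto simp: inj_def)
  ultimately show False using finite_imageD infinite_UNIV_nat by blast
qed

theorem corollary6:
  fixes a \<alpha> :: real and \<alpha>s \<beta>s :: "nat \<Rightarrow> real"
    and q q_tilde :: "real \<Rightarrow> real"
    and S :: "real \<Rightarrow> complex" and n :: nat and lam m :: "nat \<Rightarrow> real"
  assumes "a > 0" and "\<alpha> > 0" and "\<alpha> \<noteq> 1"
    and "delta1 \<alpha>s \<beta>s \<le> 0" and "delta2 \<alpha>s \<beta>s \<le> 0" and "delta3 \<alpha>s \<beta>s \<ge> 0"
    and "q \<in> borel_measurable (lebesgue_on {0..})"
    and "set_integrable lebesgue {0..} (\<lambda>x. (1 + x) * \<bar>q x\<bar>)"
    and "q_tilde \<in> borel_measurable (lebesgue_on {0..})"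
    and "set_integrable lebesgue {0..} (\<lambda>x. (1 + x) * \<bar>q_tilde x\<bar>)"
    and "scattering_data a \<alpha> \<alpha>s \<beta>s q S n lam m"
    and "scattering_data a \<alpha> \<alpha>s \<beta>s q_tilde S n lam m"
  shows "AE x in lebesgue. x \<ge> 0 \<longrightarrow> q x = q_tilde x"
proof -
  obtain e where e: "jost_solution a \<alpha> q e" "\<And>r. r \<noteq> 0 \<Longrightarrow> S r = S_fun \<alpha>s \<beta>s e r"
    "\<forall>k\<in>{1..n}. lam k > 0"
    "{l. Im l > 0 \<and> E_fun \<alpha>s \<beta>s e l = 0} = (\<lambda>k. \<i> * of_real (lam k)) ` {1..n}"
    "\<And>k. k \<in> {1..n} \<Longrightarrow> deriv (E_fun \<alpha>s \<beta>s e) (\<i> * of_real (lam k)) \<noteq> 0"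
    "\<And>k. k \<in> {1..n} \<Longrightarrow> norming_den \<beta>s (lam k) = 0 \<longrightarrow> norming_num \<alpha>s \<beta>s (lam k) = 0"
    "\<And>k. k \<in> {1..n} \<Longrightarrow> 1 / (m k)\<^sup>2 = norming_value a \<alpha> \<alpha>s \<beta>s e (lam k)"
    using assms(11) unfolding scattering_data_def by blast
  obtain e2 where e2: "jost_solution a \<alpha> q_tilde e2" "\<And>r. r \<noteq> 0 \<Longrightarrow> S r = S_fun \<alpha>s \<beta>s e2 r"
    "{l. Im l > 0 \<and> E_fun \<alpha>s \<beta>s e2 l = 0} = (\<lambda>k. \<i> * of_real (lam k)) ` {1..n}"
    "\<And>k. k \<in> {1..n} \<Longrightarrow> deriv (E_fun \<alpha>s \<beta>s e2) (\<i> * of_real (lam k)) \<noteq> 0"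
    "\<And>k. k \<in> {1..n} \<Longrightarrow> 1 / (m k)\<^sup>2 = norming_value a \<alpha> \<alpha>s \<beta>s e2 (lam k)"
    using assms(12) unfolding scattering_data_def by blast
  define K where "K = lam ` {1..n}"
  have K: "(\<lambda>k. \<i> * complex_of_real (lam k)) ` {1..n} = (\<lambda>\<kappa>. \<i> * of_real \<kappa>) ` K"
    by (simp add: K_def image_image)
  have Kpos: "0 < \<kappa>" if "\<kappa> \<in> K" for \<kappa> using that e(3) by (auto simp: K_def)
  have nv: "norming_value a \<alpha> \<alpha>s \<beta>s e \<kappa> = norming_value a \<alpha> \<alpha>s \<beta>s e2 \<kappa>" if "\<kappa> \<in> K" for \<kappa>
    using that e(7) e2(5) by (force simp: K_def)
  interpret J1: jost_problem a \<alpha> q e by unfold_locales (use assms e(1) in auto)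
  interpret J2: jost_problem a \<alpha> q_tilde e2 by unfold_locales (use assms e2(1) in auto)
  show ?thesis
  proof (cases "delta1 \<alpha>s \<beta>s = 0 \<and> delta2 \<alpha>s \<beta>s = 0 \<and> delta3 \<alpha>s \<beta>s = 0")
    case False
    have nc: "bc_poly \<alpha>s l \<noteq> 0 \<or> bc_poly \<beta>s l \<noteq> 0" if "0 \<le> Im l" "l \<noteq> 0" for l
      using bc_poly_common_zero[OF assms(4-6) that] False by blast
    interpret bc_pair a \<alpha> q e \<alpha>s \<beta>s q_tilde e2 K "{}"
    proof unfold_locales
      show "{l. 0 < Im l \<and> E_fun \<alpha>s \<beta>s e l = 0} = (\<lambda>\<kappa>. \<i> * of_real \<kappa>) ` K"
        "{l. 0 < Im l \<and> E_fun \<alpha>s \<beta>s e2 l = 0} = (\<lambda>\<kappa>. \<i> * of_real \<kappa>) ` K"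
        using e(4) e2(3) K by simp_all
      fix r :: real assume "r \<noteq> 0"
      then show "S_fun \<alpha>s \<beta>s e r = S_fun \<alpha>s \<beta>s e2 r" using e(2)[of r] e2(2)[of r] by simp
    next
      show "finite K" "finite {}" by (simp_all add: K_def)
      fix \<kappa> assume \<kappa>: "\<kappa> \<in> K"
      then obtain k where k: "k \<in> {1..n}" "\<kappa> = lam k" by (auto simp: K_def)
      show "0 < \<kappa>" by (rule Kpos[OF \<kappa>])
      show "deriv (E_fun \<alpha>s \<beta>s e) (\<i> * of_real \<kappa>) \<noteq> 0" unfolding k(2) by (rule e(5)[OF k(1)])
      show "norming_den \<beta>s \<kappa> = 0 \<longrightarrow> norming_num \<alpha>s \<beta>s \<kappa> = 0" unfolding k(2) by (rule e(6)[OF k(1)])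
      show "norming_value a \<alpha> \<alpha>s \<beta>s e \<kappa> = norming_value a \<alpha> \<alpha>s \<beta>s e2 \<kappa>" by (rule nv[OF \<kappa>])
    qed (fact assms(4-6) nc)+
    show ?thesis by (rule potentials_eq)
  next
    case True
    \<comment> \<open>The polynomials of the boundary condition have a common factor \<open>p\<close>, whose zeros are spurious zeros of \<open>E\<close>.
      Dividing by \<open>p\<close> leaves a boundary condition with constant coefficients.\<close>
    have nz: "\<exists>i\<in>{0,1,2}. \<alpha>s i \<noteq> 0 \<or> \<beta>s i \<noteq> 0"
    proof (rule ccontr)
      assume "\<not> ?thesis"
      then have "E_fun \<alpha>s \<beta>s e l = 0" for l by (simp add: E_fun_def bc_poly_def)
      then have "{l :: complex. 0 < Im l} = (\<lambda>k. \<i> * of_real (lam k)) ` {1..n}" using e(4) by simp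
      then show False using infinite_upper_half_plane by simp
    qed
    have d0: "delta1 \<alpha>s \<beta>s = 0" "delta2 \<alpha>s \<beta>s = 0" "delta3 \<alpha>s \<beta>s = 0" using True by auto
    obtain p a0 b0 where p: "a0 \<noteq> 0 \<or> b0 \<noteq> 0" "\<exists>i\<in>{0,1,2}. p i \<noteq> 0"
      "\<And>l. bc_poly \<alpha>s l = of_real a0 * bc_poly p l" "\<And>l. bc_poly \<beta>s l = of_real b0 * bc_poly p l"
      by (rule delta_zero_proportional[OF d0 nz]) (rule that)
    define \<alpha>s' \<beta>s' :: "nat \<Rightarrow> real" where "\<alpha>s' = (\<lambda>i. if i = 0 then a0 else 0)" and "\<beta>s' = (\<lambda>i. if i = 0 then b0 else 0)"
    have bc': "bc_poly \<alpha>s' l = of_real a0" "bc_poly \<beta>s' l = of_real b0" for l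
      by (simp_all add: bc_poly_def \<alpha>s'_def \<beta>s'_def)
    have d': "delta1 \<alpha>s' \<beta>s' = 0" "delta2 \<alpha>s' \<beta>s' = 0" "delta3 \<alpha>s' \<beta>s' = 0"
      by (simp_all add: delta1_def delta2_def delta3_def \<alpha>s'_def \<beta>s'_def)
    interpret B1: bc_problem a \<alpha> q e \<alpha>s' \<beta>s'
      by unfold_locales (use p(1) in \<open>simp_all add: d' bc'\<close>)
    interpret B2: bc_problem a \<alpha> q_tilde e2 \<alpha>s' \<beta>s'
      by unfold_locales (use p(1) in \<open>simp_all add: d' bc'\<close>)
    have E: "E_fun \<alpha>s \<beta>s u l = bc_poly p l * E_fun \<alpha>s' \<beta>s' u l" for u l
      by (simp add: E_fun_def bc' p(3,4) algebra_simps)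
    have num0: "norming_num \<alpha>s \<beta>s \<kappa> = 0" "norming_num \<alpha>s' \<beta>s' \<kappa> = 0" for \<kappa>
      using True d' by (simp_all add: norming_num_def)
    \<comment> \<open>The spurious zeros are discarded. As the zeros of \<open>E\<close> are simple,
      a zero of \<open>p\<close> is not also a zero of the reduced function, so no true zero is
      lost.\<close>
    define K' where "K' = {\<kappa>\<in>K. bc_poly p (\<i> * of_real \<kappa>) \<noteq> 0}"
    \<comment> \<open>At a real zero of \<open>p\<close> the quotient \<open>S_fun\<close> is 0 / 0
      = 0 and carries no information.\<close>
    define T where "T = {r. bc_poly p (of_real r) = 0}"
    have deriv_E: "deriv (E_fun \<alpha>s \<beta>s u) l = bc_poly p l * deriv (E_fun \<alpha>s' \<beta>s' u) l"
      if "E_fun \<alpha>s' \<beta>s' u holomorphic_on {l. 0 < Im l}" "0 < Im l" "E_fun \<alpha>s' \<beta>s' u l = 0" for u l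
    proof -
      have D: "(E_fun \<alpha>s' \<beta>s' u has_field_derivative deriv (E_fun \<alpha>s' \<beta>s' u) l) (at l)"
        using holomorphic_derivI[OF that(1) open_halfspace_Im_gt] that(2) by simp
      have "((\<lambda>l. bc_poly p l * E_fun \<alpha>s' \<beta>s' u l) has_field_derivative bc_poly p l * deriv (E_fun \<alpha>s' \<beta>s' u) l) (at l)"
        using DERIV_mult[OF B1.bc_poly_deriv[of p l] D] that(3) by (simp add: mult.commute[of "bc_poly p l"])
      then have "deriv (\<lambda>l. bc_poly p l * E_fun \<alpha>s' \<beta>s' u l) l = bc_poly p l * deriv (E_fun \<alpha>s' \<beta>s' u) l"
        by (rule DERIV_imp_deriv)
      then show ?thesis by (simp add: E[abs_def])
    qed
    have zeros: "{l. 0 < Im l \<and> E_fun \<alpha>s' \<beta>s' u l = 0} = (\<lambda>\<kappa>. \<i> * of_real \<kappa>) ` K'"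
      if hol: "E_fun \<alpha>s' \<beta>s' u holomorphic_on {l. 0 < Im l}"
        and z: "{l. Im l > 0 \<and> E_fun \<alpha>s \<beta>s u l = 0} = (\<lambda>\<kappa>. \<i> * of_real \<kappa>) ` K"
        and s: "\<And>\<kappa>. \<kappa> \<in> K \<Longrightarrow> deriv (E_fun \<alpha>s \<beta>s u) (\<i> * of_real \<kappa>) \<noteq> 0" for u
    proof (intro subset_antisym subsetI)
      fix l assume "l \<in> {l. 0 < Im l \<and> E_fun \<alpha>s' \<beta>s' u l = 0}"
      then have l: "0 < Im l" "E_fun \<alpha>s' \<beta>s' u l = 0" by auto
      then have "l \<in> {l. Im l > 0 \<and> E_fun \<alpha>s \<beta>s u l = 0}" by (simp add: E)
      then obtain \<kappa> where \<kappa>: "\<kappa> \<in> K" "l = \<i> * of_real \<kappa>" unfolding z by auto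
      have "bc_poly p l \<noteq> 0" using s[OF \<kappa>(1)] deriv_E[OF hol l] \<kappa>(2) by auto
      then show "l \<in> (\<lambda>\<kappa>. \<i> * of_real \<kappa>) ` K'" using \<kappa> by (auto simp: K'_def)
    next
      fix l assume "l \<in> (\<lambda>\<kappa>. \<i> * complex_of_real \<kappa>) ` K'"
      then have l: "l \<in> (\<lambda>\<kappa>. \<i> * of_real \<kappa>) ` K" "bc_poly p l \<noteq> 0" by (auto simp: K'_def)
      then have "l \<in> {l. Im l > 0 \<and> E_fun \<alpha>s \<beta>s u l = 0}" unfolding z by simp
      then show "l \<in> {l. 0 < Im l \<and> E_fun \<alpha>s' \<beta>s' u l = 0}" using l(2) by (simp add: E)
    qed
    have s1: "deriv (E_fun \<alpha>s \<beta>s e) (\<i> * of_real \<kappa>) \<noteq> 0" "deriv (E_fun \<alpha>s \<beta>s e2) (\<i> * of_real \<kappa>) \<noteq> 0"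
      if "\<kappa> \<in> K" for \<kappa> using that e(5) e2(4) by (auto simp: K_def)
    have z1: "{l. 0 < Im l \<and> E_fun \<alpha>s' \<beta>s' e l = 0} = (\<lambda>\<kappa>. \<i> * of_real \<kappa>) ` K'"
      by (rule zeros[OF B1.E_holomorphic]) (use e(4) K s1 in auto)
    have z2: "{l. 0 < Im l \<and> E_fun \<alpha>s' \<beta>s' e2 l = 0} = (\<lambda>\<kappa>. \<i> * of_real \<kappa>) ` K'"
      by (rule zeros[OF B2.E_holomorphic]) (use e2(3) K s1 in auto)
    have S': "S_fun \<alpha>s' \<beta>s' u r = S_fun \<alpha>s \<beta>s u r" if "r \<notin> T" for u r
    proof -
      have "bc_poly p (of_real r) \<noteq> 0" using that by (simp add: T_def)
      moreover have "S_fun \<alpha>s \<beta>s u r = (bc_poly p (of_real r) * (of_real b0 * cnj (deriv0 u (of_real r)) + of_real a0 * cnj (u 0 (of_real r))))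
          / (bc_poly p (of_real r) * E_fun \<alpha>s' \<beta>s' u (of_real r))"
        by (simp add: S_fun_def E p(3,4) algebra_simps)
      ultimately show ?thesis by (simp add: S_fun_def bc')
    qed
    interpret bc_pair a \<alpha> q e \<alpha>s' \<beta>s' q_tilde e2 K' T
    proof unfold_locales
      show "finite K'" by (simp add: K'_def K_def)
      show "finite T" unfolding T_def by (rule finite_real_zeros_bc_poly[OF p(2)])
      show "{l. 0 < Im l \<and> E_fun \<alpha>s' \<beta>s' e l = 0} = (\<lambda>\<kappa>. \<i> * of_real \<kappa>) ` K'" by (rule z1)
      show "{l. 0 < Im l \<and> E_fun \<alpha>s' \<beta>s' e2 l = 0} = (\<lambda>\<kappa>. \<i> * of_real \<kappa>) ` K'" by (rule z2)
      fix r assume r: "r \<noteq> 0" "r \<notin> T"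
      show "S_fun \<alpha>s' \<beta>s' e r = S_fun \<alpha>s' \<beta>s' e2 r"
        unfolding S'[OF r(2)] using e(2)[OF r(1)] e2(2)[OF r(1)] by simp
    next
      fix \<kappa> assume \<kappa>: "\<kappa> \<in> K'"
      then have \<kappa>K: "\<kappa> \<in> K" by (simp add: K'_def)
      show "0 < \<kappa>" by (rule Kpos[OF \<kappa>K])
      show "norming_den \<beta>s' \<kappa> = 0 \<longrightarrow> norming_num \<alpha>s' \<beta>s' \<kappa> = 0" by (simp add: num0)
      \<comment> \<open>All delta are 0 for the original and for the reduced condition, so their
        norming values are the same integral.\<close>
      show "norming_value a \<alpha> \<alpha>s' \<beta>s' e \<kappa> = norming_value a \<alpha> \<alpha>s' \<beta>s' e2 \<kappa>"
        using nv[OF \<kappa>K] by (simp add: norming_value_def num0)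
      have "E_fun \<alpha>s' \<beta>s' e (\<i> * of_real \<kappa>) = 0" using z1 \<kappa> by blast
      then show "deriv (E_fun \<alpha>s' \<beta>s' e) (\<i> * of_real \<kappa>) \<noteq> 0"
        using deriv_E[OF B1.E_holomorphic, of "\<i> * of_real \<kappa>"] s1(1)[OF \<kappa>K] Kpos[OF \<kappa>K] by auto
    qed
    show ?thesis by (rule potentials_eq)
  qed
qed

end
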